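(* Let $\Gamma$ be a finitely generated hyperbolic group and let $\Lambda$ be a finitely generated group. For every $p>q>0$, if there is a cobounded $(\varphi,\psi)$-integrable measure equivalence coupling from $\Gamma$ to $\Lambda$, where $\varphi(t)=\exp(t^p)$ and $\psi(t)=t^{1+1/q}$, then $\Lambda$ is also hyperbolic.
   Context: A geodesic metric space $(X,d)$ is $\delta$-hyperbolic ($\delta\ge 0$) if each side of every geodesic triangle is contained in the $\delta$-neighbourhood of the union of the other two sides; it is hyperbolic if it is $\delta$-hyperbolic for some $\delta$. A finitely generated group is hyperbolic if its Cayley graph with respect to a finite generating set, with edges identified with unit intervals and endowed with the path metric, is hyperbolic. A measure equivalence coupling from a countable group $\Gamma$ to a countable group $\Lambda$ is a tuple $(\Omega,\mu,X_\Gamma,X_\Lambda)$ where $(\Omega,\mu)$ is a nonzero $\sigma$-finite standard measured space endowed with commuting free measure-preserving actions of $\Gamma$ and $\Lambda$ (both denoted $*$), and $X_\Gamma$, $X_\Lambda\subseteq\Omega$ are finite measure fundamental domains for the $\Gamma$-action and the $\Lambda$-action respectively. Here a fundamental domain for the $\Gamma$-action is a measurable subset $X_\Gamma\subseteq\Omega$ such that $\Gamma\times X_\Gamma\to\Omega$, $(\gamma,x)\mapsto\gamma*x$, is a measure-preserving bijection for the product of counting measure and $\mu|_{X_\Gamma}$ (similarly for $\Lambda$). The associated cocycles $\alpha:\Gamma\times X_\Lambda\to\Lambda$ and $\beta:\Lambda\times X_\Gamma\to\Gamma$ are uniquely defined by $\alpha(\gamma,x)*(\gamma*x)\in X_\Lambda$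 for $\gamma\in\Gamma$, $x\in X_\Lambda$, and $\beta(\lambda,x)*(\lambda*x)\in X_\Gamma$ for $\lambda\in\Lambda$, $x\in X_\Gamma$. The coupling is cobounded if $X_\Gamma$ is contained in the union of finitely many $\Lambda$-translates of $X_\Lambda$. Let $S_\Gamma,S_\Lambda$ be finite generating sets of $\Gamma,\Lambda$ with word lengths $|\cdot|_{S_\Gamma},|\cdot|_{S_\Lambda}$. For non-decreasing $\varphi,\psi:\mathbb{R}_{\ge0}\to\mathbb{R}_{\ge0}$, the coupling is $(\varphi,\psi)$-integrable if there is $c>0$ such that $\int_{X_\Lambda}\varphi(c|\alpha(s,x)|_{S_\Lambda})\,d\mu(x)<+\infty$ for all $s\in S_\Gamma$ and $\int_{X_\Gamma}\psi(c|\beta(t,x)|_{S_\Gamma})\,d\mu(x)<+\infty$ for all $t\in S_\Lambda$. (This does not depend on the choice of finite generating sets.) *)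

theory Defs
  imports "HOL-Analysis.Analysis" "HOL-Algebra.Group_Action" "HOL-Algebra.Generated_Groups"
begin

section \<open>Hyperbolic metric spaces\<close>

definition geodesic_segment :: "'x set \<Rightarrow> ('x \<Rightarrow> 'x \<Rightarrow> real) \<Rightarrow> 'x set \<Rightarrow> 'x \<Rightarrow> 'x \<Rightarrow> bool" where
  "geodesic_segment X d A x y \<longleftrightarrow>
     (\<exists>(l::real) c. 0 \<le> l \<and> c \<in> {0..l} \<rightarrow> X \<and> c 0 = x \<and> c l = y \<and>
        (\<forall>s\<in>{0..l}. \<forall>t\<in>{0..l}. d (c s) (c t) = \<bar>s - t\<bar>) \<and> A = c ` {0..l})"

definition geodesic_space :: "'x set \<Rightarrow> ('x \<Rightarrow> 'x \<Rightarrow> real) \<Rightarrow> bool" where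
  "geodesic_space X d \<longleftrightarrow>
     Metric_space X d \<and> (\<forall>x\<in>X. \<forall>y\<in>X. \<exists>A. geodesic_segment X d A x y)"

text \<open>Geodesic segments are compact, so being at distance at most \<open>\<delta>\<close> from some point of
  \<open>B \<union> C\<close> is the same as being at distance at most \<open>\<delta>\<close> from the set \<open>B \<union> C\<close>. The three sides
  are covered by cyclically relabelling the vertices.\<close>

definition delta_hyperbolic :: "real \<Rightarrow> 'x set \<Rightarrow> ('x \<Rightarrow> 'x \<Rightarrow> real) \<Rightarrow> bool" where
  "delta_hyperbolic \<delta> X d \<longleftrightarrow> geodesic_space X d \<and>
     (\<forall>x\<in>X. \<forall>y\<in>X. \<forall>z\<in>X. \<forall>A B C.
        geodesic_segment X d A x y \<and> geodesic_segment X d B y z \<and> geodesic_segment X d C z x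
        \<longrightarrow> (\<forall>a\<in>A. \<exists>b\<in>B \<union> C. d a b \<le> \<delta>))"

definition hyperbolic_space :: "'x set \<Rightarrow> ('x \<Rightarrow> 'x \<Rightarrow> real) \<Rightarrow> bool" where
  "hyperbolic_space X d \<longleftrightarrow> (\<exists>\<delta>\<ge>0. delta_hyperbolic \<delta> X d)"


section \<open>Geometric realization of a simple graph\<close>

text \<open>An edge is a two-element set of vertices. Points of the realization are given by their
  barycentric coordinates; \<open>cell {v}\<close> is the single point \<open>v\<close> and \<open>cell {u, v}\<close>, for
  \<open>u \<noteq> v\<close>, is a copy of the unit interval, parametrised by the coordinate \<open>x v\<close>.\<close>

definition cell :: "'a set \<Rightarrow> ('a \<Rightarrow> real) set" where
  "cell e = {x. (\<forall>v. 0 \<le> x v) \<and> (\<forall>v. v \<notin> e \<longrightarrow> x v = 0) \<and> (\<Sum>v\<in>e. x v) = 1}"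

definition cells :: "'a set \<Rightarrow> 'a set set \<Rightarrow> 'a set set" where
  "cells V E = (\<lambda>v. {v}) ` V \<union> E"

definition realization :: "'a set \<Rightarrow> 'a set set \<Rightarrow> ('a \<Rightarrow> real) set" where
  "realization V E = (\<Union>e\<in>cells V E. cell e)"

text \<open>On \<open>cell {u, v}\<close> we have \<open>x u = 1 - x v\<close>, so the half sum below equals
  \<open>\<bar>x v - y v\<bar>\<close>, the distance in the unit interval.\<close>

definition cell_dist :: "'a set \<Rightarrow> ('a \<Rightarrow> real) \<Rightarrow> ('a \<Rightarrow> real) \<Rightarrow> real" where
  "cell_dist e x y = (\<Sum>v\<in>e. \<bar>x v - y v\<bar>) / 2"

text \<open>\<open>pl_path V E x y l\<close>: there is a piecewise linear path of length \<open>l\<close> from \<open>x\<close> to \<open>y\<close>.\<close>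

inductive pl_path ::
    "'a set \<Rightarrow> 'a set set \<Rightarrow> ('a \<Rightarrow> real) \<Rightarrow> ('a \<Rightarrow> real) \<Rightarrow> real \<Rightarrow> bool"
  for V E where
  refl: "x \<in> realization V E \<Longrightarrow> pl_path V E x x 0"
| step: "pl_path V E x y l \<Longrightarrow> e \<in> cells V E \<Longrightarrow> y \<in> cell e \<Longrightarrow> z \<in> cell e
          \<Longrightarrow> pl_path V E x z (l + cell_dist e y z)"

text \<open>The path metric. The value 0 when no path exists is a convention: \<open>Metric_space\<close> requires
  a symmetric nonnegative function on the whole type. It cannot make a disconnected graph
  a metric space, since distinct points would be at distance 0.\<close>

definition path_dist ::
    "'a set \<Rightarrow> 'a set set \<Rightarrow> ('a \<Rightarrow> real) \<Rightarrow> ('a \<Rightarrow> real) \<Rightarrow> real" where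
  "path_dist V E x y =
     (if \<exists>l. pl_path V E x y l then Inf {l. pl_path V E x y l} else 0)"


section \<open>Finitely generated and hyperbolic groups\<close>

definition finite_generating_set :: "('g, 'm) monoid_scheme \<Rightarrow> 'g set \<Rightarrow> bool" where
  "finite_generating_set G S \<longleftrightarrow> finite S \<and> S \<subseteq> carrier G \<and> generate G S = carrier G"

text \<open>The generating set need not be symmetric; edges are unoriented, without loops or
  multiplicities (so a generator equal to the identity contributes nothing).\<close>

definition cayley_edges :: "('g, 'm) monoid_scheme \<Rightarrow> 'g set \<Rightarrow> 'g set set" where
  "cayley_edges G S =
     {{g, g \<otimes>\<^bsub>G\<^esub> s} | g s. g \<in> carrier G \<and> s \<in> S \<and> g \<otimes>\<^bsub>G\<^esub> s \<noteq> g}"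

definition hyperbolic_group :: "('g, 'm) monoid_scheme \<Rightarrow> bool" where
  "hyperbolic_group G \<longleftrightarrow> group G \<and>
     (\<exists>S. finite_generating_set G S \<and>
        hyperbolic_space (realization (carrier G) (cayley_edges G S))
                         (path_dist (carrier G) (cayley_edges G S)))"

definition word_length :: "('g, 'm) monoid_scheme \<Rightarrow> 'g set \<Rightarrow> 'g \<Rightarrow> nat" where
  "word_length G S g =
     (LEAST n. \<exists>w. set w \<subseteq> S \<union> (\<lambda>s. inv\<^bsub>G\<^esub> s) ` S \<and> length w = n \<and>
                   foldr (\<lambda>a b. a \<otimes>\<^bsub>G\<^esub> b) w \<one>\<^bsub>G\<^esub> = g)"


section \<open>Measure equivalence couplings\<close>

text \<open>Standard Borel: the \<open>\<sigma>\<close>-algebra is generated by a Polish topology.\<close>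

definition standard_measurable_space :: "'w measure \<Rightarrow> bool" where
  "standard_measurable_space M \<longleftrightarrow>
     (\<exists>T. topspace T = space M \<and> completely_metrizable_space T \<and> second_countable T \<and>
          sets M = sigma_sets (space M) {U. openin T U})"

definition measure_preserving :: "'a measure \<Rightarrow> 'b measure \<Rightarrow> ('a \<Rightarrow> 'b) \<Rightarrow> bool" where
  "measure_preserving M N f \<longleftrightarrow> f \<in> measurable M N \<and> distr M N f = N"

locale free_mp_action = group_action G "space M" \<rho>
  for G :: "('g, 'm) monoid_scheme" (structure) and M :: "'w measure"
    and \<rho> :: "'g \<Rightarrow> 'w \<Rightarrow> 'w" +
  assumes countable_group: "countable (carrier G)"
    and measure_preserving: "g \<in> carrier G \<Longrightarrow> measure_preserving M M (\<rho> g)"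
    and free: "g \<in> carrier G \<Longrightarrow> x \<in> space M \<Longrightarrow> \<rho> g x = x \<Longrightarrow> g = \<one>"

definition fundamental_domain ::
    "('g, 'm) monoid_scheme \<Rightarrow> 'w measure \<Rightarrow> ('g \<Rightarrow> 'w \<Rightarrow> 'w) \<Rightarrow> 'w set \<Rightarrow> bool" where
  "fundamental_domain G M \<rho> X \<longleftrightarrow> X \<in> sets M \<and>
     bij_betw (\<lambda>(g, x). \<rho> g x) (carrier G \<times> X) (space M) \<and>
     measure_preserving (count_space (carrier G) \<Otimes>\<^sub>M restrict_space M X) M (\<lambda>(g, x). \<rho> g x)"

locale me_coupling =
  sigma_finite_measure M + \<Gamma>: free_mp_action \<Gamma> M \<rho> + \<Lambda>: free_mp_action \<Lambda> M \<sigma>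
  for \<Gamma> :: "('g, 'm) monoid_scheme" and \<Lambda> :: "('l, 'n) monoid_scheme"
    and M :: "'w measure"
    and \<rho> :: "'g \<Rightarrow> 'w \<Rightarrow> 'w" and \<sigma> :: "'l \<Rightarrow> 'w \<Rightarrow> 'w"
    and X\<^sub>\<Gamma> X\<^sub>\<Lambda> :: "'w set" +
  assumes standard: "standard_measurable_space M"
    and nonzero: "emeasure M (space M) \<noteq> 0"
    and commuting: "\<lbrakk>g \<in> carrier \<Gamma>; h \<in> carrier \<Lambda>; x \<in> space M\<rbrakk> \<Longrightarrow> \<rho> g (\<sigma> h x) = \<sigma> h (\<rho> g x)"
    and domain_\<Gamma>: "fundamental_domain \<Gamma> M \<rho> X\<^sub>\<Gamma>" "emeasure M X\<^sub>\<Gamma> < \<infinity>"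
    and domain_\<Lambda>: "fundamental_domain \<Lambda> M \<sigma> X\<^sub>\<Lambda>" "emeasure M X\<^sub>\<Lambda> < \<infinity>"

text \<open>For a coupling as above, the cocycle \<open>\<alpha> : \<Gamma> \<times> X\<^sub>\<Lambda> \<rightarrow> \<Lambda>\<close> is \<open>cocycle \<rho> \<Lambda> \<sigma> X\<^sub>\<Lambda>\<close>
  and \<open>\<beta> : \<Lambda> \<times> X\<^sub>\<Gamma> \<rightarrow> \<Gamma>\<close> is \<open>cocycle \<sigma> \<Gamma> \<rho> X\<^sub>\<Gamma>\<close>.\<close>

definition cocycle ::
    "('g \<Rightarrow> 'w \<Rightarrow> 'w) \<Rightarrow> ('l, 'n) monoid_scheme \<Rightarrow> ('l \<Rightarrow> 'w \<Rightarrow> 'w) \<Rightarrow> 'w set \<Rightarrow> 'g \<Rightarrow> 'w \<Rightarrow> 'l" where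
  "cocycle \<rho> \<Lambda> \<sigma> X g x = (THE h. h \<in> carrier \<Lambda> \<and> \<sigma> h (\<rho> g x) \<in> X)"

definition cobounded ::
    "('l, 'n) monoid_scheme \<Rightarrow> ('l \<Rightarrow> 'w \<Rightarrow> 'w) \<Rightarrow> 'w set \<Rightarrow> 'w set \<Rightarrow> bool" where
  "cobounded \<Lambda> \<sigma> X\<^sub>\<Gamma> X\<^sub>\<Lambda> \<longleftrightarrow>
     (\<exists>F. finite F \<and> F \<subseteq> carrier \<Lambda> \<and> X\<^sub>\<Gamma> \<subseteq> (\<Union>h\<in>F. \<sigma> h ` X\<^sub>\<Lambda>))"

text \<open>Here \<open>\<phi>\<close> and \<open>\<psi>\<close> are meant to be nonnegative and nondecreasing on \<open>{0..}\<close>; only their values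
  there matter.\<close>

definition integrable_coupling ::
    "(real \<Rightarrow> real) \<Rightarrow> (real \<Rightarrow> real) \<Rightarrow>
     ('g, 'm) monoid_scheme \<Rightarrow> 'g set \<Rightarrow> ('l, 'n) monoid_scheme \<Rightarrow> 'l set \<Rightarrow>
     'w measure \<Rightarrow> ('g \<Rightarrow> 'w \<Rightarrow> 'w) \<Rightarrow> ('l \<Rightarrow> 'w \<Rightarrow> 'w) \<Rightarrow> 'w set \<Rightarrow> 'w set \<Rightarrow> bool" where
  "integrable_coupling \<phi> \<psi> \<Gamma> S\<^sub>\<Gamma> \<Lambda> S\<^sub>\<Lambda> M \<rho> \<sigma> X\<^sub>\<Gamma> X\<^sub>\<Lambda> \<longleftrightarrow>
     (\<exists>c>0.
        (\<forall>s\<in>S\<^sub>\<Gamma>. (\<integral>\<^sup>+x\<in>X\<^sub>\<Lambda>.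
            ennreal (\<phi> (c * real (word_length \<Lambda> S\<^sub>\<Lambda> (cocycle \<rho> \<Lambda> \<sigma> X\<^sub>\<Lambda> s x)))) \<partial>M) < \<infinity>) \<and>
        (\<forall>t\<in>S\<^sub>\<Lambda>. (\<integral>\<^sup>+x\<in>X\<^sub>\<Gamma>.
            ennreal (\<psi> (c * real (word_length \<Gamma> S\<^sub>\<Gamma> (cocycle \<sigma> \<Gamma> \<rho> X\<^sub>\<Gamma> t x)))) \<partial>M) < \<infinity>))"

end

theory Submission
  imports Defs "HOL-Real_Asymp.Real_Asymp"
begin

text \<open>
  For a point \<open>x\<close> of \<open>X\<^sub>\<Gamma>\<close> the cocycle \<open>\<beta>\<close> defines a map \<open>f l = inv (\<beta> (inv l) x)\<close> from \<open>\<Lambda>\<close> to \<open>\<Gamma>\<close>.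
  It sends neighbours \<open>l\<close>, \<open>l s\<close> to elements that differ by a value of \<open>\<beta>\<close> on a generator; and if \<open>f k\<close>
  and \<open>f l\<close> differ by \<open>g\<close>, then \<open>k\<close> and \<open>l\<close> differ by a value of \<open>\<alpha> g\<close>, up to the finitely many elements
  of \<open>\<Lambda>\<close> provided by coboundedness. The induced action of \<open>\<Lambda>\<close> on \<open>X\<^sub>\<Gamma>\<close> preserves the measure, so for a
  given set of \<open>m\<close> elements a union bound over the translates of a few exceptional sets shows that \<open>x\<close>
  can be chosen such that all these values are small. As \<open>\<bar>\<beta>\<bar> powr (1 + 1 / q)\<close> is integrable, the jumps
  of \<open>f\<close> are at most of the order of \<open>R = m powr a\<close> with \<open>a = q / (1 + q)\<close>. On the whole ball of radius
  \<open>R\<close> in \<open>\<Gamma>\<close>, which has at most exponentially many elements, the integrability of \<open>exp (\<bar>\<alpha>\<bar> powr p)\<close>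
  bounds the steps of \<open>\<alpha>\<close> by a multiple of \<open>R powr (1 / p)\<close>. Hence elements whose images are at distance
  \<open>O(R)\<close> are at distance \<open>O(R powr (1 + 1 / p))\<close> in \<open>\<Lambda>\<close>, and this is \<open>o(m)\<close> because
  \<open>(1 + 1 / p) / (1 + 1 / q) < 1\<close>.

  In a space that is not hyperbolic there are, at arbitrarily large scales \<open>r\<close>, geodesics \<open>Q\<close> of length
  at most \<open>8 r\<close> whose endpoints are also joined by a path \<open>P\<close> of length at most \<open>70 r\<close> that stays
  outside the ball of radius \<open>r\<close> around some point \<open>y\<close> of \<open>Q\<close> (\<open>nonhyperbolic_detour\<close>). Suppose that
  this happens in the Cayley graph of \<open>\<Lambda>\<close> and apply the map \<open>f\<close> to the loop formed by \<open>P\<close> and \<open>Q\<close>.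
  A geodesic of the hyperbolic group \<open>\<Gamma>\<close> that joins the images of the endpoints stays within
  \<open>O(log m) + O(R)\<close> of both images (\<open>geodesic_close_to_path\<close>). Walking along it from one end to the
  other, the nearby elements of \<open>Q\<close> advance in steps of length \<open>o(m)\<close>, because close images come from
  close elements. So one of them is within \<open>o(m)\<close> of \<open>y\<close>, and it has an element of \<open>P\<close> within \<open>o(m)\<close>
  (\<open>paths_fellow_travel\<close>). As \<open>m\<close> is proportional to \<open>r\<close>, this contradicts the choice of \<open>P\<close>.

  The measure theoretic part is \<open>large_scale_maps\<close>, and both parts are combined in
  \<open>hyperbolic_group_transfer\<close>. To relate the groups to the geodesic spaces in the definition of
  hyperbolicity, the path metric of a graph is computed through its distance on vertices
  (\<open>path_dist_attained\<close>, \<open>geodesic_realization\<close>, \<open>path_dist_vertices\<close>).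
\<close>

section \<open>Word length\<close>

context group begin

abbreviation symmetrized :: "'a set \<Rightarrow> 'a set" where
  "symmetrized S \<equiv> S \<union> (\<lambda>s. inv s) ` S"

abbreviation word_eval :: "'a list \<Rightarrow> 'a" where
  "word_eval w \<equiv> foldr (\<lambda>a b. a \<otimes> b) w \<one>"

lemma word_eval_closed: "set w \<subseteq> carrier G \<Longrightarrow> word_eval w \<in> carrier G"
  by (induction w) auto

lemma word_eval_append:
  "set v \<subseteq> carrier G \<Longrightarrow> set w \<subseteq> carrier G \<Longrightarrow> word_eval (v @ w) = word_eval v \<otimes> word_eval w"
  by (induction v) (auto simp: m_assoc word_eval_closed)

lemma word_eval_inverse:
  "set w \<subseteq> carrier G \<Longrightarrow> word_eval (rev (map (\<lambda>s. inv s) w)) = inv (word_eval w)"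
proof (induction w)
  case (Cons a w)
  have "set (rev (map (\<lambda>s. inv s) w)) \<subseteq> carrier G" using Cons.prems by auto
  then have "word_eval (rev (map (\<lambda>s. inv s) w) @ [inv a]) = inv (word_eval w) \<otimes> inv a"
    using Cons by (subst word_eval_append) auto
  then show ?case using Cons.prems by (simp add: inv_mult_group word_eval_closed)
qed simp

end

locale fg_group = group G for G (structure) +
  fixes S :: "'a set"
  assumes generating: "finite_generating_set G S"
begin

abbreviation wl :: "'a \<Rightarrow> nat" where "wl \<equiv> word_length G S"

lemma finite_generators: "finite S" and generators_closed: "S \<subseteq> carrier G"
  and generates: "generate G S = carrier G"
  using generating by (auto simp: finite_generating_set_def)

lemma symmetrized_closed: "symmetrized S \<subseteq> carrier G"
  using generators_closed by auto

lemma finite_symmetrized: "finite (symmetrized S)"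
  using finite_generators by simp

lemma symmetrized_inv: "s \<in> symmetrized S \<Longrightarrow> inv s \<in> symmetrized S"
  using generators_closed by auto

lemma word_exists:
  assumes "g \<in> carrier G"
  shows "\<exists>w. set w \<subseteq> symmetrized S \<and> word_eval w = g"
proof -
  have "g \<in> generate G S" using assms generates by simp
  then show ?thesis
  proof induction
    case one
    show ?case by (intro exI[of _ "[]"]) simp
  next
    case (incl h)
    then show ?case using generators_closed by (intro exI[of _ "[h]"]) auto
  next
    case (inv h)
    then show ?case using generators_closed by (intro exI[of _ "[inv h]"]) auto
  next
    case (eng h1 h2)
    then obtain w1 w2 where "set w1 \<subseteq> symmetrized S" "word_eval w1 = h1"
      "set w2 \<subseteq> symmetrized S" "word_eval w2 = h2" by blast
    moreover from this have "word_eval (w1 @ w2) = h1 \<otimes> h2"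
      using symmetrized_closed word_eval_append[of w1 w2] by (metis dual_order.trans)
    ultimately show ?case by (intro exI[of _ "w1 @ w2"]) auto
  qed
qed

lemma wl_word:
  assumes "g \<in> carrier G"
  obtains w where "set w \<subseteq> symmetrized S" "length w = wl g" "word_eval w = g"
proof -
  obtain w where w: "set w \<subseteq> symmetrized S" "word_eval w = g" using word_exists[OF assms] by blast
  have "\<exists>w. set w \<subseteq> symmetrized S \<and> length w = wl g \<and> word_eval w = g"
    unfolding word_length_def
    by (rule LeastI_ex) (use w in blast)
  then show ?thesis using that by blast
qed

lemma wl_le: "set w \<subseteq> symmetrized S \<Longrightarrow> wl (word_eval w) \<le> length w"
  unfolding word_length_def by (rule Least_le) blast

lemma wl_one [simp]: "wl \<one> = 0"
  using wl_le[of "[]"] by simp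

lemma wl_generator: "s \<in> symmetrized S \<Longrightarrow> wl s \<le> 1"
proof -
  assume s: "s \<in> symmetrized S"
  then have "s \<in> carrier G" using symmetrized_closed by blast
  then show ?thesis using wl_le[of "[s]"] s by simp
qed

lemma wl_eq_0: "g \<in> carrier G \<Longrightarrow> wl g = 0 \<longleftrightarrow> g = \<one>"
proof
  assume g: "g \<in> carrier G" "wl g = 0"
  from g(1) show "g = \<one>" by (rule wl_word) (use g in simp)
qed simp

lemma wl_mult:
  assumes "g \<in> carrier G" "h \<in> carrier G"
  shows "wl (g \<otimes> h) \<le> wl g + wl h"
proof -
  obtain v where v: "set v \<subseteq> symmetrized S" "length v = wl g" "word_eval v = g"
    using wl_word[OF assms(1)] .
  obtain w where w: "set w \<subseteq> symmetrized S" "length w = wl h" "word_eval w = h"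
    using wl_word[OF assms(2)] .
  have "word_eval (v @ w) = g \<otimes> h"
    using v w symmetrized_closed by (subst word_eval_append) auto
  then show ?thesis using wl_le[of "v @ w"] v w by simp
qed

lemma wl_inv [simp]:
  assumes "g \<in> carrier G"
  shows "wl (inv g) = wl g"
proof -
  have le: "wl (inv g) \<le> wl g" if g: "g \<in> carrier G" for g
  proof -
    obtain w where w: "set w \<subseteq> symmetrized S" "length w = wl g" "word_eval w = g"
      using wl_word[OF g] .
    have "word_eval (rev (map (\<lambda>s. inv s) w)) = inv g"
      using w symmetrized_closed by (subst word_eval_inverse) auto
    moreover have "set (rev (map (\<lambda>s. inv s) w)) \<subseteq> symmetrized S"
      using w(1) symmetrized_inv by auto
    ultimately show ?thesis using wl_le[of "rev (map (\<lambda>s. inv s) w)"] w by simp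
  qed
  show ?thesis using le[OF assms] le[of "inv g"] assms by simp
qed

text \<open>The first letter of a shortest word can be split off. This makes induction on the length
  possible without mentioning words.\<close>

lemma wl_Suc_split:
  assumes "g \<in> carrier G" "wl g = Suc n"
  obtains s g' where "s \<in> symmetrized S" "g' \<in> carrier G" "g = s \<otimes> g'" "wl g' = n"
proof -
  obtain w where w: "set w \<subseteq> symmetrized S" "length w = wl g" "word_eval w = g"
    using wl_word[OF assms(1)] .
  then obtain s v where sv: "w = s # v" using assms(2) by (cases w) auto
  have v: "set v \<subseteq> carrier G" and s: "s \<in> symmetrized S" "s \<in> carrier G"
    using w sv symmetrized_closed by auto
  have "wl (word_eval v) \<le> n" using wl_le[of v] w sv assms(2) by simp
  moreover have "g = s \<otimes> word_eval v" using w sv by simp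
  moreover have "wl g \<le> wl s + wl (word_eval v)"
    using calculation s v by (metis wl_mult word_eval_closed)
  moreover have "wl s \<le> 1" using wl_generator s by blast
  ultimately show ?thesis using that[of s "word_eval v"] s word_eval_closed[OF v] assms(2) by simp
qed

text \<open>Splitting off letters bounds a subadditive function by its values on the generators. Applied to
  the word length of another finite generating set this compares the two.\<close>

lemma length_function_le:
  fixes N :: "'a \<Rightarrow> real" and k :: real
  assumes one: "N \<one> \<le> 0"
    and mult: "\<And>g h. g \<in> carrier G \<Longrightarrow> h \<in> carrier G \<Longrightarrow> N (g \<otimes> h) \<le> N g + N h"
    and gen: "\<And>s. s \<in> symmetrized S \<Longrightarrow> N s \<le> k"
    and g: "g \<in> carrier G"
  shows "N g \<le> k * wl g"
  using g
proof (induction "wl g" arbitrary: g)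
  case 0
  then show ?case using wl_eq_0 one by auto
next
  case (Suc n)
  obtain s h where sh: "s \<in> symmetrized S" "h \<in> carrier G" "g = s \<otimes> h" "wl h = n"
    using wl_Suc_split[OF Suc.prems, of n] Suc.hyps(2) by metis
  then have "N g \<le> N s + N h" using mult symmetrized_closed by blast
  also have "\<dots> \<le> k + k * n" using gen[OF sh(1)] Suc.hyps(1)[of h] sh by simp
  also have "\<dots> = k * wl g" unfolding Suc.hyps(2)[symmetric] by (simp add: algebra_simps)
  finally show ?case .
qed

lemma word_length_comparison:
  assumes "finite_generating_set G S'"
  shows "\<exists>k>0. \<forall>g\<in>carrier G. real (word_length G S' g) \<le> k * real (wl g)"
proof -
  interpret S': fg_group G S' by unfold_locales (rule assms)
  define k :: real where "k = 1 + (\<Sum>s\<in>symmetrized S. real (S'.wl s))"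
  have k: "real (S'.wl s) \<le> k" if "s \<in> symmetrized S" for s
    unfolding k_def using member_le_sum[OF that, of "\<lambda>s. real (S'.wl s)"] finite_symmetrized by simp
  have "k > 0" unfolding k_def by (simp add: add_pos_nonneg sum_nonneg)
  moreover have "real (S'.wl g) \<le> k * real (wl g)" if "g \<in> carrier G" for g
  proof (rule length_function_le[where N = "\<lambda>g. real (S'.wl g)", OF _ _ _ that])
    show "real (S'.wl s) \<le> k" if "s \<in> symmetrized S" for s by (rule k[OF that])
    show "real (S'.wl (g \<otimes> h)) \<le> real (S'.wl g) + real (S'.wl h)"
      if "g \<in> carrier G" "h \<in> carrier G" for g h
      using of_nat_mono[OF S'.wl_mult[OF that]] by simp
  qed simp_all
  ultimately show ?thesis by (intro exI[of _ k]) simp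
qed

lemma card_ball_le:
  "finite {g\<in>carrier G. wl g \<le> n} \<and>
   card {g\<in>carrier G. wl g \<le> n} \<le> Suc (card (symmetrized S)) ^ n"
proof (induction n)
  case 0
  have "{g\<in>carrier G. wl g \<le> 0} = {\<one>}" using wl_eq_0 by auto
  then show ?case by simp
next
  case (Suc n)
  let ?B = "\<lambda>n. {g\<in>carrier G. wl g \<le> n}" and ?U = "insert \<one> (symmetrized S)"
  have "?B (Suc n) \<subseteq> (\<lambda>(s, g). s \<otimes> g) ` (?U \<times> ?B n)"
  proof
    fix g assume g: "g \<in> ?B (Suc n)"
    show "g \<in> (\<lambda>(s, g). s \<otimes> g) ` (?U \<times> ?B n)"
    proof (cases "wl g \<le> n")
      case True
      then show ?thesis using g by (auto intro!: image_eqI[of _ _ "(\<one>, g)"])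
    next
      case False
      then have "wl g = Suc n" using g by auto
      then obtain s h where "s \<in> symmetrized S" "h \<in> carrier G" "g = s \<otimes> h" "wl h = n"
        using wl_Suc_split g by blast
      then show ?thesis by (auto intro!: image_eqI[of _ _ "(s, h)"])
    qed
  qed
  moreover have fin: "finite (?U \<times> ?B n)" using finite_symmetrized Suc by blast
  ultimately have "finite (?B (Suc n))" "card (?B (Suc n)) \<le> card (?U \<times> ?B n)"
    by (meson finite_surj, meson surj_card_le)
  moreover have "card (?U \<times> ?B n) \<le> Suc (card (symmetrized S)) * Suc (card (symmetrized S)) ^ n"
    unfolding card_cartesian_product
    using Suc finite_symmetrized by (intro mult_mono) (simp_all add: card_insert_if del: finite_Un)
  ultimately show ?case by simp
qed

definition word_dist :: "'a \<Rightarrow> 'a \<Rightarrow> nat" where "word_dist g h = wl (inv g \<otimes> h)"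

lemma word_dist_refl [simp]: "g \<in> carrier G \<Longrightarrow> word_dist g g = 0"
  by (simp add: word_dist_def)

lemma word_dist_commute: "g \<in> carrier G \<Longrightarrow> h \<in> carrier G \<Longrightarrow> word_dist g h = word_dist h g"
  unfolding word_dist_def using wl_inv[of "inv g \<otimes> h"] by (simp add: inv_mult_group)

lemma word_dist_triangle:
  assumes "g \<in> carrier G" "h \<in> carrier G" "k \<in> carrier G"
  shows "word_dist g k \<le> word_dist g h + word_dist h k"
proof -
  have "inv g \<otimes> k = (inv g \<otimes> h) \<otimes> (inv h \<otimes> k)" using assms by (simp add: m_assoc m_assoc[of h, symmetric])
  then show ?thesis unfolding word_dist_def using wl_mult[of "inv g \<otimes> h" "inv h \<otimes> k"] assms by simp
qed

end

section \<open>The path metric of a graph\<close>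

definition vertex_point :: "'a \<Rightarrow> 'a \<Rightarrow> real" where
  "vertex_point v = (\<lambda>u. if u = v then 1 else 0)"

lemma cell_dist_nonneg: "0 \<le> cell_dist e x y"
  by (simp add: cell_dist_def sum_nonneg)

lemma cell_dist_commute: "cell_dist e x y = cell_dist e y x"
  by (simp add: cell_dist_def abs_minus_commute)

lemma cell_dist_refl [simp]: "cell_dist e x x = 0"
  by (simp add: cell_dist_def)

lemma cell_dist_triangle: "cell_dist e x z \<le> cell_dist e x y + cell_dist e y z"
proof -
  have "(\<Sum>v\<in>e. \<bar>x v - z v\<bar>) \<le> (\<Sum>v\<in>e. \<bar>x v - y v\<bar> + \<bar>y v - z v\<bar>)"
    by (rule sum_mono) linarith
  then show ?thesis by (simp add: cell_dist_def sum.distrib)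
qed

lemma cell_dist_eq_0:
  assumes "finite e" "x \<in> cell e" "y \<in> cell e" "cell_dist e x y = 0"
  shows "x = y"
proof
  fix v
  have "(\<Sum>v\<in>e. \<bar>x v - y v\<bar>) = 0" using assms by (simp add: cell_dist_def)
  then have "\<forall>v\<in>e. \<bar>x v - y v\<bar> = 0" using assms(1) by (subst (asm) sum_nonneg_eq_0_iff) auto
  then show "x v = y v" using assms by (cases "v \<in> e") (auto simp: cell_def)
qed

lemma cell_le_1:
  assumes "finite e" "x \<in> cell e"
  shows "x v \<le> 1"
proof (cases "v \<in> e")
  case True
  then have "x v \<le> (\<Sum>v\<in>e. x v)" using assms by (intro member_le_sum) (auto simp: cell_def)
  then show ?thesis using assms by (simp add: cell_def)
qed (use assms in \<open>simp add: cell_def\<close>)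

lemma vertex_point_cell_iff: "finite e \<Longrightarrow> vertex_point v \<in> cell e \<longleftrightarrow> v \<in> e"
  by (auto simp: vertex_point_def cell_def sum.delta)

lemma cell_dist_vertex_point:
  assumes "finite e" "x \<in> cell e" "u \<in> e"
  shows "cell_dist e x (vertex_point u) = 1 - x u"
proof -
  have "(\<Sum>v\<in>e. \<bar>x v - vertex_point u v\<bar>)
      = \<bar>x u - 1\<bar> + (\<Sum>v\<in>e - {u}. \<bar>x v - vertex_point u v\<bar>)"
    using assms by (subst sum.remove[of e u]) (auto simp: vertex_point_def)
  also have "(\<Sum>v\<in>e - {u}. \<bar>x v - vertex_point u v\<bar>) = (\<Sum>v\<in>e - {u}. x v)"
    using assms by (intro sum.cong) (auto simp: vertex_point_def cell_def)
  also have "\<dots> = 1 - x u"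
    using assms by (simp add: sum_diff1 cell_def)
  finally show ?thesis using cell_le_1[OF assms(1,2), of u] by (simp add: cell_dist_def)
qed

lemma cell_cong_1:
  assumes "finite e" "x \<in> cell e" "x u = 1"
  shows "x = vertex_point u"
proof -
  have "u \<in> e" using assms by (auto simp: cell_def)
  then show ?thesis
    using assms cell_dist_vertex_point[of e x u] cell_dist_eq_0[of e x "vertex_point u"]
    by (simp add: vertex_point_cell_iff)
qed

lemma cell_scale:
  assumes "finite e" "x \<in> cell e" "y \<in> cell e" "0 \<le> t" "t \<le> 1"
  shows "(\<lambda>v. (1 - t) * x v + t * y v) \<in> cell e"
  using assms by (auto simp: cell_def sum.distrib simp flip: sum_distrib_left)

lemma cell_dist_scale:
  "cell_dist e (\<lambda>v. (1 - s) * x v + s * y v) (\<lambda>v. (1 - t) * x v + t * y v)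
     = \<bar>s - t\<bar> * cell_dist e x y"
proof -
  have "\<bar>((1 - s) * x v + s * y v) - ((1 - t) * x v + t * y v)\<bar> = \<bar>s - t\<bar> * \<bar>x v - y v\<bar>" for v
    unfolding abs_mult[symmetric] abs_minus_commute[of s t] by (rule arg_cong[of _ _ abs]) (simp add: algebra_simps)
  then show ?thesis by (simp add: cell_dist_def flip: sum_distrib_left)
qed

lemma pl_path_nonneg: "pl_path V E x y l \<Longrightarrow> 0 \<le> l"
  by (induction rule: pl_path.induct) (auto simp: add_nonneg_nonneg cell_dist_nonneg)

lemma pl_path_realization:
  "pl_path V E x y l \<Longrightarrow> x \<in> realization V E \<and> y \<in> realization V E"
  by (induction rule: pl_path.induct) (auto simp: realization_def)

lemma pl_path_trans:
  "pl_path V E y z k \<Longrightarrow> pl_path V E x y l \<Longrightarrow> pl_path V E x z (l + k)"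
proof (induction rule: pl_path.induct)
  case (step y z k e w)
  then show ?case using pl_path.step[of V E x z "l + k" e w] by (simp add: add.assoc)
qed simp

lemma pl_path_cell:
  assumes "e \<in> cells V E" "x \<in> cell e" "y \<in> cell e"
  shows "pl_path V E x y (cell_dist e x y)"
proof -
  have "x \<in> realization V E" using assms by (auto simp: realization_def)
  then show ?thesis using pl_path.step[OF pl_path.refl assms] by simp
qed

lemma pl_path_sym: "pl_path V E x y l \<Longrightarrow> pl_path V E y x l"
proof (induction rule: pl_path.induct)
  case (step x y l e z)
  then have "pl_path V E z y (cell_dist e z y)" by (intro pl_path_cell)
  from pl_path_trans[OF step.IH this] show ?case by (simp add: cell_dist_commute add.commute)
qed (rule pl_path.refl)

lemma path_dist_le: "pl_path V E x y l \<Longrightarrow> path_dist V E x y \<le> l"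
  unfolding path_dist_def
  by (auto intro!: cInf_lower bdd_belowI[of _ 0] dest: pl_path_nonneg)

lemma path_dist_nonneg: "0 \<le> path_dist V E x y"
  unfolding path_dist_def by (auto intro!: cInf_greatest dest: pl_path_nonneg)

lemma path_dist_commute: "path_dist V E x y = path_dist V E y x"
proof -
  have "pl_path V E x y = pl_path V E y x" by (intro ext iffI) (erule pl_path_sym)+
  then show ?thesis by (simp add: path_dist_def)
qed

text \<open>The graph is given with an integer distance on its vertices that is realized by edge paths.
  All assertions about the metric realization are derived from this.\<close>

locale graph_distance =
  fixes V :: "'a set" and E :: "'a set set" and D :: "'a \<Rightarrow> 'a \<Rightarrow> nat"
  assumes edge: "e \<in> E \<Longrightarrow> \<exists>u\<in>V. \<exists>v\<in>V. u \<noteq> v \<and> e = {u, v} \<and> D u v \<le> 1"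
    and D_commute: "u \<in> V \<Longrightarrow> v \<in> V \<Longrightarrow> D u v = D v u"
    and D_eq_0: "u \<in> V \<Longrightarrow> v \<in> V \<Longrightarrow> D u v = 0 \<longleftrightarrow> u = v"
    and D_triangle: "u \<in> V \<Longrightarrow> v \<in> V \<Longrightarrow> w \<in> V \<Longrightarrow> D u w \<le> D u v + D v w"
    and D_Suc: "u \<in> V \<Longrightarrow> w \<in> V \<Longrightarrow> D u w = Suc n \<Longrightarrow> \<exists>v\<in>V. {v, w} \<in> E \<and> D u v = n"
    and V_nonempty: "V \<noteq> {}"
begin

abbreviation Y :: "('a \<Rightarrow> real) set" where "Y \<equiv> realization V E"
abbreviation pd :: "('a \<Rightarrow> real) \<Rightarrow> ('a \<Rightarrow> real) \<Rightarrow> real" where "pd \<equiv> path_dist V E"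

lemma cells_cases:
  assumes "e \<in> cells V E"
  obtains u where "u \<in> V" "e = {u}" | u v where "u \<in> V" "v \<in> V" "u \<noteq> v" "e = {u, v}" "D u v \<le> 1"
proof (cases "e \<in> E")
  case True
  from edge[OF this] show ?thesis using that(2) by (elim bexE conjE)
next
  case False
  then show ?thesis using assms that(1) by (auto simp: cells_def)
qed

lemma finite_cells: "e \<in> cells V E \<Longrightarrow> finite e"
  and cells_nonempty: "e \<in> cells V E \<Longrightarrow> e \<noteq> {}"
  and cells_subset: "e \<in> cells V E \<Longrightarrow> e \<subseteq> V"
  by (erule cells_cases; simp)+

lemma D_cell:
  assumes "e \<in> cells V E" "u \<in> e" "w \<in> e"
  shows "D u w \<le> 1"
  using assms(1)
proof (cases rule: cells_cases)
  case (1 v)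
  then show ?thesis using assms D_eq_0[of v v] by simp
next
  case (2 v v')
  then show ?thesis using assms(2,3) D_eq_0[of v v] D_eq_0[of v' v'] D_commute[of v v'] by auto
qed

lemma vertex_point_realization: "u \<in> V \<Longrightarrow> vertex_point u \<in> Y"
  unfolding realization_def by (rule UN_I[of "{u}"]) (auto simp: cells_def vertex_point_cell_iff)

text \<open>A point with two positive coordinates determines its cell, since cells have at most two
  vertices. So different cells meet in vertices only.\<close>

lemma cells_intersection:
  assumes "e \<in> cells V E" "e' \<in> cells V E" "e \<noteq> e'" "x \<in> cell e" "x \<in> cell e'"
  obtains w where "w \<in> e" "w \<in> e'" "x = vertex_point w"
proof -
  have "\<exists>w. x w = 1"
  proof (rule ccontr)
    assume nv: "\<nexists>w. x w = 1"
    from assms(1) show False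
    proof (cases rule: cells_cases)
      case (1 u)
      then show False using assms nv by (simp add: cell_def)
    next
      case (2 u v)
      then have s: "x u + x v = 1" using assms by (simp add: cell_def)
      then have "x u \<noteq> 0" "x v \<noteq> 0" using nv by auto
      then have "u \<in> e'" "v \<in> e'" using assms by (auto simp: cell_def)
      with assms(2) have "e' = {u, v}" using 2(3) by (cases rule: cells_cases) auto
      then show False using 2 assms by simp
    qed
  qed
  then obtain w where "x w = 1" by blast
  then have "w \<in> e" "w \<in> e'" using assms by (auto simp: cell_def)
  then show ?thesis using that cell_cong_1[OF _ assms(4) \<open>x w = 1\<close>] finite_cells assms by blast
qed

lemma cell_dist_cell_cong:
  assumes "e \<in> cells V E" "e' \<in> cells V E" "x \<in> cell e" "x \<in> cell e'" "y \<in> cell e" "y \<in> cell e'"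
  shows "cell_dist e x y = cell_dist e' x y"
proof (cases "e = e'")
  case False
  obtain u where u: "u \<in> e" "u \<in> e'" "x = vertex_point u"
    using cells_intersection[OF assms(1,2) False assms(3,4)] .
  obtain v where v: "v \<in> e" "v \<in> e'" "y = vertex_point v"
    using cells_intersection[OF assms(1,2) False assms(5,6)] .
  have fin: "finite e" "finite e'" using assms finite_cells by auto
  show ?thesis
    using cell_dist_vertex_point[OF fin(1) assms(3) v(1)] cell_dist_vertex_point[OF fin(2) assms(4) v(2)] v by simp
qed simp

lemma vertex_path:
  "u \<in> V \<Longrightarrow> w \<in> V \<Longrightarrow> pl_path V E (vertex_point u) (vertex_point w) (D u w)"
proof (induction "D u w" arbitrary: w)
  case 0
  then show ?case using D_eq_0[of u w] pl_path.refl[OF vertex_point_realization[of w]] by simp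
next
  case (Suc n)
  then obtain v where v: "v \<in> V" "{v, w} \<in> E" "D u v = n" using D_Suc by metis
  have "pl_path V E (vertex_point u) (vertex_point v) n" using Suc v by blast
  moreover have c: "{v, w} \<in> cells V E" using v by (simp add: cells_def)
  ultimately have "pl_path V E (vertex_point u) (vertex_point w)
      (n + cell_dist {v, w} (vertex_point v) (vertex_point w))"
    by (rule pl_path.step) (simp_all add: vertex_point_cell_iff)
  moreover have "cell_dist {v, w} (vertex_point v) (vertex_point w) = 1"
  proof -
    have "v \<noteq> w" using v Suc by auto
    then show ?thesis by (simp add: cell_dist_def vertex_point_def)
  qed
  ultimately show ?case by (simp add: Suc(2)[symmetric] add.commute)
qed

text \<open>A shortest path either stays in one cell or leaves the cell of \<open>x\<close> through a vertex \<open>u\<close>,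
  follows edges and enters the cell of \<open>y\<close> through a vertex \<open>w\<close>. The lengths of the paths of this
  kind form a set that is finite below any bound, so the infimum defining the metric is attained.\<close>

definition canonical_length :: "('a \<Rightarrow> real) \<Rightarrow> ('a \<Rightarrow> real) \<Rightarrow> real \<Rightarrow> bool" where
  "canonical_length x y l \<longleftrightarrow>
     (\<exists>e\<in>cells V E. x \<in> cell e \<and> y \<in> cell e \<and> l = cell_dist e x y) \<or>
     (\<exists>e\<in>cells V E. \<exists>e'\<in>cells V E. \<exists>u\<in>e. \<exists>w\<in>e'. x \<in> cell e \<and> y \<in> cell e' \<and>
        l = (1 - x u) + real (D u w) + (1 - y w))"

lemma canonical_length_direct:
  "e \<in> cells V E \<Longrightarrow> x \<in> cell e \<Longrightarrow> y \<in> cell e \<Longrightarrow> canonical_length x y (cell_dist e x y)"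
  unfolding canonical_length_def by blast

lemma canonical_length_via:
  "e \<in> cells V E \<Longrightarrow> e' \<in> cells V E \<Longrightarrow> u \<in> e \<Longrightarrow> w \<in> e' \<Longrightarrow> x \<in> cell e \<Longrightarrow> y \<in> cell e' \<Longrightarrow>
   canonical_length x y ((1 - x u) + real (D u w) + (1 - y w))"
  unfolding canonical_length_def by blast

lemma canonical_length_cases:
  assumes "canonical_length x y l"
  obtains e where "e \<in> cells V E" "x \<in> cell e" "y \<in> cell e" "l = cell_dist e x y"
  | e e' u w where "e \<in> cells V E" "e' \<in> cells V E" "u \<in> e" "w \<in> e'" "x \<in> cell e" "y \<in> cell e'"
      "l = (1 - x u) + real (D u w) + (1 - y w)"
  using assms unfolding canonical_length_def by blast

text \<open>Prolonging a canonical path by a step in a cell either stays in its last cell, where the triangle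
  inequality applies, or passes through a common vertex of two cells, where the step joins the edge
  part of the path.\<close>

lemma canonical_length_step:
  assumes "canonical_length x y l" and e2: "e2 \<in> cells V E" "y \<in> cell e2" "z \<in> cell e2"
  shows "\<exists>l'\<le>l + cell_dist e2 y z. canonical_length x z l'"
  using assms(1)
proof (cases rule: canonical_length_cases)
  case (1 e)
  show ?thesis
  proof (cases "e = e2")
    case True
    then show ?thesis using 1 e2 canonical_length_direct[of e2 x z] cell_dist_triangle[of e x z y] by blast
  next
    case False
    obtain w where w: "w \<in> e" "w \<in> e2" "y = vertex_point w"
      using cells_intersection[OF 1(1) e2(1) False 1(3) e2(2)] .
    have "w \<in> V" using w 1 cells_subset by blast
    then have "D w w = 0" using D_eq_0 by simp
    then have "canonical_length x z ((1 - x w) + 0 + (1 - z w))"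
      using canonical_length_via[OF 1(1) e2(1) w(1,2) 1(2) e2(3)] by simp
    moreover have "cell_dist e x y = 1 - x w" "cell_dist e2 y z = 1 - z w"
      using cell_dist_vertex_point finite_cells 1 e2 w cell_dist_commute by metis+
    ultimately show ?thesis using 1 by force
  qed
next
  case (2 e e' u w)
  show ?thesis
  proof (cases "e' = e2")
    case True
    have "cell_dist e2 z (vertex_point w) \<le> cell_dist e2 z y + cell_dist e2 y (vertex_point w)"
      by (rule cell_dist_triangle)
    then have "1 - z w \<le> cell_dist e2 y z + (1 - y w)"
      using cell_dist_vertex_point[OF finite_cells[OF e2(1)] e2(2), of w] cell_dist_commute[of e2 y z]
        cell_dist_vertex_point[OF finite_cells[OF e2(1)] e2(3), of w] 2(4) True by simp
    moreover have "canonical_length x z ((1 - x u) + real (D u w) + (1 - z w))"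
      using canonical_length_via 2 e2 True by blast
    ultimately show ?thesis using 2(7)
      by (intro exI[of _ "(1 - x u) + real (D u w) + (1 - z w)"]) simp
  next
    case False
    obtain v where v: "v \<in> e'" "v \<in> e2" "y = vertex_point v"
      using cells_intersection[OF 2(2) e2(1) False 2(6) e2(2)] .
    have V: "u \<in> V" "v \<in> V" "w \<in> V" using 2 v cells_subset by auto
    have "real (D w v) \<le> 1 - y w"
      using v D_cell[OF 2(2) 2(4) v(1)] D_eq_0[of v v] V by (auto simp: vertex_point_def)
    moreover have "real (D u v) \<le> real (D u w) + real (D w v)" using D_triangle[of u w v] V by linarith
    moreover have "cell_dist e2 y z = 1 - z v"
      using cell_dist_vertex_point finite_cells e2 v cell_dist_commute by metis
    moreover have "canonical_length x z ((1 - x u) + real (D u v) + (1 - z v))"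
      using canonical_length_via[OF 2(1) e2(1) 2(3) v(2) 2(5) e2(3)] .
    ultimately show ?thesis using 2(7) by (intro exI[of _ "(1 - x u) + real (D u v) + (1 - z v)"]) simp
  qed
qed

lemma canonical_length_le_path:
  "pl_path V E x y l \<Longrightarrow> \<exists>l'\<le>l. canonical_length x y l'"
proof (induction rule: pl_path.induct)
  case (refl x)
  then obtain e where "e \<in> cells V E" "x \<in> cell e" by (auto simp: realization_def)
  then show ?case using canonical_length_direct[of e x x] by auto
next
  case (step x y l e z)
  then obtain l1 where l1: "l1 \<le> l" "canonical_length x y l1" by blast
  then obtain l2 where "l2 \<le> l1 + cell_dist e y z" "canonical_length x z l2"
    using canonical_length_step step by blast
  then show ?case using l1 by (intro exI[of _ l2]) simp
qed

lemma canonical_length_path: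
  assumes "canonical_length x y l"
  shows "pl_path V E x y l"
  using assms
proof (cases rule: canonical_length_cases)
  case (1 e)
  then show ?thesis using pl_path_cell by blast
next
  case (2 e e' u w)
  have fin: "finite e" "finite e'" using 2 finite_cells by auto
  have "pl_path V E x (vertex_point u) (1 - x u)"
    using pl_path_cell[OF 2(1,5), of "vertex_point u"] cell_dist_vertex_point[OF fin(1) 2(5,3)] 2 fin
    by (simp add: vertex_point_cell_iff)
  moreover have "pl_path V E (vertex_point u) (vertex_point w) (D u w)"
    using vertex_path 2 cells_subset by blast
  moreover have "pl_path V E y (vertex_point w) (1 - y w)"
    using pl_path_cell[OF 2(2,6), of "vertex_point w"] cell_dist_vertex_point[OF fin(2) 2(6,4)] 2 fin
    by (simp add: vertex_point_cell_iff)
  then have "pl_path V E (vertex_point w) y (1 - y w)" by (rule pl_path_sym)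
  ultimately show ?thesis unfolding 2(7) by (meson pl_path_trans)
qed

text \<open>At a vertex infinitely many cells may meet, but the coordinates of a point take only finitely many
  values, and the length of a direct path does not depend on the cell.\<close>

lemma finite_canonical_lengths:
  assumes "x \<in> Y" "y \<in> Y"
  shows "finite {l. canonical_length x y l \<and> l \<le> b}"
proof -
  obtain e0 e1 where e: "e0 \<in> cells V E" "x \<in> cell e0" "e1 \<in> cells V E" "y \<in> cell e1"
    using assms by (auto simp: realization_def)
  let ?X = "insert 0 (x ` e0)" and ?Z = "insert 0 (y ` e1)"
  let ?F = "(\<lambda>(a, n, c). (1 - a) + real n + (1 - c)) ` (?X \<times> {..nat \<lceil>b\<rceil>} \<times> ?Z)"
  let ?G = "{cell_dist (SOME e. e \<in> cells V E \<and> x \<in> cell e \<and> y \<in> cell e) x y}"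
  have "finite (?F \<union> ?G)" using e finite_cells by auto
  moreover have "{l. canonical_length x y l \<and> l \<le> b} \<subseteq> ?F \<union> ?G"
  proof
    fix l assume "l \<in> {l. canonical_length x y l \<and> l \<le> b}"
    then have l: "canonical_length x y l" "l \<le> b" by auto
    from l(1) show "l \<in> ?F \<union> ?G"
    proof (cases rule: canonical_length_cases)
      case (1 e)
      let ?e = "SOME e. e \<in> cells V E \<and> x \<in> cell e \<and> y \<in> cell e"
      have "?e \<in> cells V E \<and> x \<in> cell ?e \<and> y \<in> cell ?e" by (rule someI[of _ e]) (use 1 in blast)
      then have "l = cell_dist ?e x y" using cell_dist_cell_cong[of e ?e x y] 1 by blast
      then show ?thesis by blast
    next
      case (2 e e' u w)
      have "x u \<le> 1" "y w \<le> 1"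
        using cell_le_1[OF finite_cells[OF 2(1)] 2(5)] cell_le_1[OF finite_cells[OF 2(2)] 2(6)] by auto
      then have "D u w \<le> nat \<lceil>b\<rceil>" using 2(7) l(2) by linarith
      moreover have "x u \<in> ?X" "y w \<in> ?Z" using e by (auto simp: cell_def)
      ultimately show ?thesis unfolding 2(7)
        by (intro UnI1 image_eqI[of _ _ "(x u, D u w, y w)"]) auto
    qed
  qed
  ultimately show ?thesis by (rule rev_finite_subset)
qed

lemma paths_exist:
  assumes "x \<in> Y" "y \<in> Y"
  shows "\<exists>l. pl_path V E x y l"
proof -
  obtain e e' where e: "e \<in> cells V E" "x \<in> cell e" "e' \<in> cells V E" "y \<in> cell e'"
    using assms by (auto simp: realization_def)
  then obtain u w where "u \<in> e" "w \<in> e'" using cells_nonempty by blast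
  then show ?thesis using canonical_length_path[OF canonical_length_via] e by blast
qed

lemma path_dist_attained:
  assumes "x \<in> Y" "y \<in> Y"
  shows "canonical_length x y (pd x y)"
proof -
  obtain l0 where l0: "pl_path V E x y l0" using paths_exist assms by blast
  let ?W = "{l. canonical_length x y l \<and> l \<le> l0}"
  have W: "finite ?W" "?W \<noteq> {}"
    using finite_canonical_lengths[OF assms] canonical_length_le_path[OF l0] by auto
  then have m: "Min ?W \<in> ?W" by (rule Min_in)
  have "Min ?W \<le> l" if l: "pl_path V E x y l" for l
  proof -
    obtain l' where l': "l' \<le> l" "canonical_length x y l'" using canonical_length_le_path[OF l] by blast
    show ?thesis
    proof (cases "l' \<le> l0")
      case True
      then have "Min ?W \<le> l'" using W l' by (intro Min_le) auto
      then show ?thesis using l' by simp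
    next
      case False
      then show ?thesis using m l' by simp
    qed
  qed
  then have "Min ?W \<le> pd x y"
    unfolding path_dist_def using l0 by (auto intro!: cInf_greatest)
  moreover have "pd x y \<le> Min ?W" using m canonical_length_path path_dist_le by blast
  ultimately show ?thesis using m by simp
qed

lemma path_dist_path: "x \<in> Y \<Longrightarrow> y \<in> Y \<Longrightarrow> pl_path V E x y (pd x y)"
  using path_dist_attained canonical_length_path by blast

lemma path_dist_triangle:
  assumes "x \<in> Y" "y \<in> Y" "z \<in> Y"
  shows "pd x z \<le> pd x y + pd y z"
  using pl_path_trans[OF path_dist_path[OF assms(2,3)] path_dist_path[OF assms(1,2)]] by (rule path_dist_le)

lemma path_dist_refl: "x \<in> Y \<Longrightarrow> pd x x = 0"
  using path_dist_le[OF pl_path.refl[of x V E]] path_dist_nonneg[of V E x x] by simp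

lemma path_dist_eq_0:
  assumes "x \<in> Y" "y \<in> Y" "pd x y = 0"
  shows "x = y"
  using path_dist_attained[OF assms(1,2)]
proof (cases rule: canonical_length_cases)
  case (1 e)
  then show ?thesis using cell_dist_eq_0 finite_cells assms by metis
next
  case (2 e e' u w)
  have fin: "finite e" "finite e'" using 2 finite_cells by auto
  have "x u \<le> 1" "y w \<le> 1"
    using cell_le_1[OF fin(1) 2(5)] cell_le_1[OF fin(2) 2(6)] by auto
  with 2(7) assms(3) have *: "x u = 1" "y w = 1" "D u w = 0" by linarith+
  then have "u = w" using D_eq_0 2 cells_subset by blast
  then show ?thesis using cell_cong_1[OF fin(1) 2(5) *(1)] cell_cong_1[OF fin(2) 2(6) *(2)] by simp
qed

lemma metric_realization: "Metric_space Y pd"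
  by unfold_locales
    (auto simp: path_dist_nonneg path_dist_commute path_dist_refl dest: path_dist_eq_0 intro: path_dist_triangle)

lemma path_dist_vertices:
  assumes "u \<in> V" "w \<in> V"
  shows "pd (vertex_point u) (vertex_point w) = D u w"
proof (rule antisym)
  show "pd (vertex_point u) (vertex_point w) \<le> D u w"
    using vertex_path[OF assms] by (rule path_dist_le)
  have "canonical_length (vertex_point u) (vertex_point w) (pd (vertex_point u) (vertex_point w))"
    using assms by (intro path_dist_attained vertex_point_realization)
  then show "D u w \<le> pd (vertex_point u) (vertex_point w)"
  proof (cases rule: canonical_length_cases)
    case (1 e)
    have uw: "u \<in> e" "w \<in> e" using 1 vertex_point_cell_iff finite_cells by metis+
    then have "pd (vertex_point u) (vertex_point w) = 1 - vertex_point u w"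
      using 1 cell_dist_vertex_point finite_cells by metis
    then show ?thesis using D_cell[OF 1(1) uw] D_eq_0[OF assms] by (auto simp: vertex_point_def)
  next
    case (2 e e' u' w')
    have uw: "u \<in> e" "w \<in> e'" using 2 vertex_point_cell_iff finite_cells by metis+
    have V: "u' \<in> V" "w' \<in> V" using 2 cells_subset by auto
    have "D u u' \<le> 1 - vertex_point u u'" "D w' w \<le> 1 - vertex_point w w'"
      using D_cell[OF 2(1) uw(1) 2(3)] D_cell[OF 2(2) 2(4) uw(2)] D_eq_0 assms by (auto simp: vertex_point_def)
    moreover have "D u w \<le> D u u' + D u' w' + D w' w"
      using D_triangle[OF assms(1) V(1) assms(2)] D_triangle[OF V assms(2)] by linarith
    then have "real (D u w) \<le> real (D u u') + real (D u' w') + real (D w' w)" by linarith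
    ultimately show ?thesis unfolding 2(7) by linarith
  qed
qed

lemma near_vertex:
  assumes "x \<in> Y"
  obtains u where "u \<in> V" "pd x (vertex_point u) \<le> 1"
proof -
  obtain e where e: "e \<in> cells V E" "x \<in> cell e" using assms by (auto simp: realization_def)
  then obtain u where u: "u \<in> e" using cells_nonempty by blast
  have "pl_path V E x (vertex_point u) (cell_dist e x (vertex_point u))"
    using pl_path_cell[OF e] u finite_cells[OF e(1)] by (simp add: vertex_point_cell_iff)
  then have "pd x (vertex_point u) \<le> 1 - x u"
    using path_dist_le cell_dist_vertex_point[OF finite_cells[OF e(1)] e(2) u] by metis
  moreover have "0 \<le> x u" using e by (simp add: cell_def)
  ultimately show ?thesis using that u cells_subset[OF e(1)] by force
qed

text \<open>It is enough to parametrize piecewise linear paths by 1-Lipschitz maps; the isometry needed for a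
  geodesic follows when the path is a shortest one.\<close>

lemma pl_path_parametrization:
  assumes "pl_path V E x y l"
  shows "\<exists>c. c \<in> {0..l} \<rightarrow> Y \<and> c 0 = x \<and> c l = y \<and>
           (\<forall>s\<in>{0..l}. \<forall>t\<in>{0..l}. s \<le> t \<longrightarrow> pd (c s) (c t) \<le> t - s)"
  using assms
proof (induction rule: pl_path.induct)
  case (refl x)
  then show ?case by (intro exI[of _ "\<lambda>_. x"]) (auto simp: path_dist_refl)
next
  case (step x y l e z)
  then obtain c where c: "c \<in> {0..l} \<rightarrow> Y" "c 0 = x" "c l = y"
    and lip: "\<And>s t. s \<in> {0..l} \<Longrightarrow> t \<in> {0..l} \<Longrightarrow> s \<le> t \<Longrightarrow> pd (c s) (c t) \<le> t - s"
    by (metis (no_types, lifting))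
  have l: "0 \<le> l" using step pl_path_nonneg by blast
  have fin: "finite e" using step finite_cells by blast
  define k where "k = cell_dist e y z"
  have k: "0 \<le> k" unfolding k_def by (rule cell_dist_nonneg)
  show ?case
  proof (cases "k = 0")
    case True
    then have "y = z" using cell_dist_eq_0[OF fin step.hyps(3,4)] by (simp add: k_def)
    then show ?thesis using c lip by (intro exI[of _ c]) auto
  next
    case False
    with k have k: "0 < k" by simp
    define p where "p r = (\<lambda>v. (1 - r / k) * y v + r / k * z v)" for r
    have pcell: "p r \<in> cell e" if "0 \<le> r" "r \<le> k" for r
      unfolding p_def using that k step fin by (intro cell_scale) auto
    then have pY: "p r \<in> Y" if "0 \<le> r" "r \<le> k" for r
      using that step by (auto simp: realization_def)
    have plip: "pd (p r) (p r') \<le> r' - r" if "0 \<le> r" "r \<le> r'" "r' \<le> k" for r r'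
    proof -
      have "pd (p r) (p r') \<le> cell_dist e (p r) (p r')"
        using that pcell step by (intro path_dist_le pl_path_cell) auto
      also have "\<dots> = \<bar>r / k - r' / k\<bar> * k" unfolding p_def cell_dist_scale k_def ..
      also have "\<dots> = r' - r" using that k by (simp add: field_simps)
      finally show ?thesis .
    qed
    have p0: "p 0 = y" "p k = z" using k by (auto simp: p_def)
    define c' where "c' t = (if t \<le> l then c t else p (t - l))" for t
    have "c' \<in> {0..l + k} \<rightarrow> Y" using c pY by (auto simp: c'_def)
    moreover have "c' 0 = x" "c' (l + k) = z" using c l k p0 by (auto simp: c'_def)
    moreover have "pd (c' s) (c' t) \<le> t - s" if "0 \<le> s" "s \<le> t" "t \<le> l + k" for s t
    proof -
      consider "t \<le> l" | "s \<le> l" "l < t" | "l < s" using that by linarith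
      then show ?thesis
      proof cases
        case 1
        then show ?thesis using lip that by (simp add: c'_def)
      next
        case 2
        have "pd (c s) (p (t - l)) \<le> pd (c s) y + pd y (p (t - l))"
          using that 2 pY c(1) step l pl_path_realization by (intro path_dist_triangle) auto
        also have "\<dots> \<le> (l - s) + (t - l)"
          using lip[of s l] plip[of 0 "t - l"] c p0 that 2 l by (intro add_mono) auto
        finally show ?thesis using 2 by (simp add: c'_def)
      next
        case 3
        then show ?thesis using plip[of "s - l" "t - l"] that by (simp add: c'_def)
      qed
    qed
    ultimately show ?thesis unfolding k_def[symmetric] by (intro exI[of _ c']) auto
  qed
qed

lemma geodesic_realization: "geodesic_space Y pd"
  unfolding geodesic_space_def
proof (intro conjI ballI metric_realization)
  fix x y assume xy: "x \<in> Y" "y \<in> Y"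
  define l where "l = pd x y"
  obtain c where c: "c \<in> {0..l} \<rightarrow> Y" "c 0 = x" "c l = y"
    and lip: "\<And>s t. s \<in> {0..l} \<Longrightarrow> t \<in> {0..l} \<Longrightarrow> s \<le> t \<Longrightarrow> pd (c s) (c t) \<le> t - s"
    using pl_path_parametrization[OF path_dist_path[OF xy]] unfolding l_def by blast
  have l: "0 \<le> l" unfolding l_def by (rule path_dist_nonneg)
  \<comment> \<open>A 1-Lipschitz path whose length is the distance of its endpoints cannot be shortened anywhere.\<close>
  have eq: "pd (c s) (c t) = t - s" if "0 \<le> s" "s \<le> t" "t \<le> l" for s t
  proof -
    have Y: "c s \<in> Y" "c t \<in> Y" using c that by auto
    have "l \<le> pd x (c s) + (pd (c s) (c t) + pd (c t) y)"
      unfolding l_def using path_dist_triangle[OF xy(1) Y(1) xy(2)] path_dist_triangle[OF Y xy(2)] by linarith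
    moreover have "pd x (c s) \<le> s" "pd (c t) y \<le> l - t"
      using lip[of 0 s] lip[of t l] c that l by auto
    ultimately show ?thesis using lip[of s t] that by simp
  qed
  have "pd (c s) (c t) = \<bar>s - t\<bar>" if "s \<in> {0..l}" "t \<in> {0..l}" for s t
    using eq[of s t] eq[of t s] that path_dist_commute[of V E "c s" "c t"] by (cases "s \<le> t") auto
  then show "\<exists>A. geodesic_segment Y pd A x y"
    unfolding geodesic_segment_def using c l by blast
qed

end

context fg_group begin

lemma cayley_edgeI:
  "g \<in> carrier G \<Longrightarrow> s \<in> S \<Longrightarrow> g \<otimes> s \<noteq> g \<Longrightarrow> {g, g \<otimes> s} \<in> cayley_edges G S"
  unfolding cayley_edges_def by (intro CollectI exI[of _ g] exI[of _ s]) simp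

text \<open>The last edge of a geodesic from \<open>u\<close> to \<open>w\<close> is obtained by splitting off the first letter of
  \<open>inv w \<otimes> u\<close>, the inverse of the word from \<open>u\<close> to \<open>w\<close>.\<close>

lemma graph_distance_cayley: "graph_distance (carrier G) (cayley_edges G S) word_dist"
proof
  fix e assume "e \<in> cayley_edges G S"
  then obtain g s where gs: "g \<in> carrier G" "s \<in> S" "g \<otimes> s \<noteq> g" "e = {g, g \<otimes> s}"
    by (auto simp: cayley_edges_def)
  have s: "s \<in> carrier G" using gs generators_closed by blast
  have "word_dist g (g \<otimes> s) \<le> 1"
    using wl_generator[of s] gs s by (simp add: word_dist_def m_assoc[symmetric])
  then show "\<exists>u\<in>carrier G. \<exists>v\<in>carrier G. u \<noteq> v \<and> e = {u, v} \<and> word_dist u v \<le> 1"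
    using gs s by (intro bexI[of _ g] bexI[of _ "g \<otimes> s"]) auto
next
  fix u v assume uv: "u \<in> carrier G" "v \<in> carrier G"
  show "word_dist u v = word_dist v u" using uv by (rule word_dist_commute)
  have "inv u \<otimes> v = \<one> \<longleftrightarrow> u = v" using uv by (metis inv_solve_left' r_one l_inv one_closed)
  then show "word_dist u v = 0 \<longleftrightarrow> u = v" unfolding word_dist_def using wl_eq_0[of "inv u \<otimes> v"] uv by simp
next
  fix u w n assume uw: "u \<in> carrier G" "w \<in> carrier G" "word_dist u w = Suc n"
  then have "wl (inv w \<otimes> u) = Suc n" using word_dist_commute by (simp add: word_dist_def)
  then obtain s h where sh: "s \<in> symmetrized S" "h \<in> carrier G" "inv w \<otimes> u = s \<otimes> h" "wl h = n"
    using wl_Suc_split uw by (metis inv_closed m_closed)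
  have s: "s \<in> carrier G" using sh symmetrized_closed by blast
  define v where "v = w \<otimes> s"
  have v: "v \<in> carrier G" using uw s v_def by simp
  have "inv v \<otimes> u = inv s \<otimes> (inv w \<otimes> u)"
    using uw s by (simp add: v_def inv_mult_group m_assoc)
  also have "\<dots> = h" unfolding sh(3) using s sh by (simp add: m_assoc[symmetric])
  finally have "inv v \<otimes> u = h" .
  then have uv: "word_dist u v = n" using word_dist_commute[OF uw(1) v] sh by (simp add: word_dist_def)
  then have ne: "v \<noteq> w" using uw by auto
  have "{v, w} \<in> cayley_edges G S"
  proof (cases "s \<in> S")
    case True
    then have "{w, w \<otimes> s} \<in> cayley_edges G S" using uw ne unfolding v_def by (intro cayley_edgeI) auto
    then show ?thesis by (simp add: v_def insert_commute)
  next
    case False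
    then obtain t where t: "t \<in> S" "s = inv t" using sh by blast
    have "w = v \<otimes> t" using t generators_closed uw v_def by (auto simp: m_assoc subset_iff)
    then have "v \<otimes> t \<noteq> v" using ne by simp
    then have "{v, v \<otimes> t} \<in> cayley_edges G S" using t(1) v by (intro cayley_edgeI)
    then show ?thesis using \<open>w = v \<otimes> t\<close> by simp
  qed
  then show "\<exists>v\<in>carrier G. {v, w} \<in> cayley_edges G S \<and> word_dist u v = n" using v uv by blast
qed (auto intro: word_dist_triangle)

end

text \<open>A function that is controlled along the edges near \<open>g\<close> is controlled between \<open>g\<close> and the
  vertices near it. The generating set need not be symmetric, so an edge may be traversed backwards.\<close>

lemma (in fg_group) lipschitz_along_words:
  fixes f :: "'a \<Rightarrow> 'x" and D :: "'x \<Rightarrow> 'x \<Rightarrow> real"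
  assumes refl: "\<And>u. u \<in> carrier G \<Longrightarrow> D (f u) (f u) \<le> 0"
    and sym: "\<And>u w. u \<in> carrier G \<Longrightarrow> w \<in> carrier G \<Longrightarrow> D (f u) (f w) = D (f w) (f u)"
    and triangle: "\<And>u v w. u \<in> carrier G \<Longrightarrow> v \<in> carrier G \<Longrightarrow> w \<in> carrier G \<Longrightarrow>
                     D (f u) (f w) \<le> D (f u) (f v) + D (f v) (f w)"
    and gen: "\<And>u s. u \<in> carrier G \<Longrightarrow> word_dist g u \<le> n \<Longrightarrow> s \<in> S \<Longrightarrow> D (f u) (f (u \<otimes> s)) \<le> J"
    and g: "g \<in> carrier G" and w: "w \<in> carrier G" "word_dist g w \<le> n"
  shows "D (f g) (f w) \<le> real (word_dist g w) * J"
  using w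
proof (induction "word_dist g w" arbitrary: w)
  interpret graph_distance "carrier G" "cayley_edges G S" word_dist by (rule graph_distance_cayley)
  case 0
  then show ?case using D_eq_0[OF g 0(2)] refl by simp
next
  interpret graph_distance "carrier G" "cayley_edges G S" word_dist by (rule graph_distance_cayley)
  case (Suc m)
  obtain v where v: "v \<in> carrier G" "{v, w} \<in> cayley_edges G S" "word_dist g v = m"
    using D_Suc[OF g Suc.prems(1) Suc.hyps(2)[symmetric]] by blast
  obtain h s where hs: "h \<in> carrier G" "s \<in> S" "{v, w} = {h, h \<otimes> s}"
    using v(2) unfolding cayley_edges_def by blast
  have "D (f v) (f w) \<le> J"
  proof -
    consider "v = h" "w = h \<otimes> s" | "w = h" "v = h \<otimes> s" using hs(3) by (metis doubleton_eq_iff)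
    then show ?thesis
    proof cases
      case 1
      then show ?thesis using gen[of v s] v hs Suc by simp
    next
      case 2
      then show ?thesis using gen[of w s] v hs Suc sym[of v w] by simp
    qed
  qed
  moreover have "D (f g) (f v) \<le> real m * J" using Suc.hyps(1)[of v] v Suc by simp
  ultimately have "D (f g) (f w) \<le> real m * J + J" using triangle[OF g v(1) Suc.prems(1)] by linarith
  then show ?case unfolding Suc.hyps(2)[symmetric] by (simp add: algebra_simps)
qed

section \<open>Geodesic triangles\<close>

locale geodesic_metric =
  fixes Y :: "'x set" and d :: "'x \<Rightarrow> 'x \<Rightarrow> real"
  assumes geodesic: "geodesic_space Y d"
begin

sublocale Metric_space Y d
  using geodesic by (simp add: geodesic_space_def)

abbreviation seg :: "'x set \<Rightarrow> 'x \<Rightarrow> 'x \<Rightarrow> bool" where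
  "seg \<equiv> geodesic_segment Y d"

lemma seg_parametrization:
  assumes "seg A x y"
  obtains c where "c \<in> {0..d x y} \<rightarrow> Y" "c 0 = x" "c (d x y) = y" "A = c ` {0..d x y}"
    "\<And>s t. s \<in> {0..d x y} \<Longrightarrow> t \<in> {0..d x y} \<Longrightarrow> d (c s) (c t) = \<bar>s - t\<bar>"
proof -
  obtain l c where lc: "0 \<le> l" "c \<in> {0..l} \<rightarrow> Y" "c 0 = x" "c l = y" "A = c ` {0..l}"
    and iso: "\<forall>s\<in>{0..l}. \<forall>t\<in>{0..l}. d (c s) (c t) = \<bar>s - t\<bar>"
    using assms unfolding geodesic_segment_def by (elim exE conjE)
  have "d x y = l" using iso[rule_format, of 0 l] lc by simp
  then show ?thesis using that[of c] lc iso by simp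
qed

lemma seg_of_parametrization:
  assumes "c \<in> {a..b} \<rightarrow> Y" "a \<le> b"
    "\<And>s t. s \<in> {a..b} \<Longrightarrow> t \<in> {a..b} \<Longrightarrow> d (c s) (c t) = \<bar>s - t\<bar>"
  shows "seg (c ` {a..b}) (c a) (c b)"
  unfolding geodesic_segment_def
proof (intro exI conjI)
  have "{a..b} = (\<lambda>s. a + s) ` {0..b - a}" by simp
  then show "c ` {a..b} = (\<lambda>s. c (a + s)) ` {0..b - a}" by (metis image_image)
qed (use assms in auto)

lemma seg_subset: "seg A x y \<Longrightarrow> A \<subseteq> Y"
  by (elim seg_parametrization) auto

lemma seg_ends:
  assumes "seg A x y"
  shows "x \<in> A \<and> y \<in> A"
  using assms
proof (rule seg_parametrization)
  fix c assume "c 0 = x" "c (d x y) = y" "A = c ` {0..d x y}"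
  moreover have "0 \<in> {0..d x y}" "d x y \<in> {0..d x y}" by auto
  ultimately show ?thesis by (metis imageI)
qed

lemma seg_exists: "x \<in> Y \<Longrightarrow> y \<in> Y \<Longrightarrow> \<exists>A. seg A x y"
  using geodesic by (simp add: geodesic_space_def)

lemma seg_sym:
  assumes "seg A x y"
  shows "seg A y x"
proof -
  obtain c where c: "c \<in> {0..d x y} \<rightarrow> Y" "c 0 = x" "c (d x y) = y" "A = c ` {0..d x y}"
    and iso: "\<And>s t. s \<in> {0..d x y} \<Longrightarrow> t \<in> {0..d x y} \<Longrightarrow> d (c s) (c t) = \<bar>s - t\<bar>"
    using seg_parametrization[OF assms] by metis
  let ?l = "d x y"
  have "c ` {0..?l} = (\<lambda>s. c (?l - s)) ` {0..?l}"
  proof -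
    have "{0..?l} = (\<lambda>s. ?l - s) ` {0..?l}" by simp
    then show ?thesis by (metis image_image)
  qed
  then show ?thesis
    unfolding geodesic_segment_def using c iso
    by (intro exI[of _ ?l] exI[of _ "\<lambda>s. c (?l - s)"]) auto
qed

lemma seg_dist:
  assumes "seg A x y" "u \<in> A"
  shows "d x u + d u y = d x y"
  using assms(1)
proof (rule seg_parametrization)
  fix c assume c: "c 0 = x" "c (d x y) = y" "A = c ` {0..d x y}"
    and iso: "\<And>s t. s \<in> {0..d x y} \<Longrightarrow> t \<in> {0..d x y} \<Longrightarrow> d (c s) (c t) = \<bar>s - t\<bar>"
  obtain s where s: "s \<in> {0..d x y}" "u = c s" using assms c by blast
  then show ?thesis using iso[of 0 s] iso[of s "d x y"] c by simp
qed

lemma seg_point_at: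
  assumes "seg A x y" "0 \<le> t" "t \<le> d x y"
  obtains u where "u \<in> A" "d x u = t"
  using assms(1)
proof (rule seg_parametrization)
  fix c assume c: "c 0 = x" "A = c ` {0..d x y}"
    and iso: "\<And>s t. s \<in> {0..d x y} \<Longrightarrow> t \<in> {0..d x y} \<Longrightarrow> d (c s) (c t) = \<bar>s - t\<bar>"
  show ?thesis using iso[of 0 t] assms(2,3) c by (intro that[of "c t"]) auto
qed

lemma seg_sub:
  assumes "seg A x y" "u \<in> A" "v \<in> A"
  shows "\<exists>B\<subseteq>A. seg B u v"
proof -
  obtain c where c: "c \<in> {0..d x y} \<rightarrow> Y" "A = c ` {0..d x y}"
    and iso: "\<And>s t. s \<in> {0..d x y} \<Longrightarrow> t \<in> {0..d x y} \<Longrightarrow> d (c s) (c t) = \<bar>s - t\<bar>"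
    using seg_parametrization[OF assms(1)] by metis
  have *: "\<exists>B\<subseteq>A. seg B (c s) (c t)" if "0 \<le> s" "s \<le> t" "t \<le> d x y" for s t
  proof (intro exI conjI)
    show "seg (c ` {s..t}) (c s) (c t)" using c iso that by (intro seg_of_parametrization) auto
    show "c ` {s..t} \<subseteq> A" using c that by auto
  qed
  obtain s t where st: "s \<in> {0..d x y}" "t \<in> {0..d x y}" "u = c s" "v = c t"
    using assms c by blast
  show ?thesis
  proof (cases "s \<le> t")
    case True
    then show ?thesis using *[of s t] st by simp
  next
    case False
    then obtain B where "B \<subseteq> A" "seg B v u" using *[of t s] st by auto
    then show ?thesis using seg_sym by blast
  qed
qed

text \<open>Paths are represented by chains of points of a set with steps of length at most 1; the
  number of steps measures the length.\<close>

definition steps :: "'x set \<Rightarrow> ('x \<times> 'x) set" where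
  "steps U = {(u, v). u \<in> U \<and> v \<in> U \<and> d u v \<le> 1}"

lemma steps_relpow_sym: "(u, v) \<in> steps U ^^ n \<Longrightarrow> (v, u) \<in> steps U ^^ n"
proof (induction n arbitrary: v)
  case (Suc n)
  then obtain w where "(u, w) \<in> steps U ^^ n" "(v, w) \<in> steps U" by (auto simp: steps_def commute)
  then show ?case using Suc.IH relpow_Suc_I2 by metis
qed simp

lemma steps_relpow_trans:
  "(u, v) \<in> steps U ^^ m \<Longrightarrow> (v, w) \<in> steps U ^^ n \<Longrightarrow> (u, w) \<in> steps U ^^ (m + n)"
  by (auto simp: relpow_add)

lemma seg_steps:
  assumes "seg A x y" "A \<subseteq> U" "d x y \<le> real n"
  shows "(x, y) \<in> steps U ^^ n"
  unfolding relpow_fun_conv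
proof -
  obtain c where c: "c 0 = x" "c (d x y) = y" "A = c ` {0..d x y}"
    and iso: "\<And>s t. s \<in> {0..d x y} \<Longrightarrow> t \<in> {0..d x y} \<Longrightarrow> d (c s) (c t) = \<bar>s - t\<bar>"
    using seg_parametrization[OF assms(1)] by metis
  let ?t = "\<lambda>i. min (real i) (d x y)"
  have "(c (?t i), c (?t (Suc i))) \<in> steps U" for i
  proof -
    have "?t i \<in> {0..d x y}" "?t (Suc i) \<in> {0..d x y}" by auto
    then show ?thesis unfolding steps_def using iso[of "?t i" "?t (Suc i)"] c assms(2) by auto
  qed
  then show "\<exists>f. f 0 = x \<and> f n = y \<and> (\<forall>i<n. (f i, f (Suc i)) \<in> steps U)"
    using c assms(3) by (intro exI[of _ "\<lambda>i. c (?t i)"]) auto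
qed

lemma seg_steps_ceiling:
  assumes "seg A x y" "A \<subseteq> U" "d x y \<le> b"
  shows "(x, y) \<in> steps U ^^ nat \<lceil>b\<rceil>"
  using assms of_nat_ceiling[of b] by (intro seg_steps[of A]) auto

text \<open>Slimness is restricted to triangles of bounded perimeter because it is then bounded
  (\<open>slim_below_perimeter\<close>), which makes an almost extremal triangle available.\<close>

definition slim_below :: "real \<Rightarrow> real \<Rightarrow> bool" where
  "slim_below N r \<longleftrightarrow> (\<forall>x y z A B C. seg A x y \<and> seg B y z \<and> seg C z x \<and>
     d x y + d y z + d z x \<le> N \<longrightarrow> (\<forall>a\<in>A. \<exists>b\<in>B \<union> C. d a b \<le> r))"

lemma slim_belowD:
  assumes "slim_below N r" "seg A x y" "seg B y z" "seg C z x" "d x y + d y z + d z x \<le> N" "a \<in> A"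
  obtains b where "b \<in> B \<union> C" "d a b \<le> r"
  using assms unfolding slim_below_def by blast

lemma slim_below_perimeter: "N \<le> r \<Longrightarrow> slim_below N r"
  unfolding slim_below_def
proof (intro allI impI ballI)
  fix x y z A B C a
  assume N: "N \<le> r" and t: "seg A x y \<and> seg B y z \<and> seg C z x \<and> d x y + d y z + d z x \<le> N" and a: "a \<in> A"
  have "d x a + d a y = d x y" using seg_dist t a by blast
  moreover have "d x a \<ge> 0" "d y z \<ge> 0" "d z x \<ge> 0" by auto
  ultimately have "d a y \<le> r" using N t by linarith
  moreover have "y \<in> B" using seg_ends t by blast
  ultimately show "\<exists>b\<in>B \<union> C. d a b \<le> r" by blast
qed

text \<open>Starting from a fat triangle one doubles the constant until all triangles of at most its perimeter
  are slim.\<close>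

lemma extremal_fat_triangle:
  assumes "\<not> hyperbolic_space Y d" "K > 0"
  obtains N r where "r \<ge> K" "\<not> slim_below N r" "slim_below N (2 * r)"
proof -
  have "\<not> delta_hyperbolic K Y d" using assms unfolding hyperbolic_space_def by auto
  then obtain x y z A B C a where t: "seg A x y" "seg B y z" "seg C z x" and a: "a \<in> A"
    "\<forall>b\<in>B \<union> C. \<not> d a b \<le> K"
    unfolding delta_hyperbolic_def using geodesic by blast
  define N where "N = d x y + d y z + d z x"
  have fat: "\<not> slim_below N (2 ^ 0 * K)"
  proof
    assume "slim_below N (2 ^ 0 * K)"
    from slim_belowD[OF this t _ a(1)] a(2) show False unfolding N_def by auto
  qed
  have "\<exists>k. \<not> slim_below N (2 ^ k * K) \<and> slim_below N (2 ^ Suc k * K)"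
  proof (rule ccontr)
    assume *: "\<not> ?thesis"
    have all: "\<not> slim_below N (2 ^ k * K)" for k
      by (induction k) (use fat * in blast)+
    obtain k where "N / K < 2 ^ k" using real_arch_pow[of 2 "N / K"] by auto
    then have "N \<le> 2 ^ k * K" using assms(2) by (simp add: field_simps)
    then show False using all slim_below_perimeter by blast
  qed
  then obtain k where "\<not> slim_below N (2 ^ k * K)" "slim_below N (2 * (2 ^ k * K))"
    by (auto simp: mult.assoc)
  moreover have "2 ^ k * K \<ge> K" using assms(2) by simp
  ultimately show ?thesis using that by blast
qed

text \<open>Two points on the two sides that meet in \<open>z\<close> are joined along these sides. If \<open>z\<close> is far
  away, the smaller triangle that they form with \<open>z\<close>, being slim too, provides a shortcut between the
  sides, at a distance from the first point large enough to stay away from \<open>q\<close>.\<close>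

lemma shortcut_across_corner:
  assumes slim: "slim_below N (2 * r)" and r: "r > 0"
    and tri: "seg A x y" "seg B y z" "seg C z x" "d x y + d y z + d z x \<le> N"
    and q: "q \<in> Y" "\<And>b. b \<in> B \<union> C \<Longrightarrow> r \<le> d q b"
    and w: "w1 \<in> C" "w2 \<in> B" "d w1 w2 \<le> 12 * r" "d q w1 \<le> 6 * r"
  shows "\<exists>n. real n \<le> 56 * r + 3 \<and> (w1, w2) \<in> steps {u\<in>Y. r \<le> d q u} ^^ n"
proof -
  let ?U = "{u\<in>Y. r \<le> d q u}"
  have BC: "B \<subseteq> ?U" "C \<subseteq> ?U" using q(2) seg_subset tri by blast+
  have Y: "x \<in> Y" "y \<in> Y" "z \<in> Y" "w1 \<in> Y" "w2 \<in> Y"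
    using tri seg_subset seg_ends w by blast+
  obtain C1 where C1: "C1 \<subseteq> C" "seg C1 w1 z" using seg_sub[OF tri(3), of w1 z] seg_ends tri w by blast
  obtain B1 where B1: "B1 \<subseteq> B" "seg B1 z w2" using seg_sub[OF tri(2), of z w2] seg_ends tri w by blast
  show ?thesis
  proof (cases "d w1 z \<le> 20 * r")
    case True
    have "d z w2 \<le> d z w1 + d w1 w2" using Y by (intro triangle)
    then have "d z w2 \<le> 32 * r" using True w commute[of z w1] by linarith
    then have "(z, w2) \<in> steps ?U ^^ nat \<lceil>32 * r\<rceil>"
      using B1 BC by (intro seg_steps_ceiling[OF B1(2)]) auto
    moreover have "(w1, z) \<in> steps ?U ^^ nat \<lceil>20 * r\<rceil>"
      using True C1 BC by (intro seg_steps_ceiling[OF C1(2)]) auto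
    ultimately have "(w1, w2) \<in> steps ?U ^^ (nat \<lceil>20 * r\<rceil> + nat \<lceil>32 * r\<rceil>)"
      using steps_relpow_trans by blast
    moreover have "real (nat \<lceil>20 * r\<rceil> + nat \<lceil>32 * r\<rceil>) \<le> 56 * r + 3" using r by linarith
    ultimately show ?thesis by blast
  next
    case False
    obtain w where ww: "w \<in> C1" "d w1 w = 20 * r" using seg_point_at[OF C1(2), of "20 * r"] False r by auto
    obtain D where D: "seg D w2 w1" using seg_exists Y by blast
    have "d w1 z + d z w2 + d w2 w1 \<le> N"
    proof -
      have "d z w1 + d w1 x = d z x" "d y w2 + d w2 z = d y z" using seg_dist tri w by blast+
      moreover have "d w2 w1 \<le> d w2 y + d y x + d x w1"
        using triangle[OF Y(5,2,4)] triangle[OF Y(2,1,4)] by linarith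
      ultimately show ?thesis using tri(4) commute by (smt (verit))
    qed
    then obtain w' where w': "w' \<in> B1 \<union> D" "d w w' \<le> 2 * r"
      using slim_belowD[OF slim C1(2) B1(2) D _ ww(1)] by blast
    have wY: "w \<in> Y" "w' \<in> Y" using ww w' C1 B1 D seg_subset by blast+
    have "w' \<notin> D"
    proof
      assume "w' \<in> D"
      then have "d w2 w' + d w' w1 = d w2 w1" using D seg_dist by blast
      then have "d w' w1 \<le> 12 * r" using w(3) commute[of w1 w2] nonneg[of w2 w'] by linarith
      then show False using triangle[OF Y(4) wY(2,1)] ww(2) w'(2) r commute[of w1 w'] commute[of w w'] by linarith
    qed
    then have w'B: "w' \<in> B" using w' B1 by blast
    obtain C2 where C2: "C2 \<subseteq> C" "seg C2 w1 w" using seg_sub[OF tri(3), of w1 w] ww C1 w by blast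
    obtain B2 where B2: "B2 \<subseteq> B" "seg B2 w' w2" using seg_sub[OF tri(2), of w' w2] w'B w by blast
    obtain F where F: "seg F w w'" using seg_exists wY by blast
    have "F \<subseteq> ?U"
    proof
      fix u assume u: "u \<in> F"
      have uY: "u \<in> Y" using u F seg_subset by blast
      have "d w u \<le> 2 * r" using seg_dist[OF F u] w'(2) nonneg[of u w'] by linarith
      moreover have "d w1 w \<le> d w1 q + d q u + d u w"
        using triangle[OF Y(4) q(1) wY(1)] triangle[OF q(1) uY wY(1)] by linarith
      ultimately show "u \<in> ?U" using uY ww(2) w(4) commute[of w1 q] commute[of u w] r by simp
    qed
    then have "(w, w') \<in> steps ?U ^^ nat \<lceil>2 * r\<rceil>" using w' by (intro seg_steps_ceiling[OF F]) auto
    moreover have "(w1, w) \<in> steps ?U ^^ nat \<lceil>20 * r\<rceil>" using ww C2 BC by (intro seg_steps_ceiling[OF C2(2)]) auto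
    moreover have "(w', w2) \<in> steps ?U ^^ nat \<lceil>34 * r\<rceil>"
    proof -
      have "d w' w2 \<le> d w' w + d w w1 + d w1 w2"
        using triangle[OF wY(2,1) Y(5)] triangle[OF wY(1) Y(4,5)] by linarith
      then have "d w' w2 \<le> 34 * r" using w' ww w commute[of w w'] commute[of w w1] by linarith
      then show ?thesis using B2 BC by (intro seg_steps_ceiling[OF B2(2)]) auto
    qed
    ultimately have "(w1, w2) \<in> steps ?U ^^ (nat \<lceil>20 * r\<rceil> + (nat \<lceil>2 * r\<rceil> + nat \<lceil>34 * r\<rceil>))"
      using steps_relpow_trans by blast
    moreover have "real (nat \<lceil>20 * r\<rceil> + (nat \<lceil>2 * r\<rceil> + nat \<lceil>34 * r\<rceil>)) \<le> 56 * r + 3" using r by linarith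
    ultimately show ?thesis by blast
  qed
qed

text \<open>Nonhyperbolicity is visible on loops whose length is proportional to their width, at
  arbitrarily large scales. Around a point \<open>q\<close> of an extremal triangle one cuts out the part of its
  side within \<open>4 * r\<close>; near the ends of this part the triangle is \<open>2 * r\<close>-slim, which leads to the
  other two sides without approaching \<open>q\<close>.\<close>

lemma nonhyperbolic_detour:
  assumes "\<not> hyperbolic_space Y d" "K \<ge> 1"
  shows "\<exists>r\<ge>K. \<exists>x y Q q n. seg Q x y \<and> q \<in> Q \<and> d x y \<le> 8 * r \<and> 0 < n \<and> real n \<le> 70 * r \<and>
           (x, y) \<in> steps {u\<in>Y. r \<le> d q u} ^^ n"
proof -
  obtain N r where r: "r \<ge> K" and fat: "\<not> slim_below N r" and slim: "slim_below N (2 * r)"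
    using extremal_fat_triangle[OF assms(1), of K] assms(2) by (metis less_le_trans zero_less_one)
  obtain x y z A B C q where tri: "seg A x y" "seg B y z" "seg C z x" "d x y + d y z + d z x \<le> N"
    and q: "q \<in> A" "\<And>b. b \<in> B \<union> C \<Longrightarrow> \<not> d q b \<le> r"
    using fat unfolding slim_below_def by blast
  have r1: "r \<ge> 1" using r assms by simp
  let ?U = "{u\<in>Y. r \<le> d q u}"
  have qY: "q \<in> Y" using q tri seg_subset by blast
  have BC: "B \<union> C \<subseteq> ?U" using q(2) seg_subset tri by fastforce
  obtain c where c: "c \<in> {0..d x y} \<rightarrow> Y" "c 0 = x" "c (d x y) = y" "A = c ` {0..d x y}"
    and iso: "\<And>s t. s \<in> {0..d x y} \<Longrightarrow> t \<in> {0..d x y} \<Longrightarrow> d (c s) (c t) = \<bar>s - t\<bar>"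
    using seg_parametrization[OF tri(1)] by metis
  obtain s where s: "s \<in> {0..d x y}" "q = c s" using q c by blast
  define s1 where "s1 = max 0 (s - 4 * r)"
  define s2 where "s2 = min (d x y) (s + 4 * r)"
  have s12: "0 \<le> s1" "s1 \<le> s" "s \<le> s2" "s2 \<le> d x y" "s2 - s1 \<le> 8 * r"
    using s r1 unfolding s1_def s2_def by auto
  have exit: "\<exists>w\<in>B \<union> C. d (c t) w \<le> 2 * r \<and> (c t, w) \<in> steps ?U ^^ nat \<lceil>2 * r\<rceil>"
    if t: "t \<in> {0..d x y}" "\<bar>s - t\<bar> = 4 * r \<or> t = 0 \<or> t = d x y" for t
  proof -
    have ctY: "c t \<in> Y" using t c by auto
    have "\<exists>w\<in>B \<union> C. d (c t) w \<le> 2 * r \<and> (\<forall>D. seg D (c t) w \<longrightarrow> D \<subseteq> ?U)"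
    proof (cases "\<bar>s - t\<bar> = 4 * r")
      case True
      obtain w where w: "w \<in> B \<union> C" "d (c t) w \<le> 2 * r"
        using slim_belowD[OF slim tri, of "c t"] c t by blast
      have "D \<subseteq> ?U" if D: "seg D (c t) w" for D
      proof
        fix u assume u: "u \<in> D"
        then have uY: "u \<in> Y" using D seg_subset by blast
        have "d (c t) u \<le> 2 * r" using seg_dist[OF D u] w nonneg[of u w] by linarith
        moreover have "d q (c t) = 4 * r" using iso[OF s(1) t(1)] s True by simp
        ultimately show "u \<in> ?U"
          using triangle[OF qY uY ctY] commute[of u "c t"] uY r1 by simp
      qed
      then show ?thesis using w by blast
    next
      case False
      then have "c t \<in> B \<union> C" using t c seg_ends tri by auto
      moreover have "D \<subseteq> ?U" if D: "seg D (c t) (c t)" for D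
      proof
        fix u assume u: "u \<in> D"
        have uY: "u \<in> Y" using D seg_subset u by blast
        have "d (c t) u \<le> 0" using seg_dist[OF D u] mdist_zero[OF ctY] nonneg[of u "c t"] by linarith
        then have "u = c t" using zero[OF ctY uY] nonneg[of "c t" u] by auto
        then show "u \<in> ?U" using \<open>c t \<in> B \<union> C\<close> BC by blast
      qed
      ultimately show ?thesis using r1 mdist_zero[OF ctY] by (intro bexI[of _ "c t"]) auto
    qed
    then obtain w where w: "w \<in> B \<union> C" "d (c t) w \<le> 2 * r" "\<forall>D. seg D (c t) w \<longrightarrow> D \<subseteq> ?U"
      by blast
    moreover obtain D where "seg D (c t) w" using seg_exists ctY w(1) BC by blast
    ultimately have "(c t, w) \<in> steps ?U ^^ nat \<lceil>2 * r\<rceil>" by (intro seg_steps_ceiling) auto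
    then show ?thesis using w by blast
  qed
  have t1: "s1 \<in> {0..d x y}" "\<bar>s - s1\<bar> = 4 * r \<or> s1 = 0 \<or> s1 = d x y"
    and t2: "s2 \<in> {0..d x y}" "\<bar>s - s2\<bar> = 4 * r \<or> s2 = 0 \<or> s2 = d x y"
    using s12 s r1 unfolding s1_def s2_def by auto
  obtain w1 where w1: "w1 \<in> B \<union> C" "d (c s1) w1 \<le> 2 * r" "(c s1, w1) \<in> steps ?U ^^ nat \<lceil>2 * r\<rceil>"
    using exit[OF t1] by blast
  obtain w2 where w2: "w2 \<in> B \<union> C" "d (c s2) w2 \<le> 2 * r" "(c s2, w2) \<in> steps ?U ^^ nat \<lceil>2 * r\<rceil>"
    using exit[OF t2] by blast
  have Y: "w1 \<in> Y" "w2 \<in> Y" "c s1 \<in> Y" "c s2 \<in> Y"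
    using w1(1) w2(1) BC t1(1) t2(1) c(1) by blast+
  have d12: "d (c s1) (c s2) \<le> 8 * r" using iso[OF t1(1) t2(1)] s12 by simp
  have dw: "d w1 w2 \<le> 12 * r"
    using triangle[OF Y(1,3,2)] triangle[OF Y(3,4,2)] w1 w2 d12 commute[of w1 "c s1"] by linarith
  have dq: "d q w1 \<le> 6 * r" "d q w2 \<le> 6 * r"
  proof -
    have "d q (c s1) \<le> 4 * r" "d q (c s2) \<le> 4 * r"
      using iso[OF s(1) t1(1)] iso[OF s(1) t2(1)] s(2) s12 r1 unfolding s1_def s2_def by auto
    then show "d q w1 \<le> 6 * r" "d q w2 \<le> 6 * r"
      using triangle[OF qY Y(3,1)] triangle[OF qY Y(4,2)] w1 w2 by linarith+
  qed
  have qBC: "r \<le> d q b" if "b \<in> B \<union> C" for b using q(2)[OF that] by simp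
  have "\<exists>n. real n \<le> 56 * r + 3 \<and> (w1, w2) \<in> steps ?U ^^ n"
  proof -
    have same: ?thesis if D: "w1 \<in> D" "w2 \<in> D" "seg D u v" "D \<subseteq> B \<union> C" for D u v
    proof -
      obtain F where "F \<subseteq> D" "seg F w1 w2" using seg_sub[OF D(3,1,2)] by blast
      then have "(w1, w2) \<in> steps ?U ^^ nat \<lceil>12 * r\<rceil>" using D(4) BC dw by (intro seg_steps_ceiling[of F]) blast+
      then show ?thesis using r1 by (intro exI[of _ "nat \<lceil>12 * r\<rceil>"]) linarith
    qed
    consider "w1 \<in> B" "w2 \<in> B" | "w1 \<in> C" "w2 \<in> C" | "w1 \<in> C" "w2 \<in> B" | "w1 \<in> B" "w2 \<in> C"
      using w1 w2 by blast
    then show ?thesis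
    proof cases
      case 1
      then show ?thesis using same[OF _ _ tri(2)] by blast
    next
      case 2
      then show ?thesis using same[OF _ _ tri(3)] by blast
    next
      case 3
      then show ?thesis
        using shortcut_across_corner[OF slim _ tri qY qBC] dw dq r1 by simp
    next
      case 4
      then show ?thesis
        using shortcut_across_corner[OF slim _ tri qY qBC, of w2 w1] dw dq r1 commute[of w1 w2]
          steps_relpow_sym by fastforce
    qed
  qed
  then obtain n where n: "real n \<le> 56 * r + 3" "(w1, w2) \<in> steps ?U ^^ n" by blast
  have "(c s1, c s2) \<in> steps ?U ^^ (nat \<lceil>2 * r\<rceil> + (n + nat \<lceil>2 * r\<rceil>))"
    using w1(3) n(2) steps_relpow_sym[OF w2(3)] steps_relpow_trans by blast
  moreover have "real (nat \<lceil>2 * r\<rceil> + (n + nat \<lceil>2 * r\<rceil>)) \<le> 70 * r"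
    "0 < nat \<lceil>2 * r\<rceil> + (n + nat \<lceil>2 * r\<rceil>)" using n r1 by linarith+
  moreover have "seg (c ` {s1..s2}) (c s1) (c s2)" using c iso s12 by (intro seg_of_parametrization) auto
  moreover have "q \<in> c ` {s1..s2}" using s s12 by auto
  ultimately show ?thesis using r d12
    by (intro exI[of _ r] conjI exI[of _ "c s1"] exI[of _ "c s2"] exI[of _ "c ` {s1..s2}"] exI[of _ q]
        exI[of _ "nat \<lceil>2 * r\<rceil> + (n + nat \<lceil>2 * r\<rceil>)"])
qed

text \<open>Halve the path repeatedly and apply slimness to the triangle formed by the endpoints and the
  midpoint: a point on the long side is \<open>\<delta>\<close>-close to a geodesic for one of the halves.\<close>

lemma geodesic_close_to_path:
  fixes u :: "nat \<Rightarrow> 'x"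
  assumes hyp: "delta_hyperbolic \<delta> Y d" and J: "0 \<le> J"
    and ij: "i \<le> j" "j - i \<le> 2 ^ k"
    and u: "\<And>l. i \<le> l \<Longrightarrow> l \<le> j \<Longrightarrow> u l \<in> Y"
    and jump: "\<And>l. i \<le> l \<Longrightarrow> l < j \<Longrightarrow> d (u l) (u (Suc l)) \<le> J"
    and A: "seg A (u i) (u j)" "a \<in> A"
  shows "\<exists>l. i \<le> l \<and> l \<le> j \<and> d a (u l) \<le> \<delta> * real k + J"
  using ij u jump A
proof (induction k arbitrary: i j A a)
  case 0
  have uY: "u i \<in> Y" "u j \<in> Y" using 0 by auto
  have "d (u i) (u j) \<le> J"
  proof (cases "i = j")
    case True
    then show ?thesis using J mdist_zero uY by simp
  next
    case False
    then have "j = Suc i" using 0(1,2) by simp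
    then show ?thesis using 0(4)[of i] by simp
  qed
  then have "d a (u j) \<le> J" using seg_dist[OF 0(5,6)] nonneg[of "u i" a] by linarith
  then show ?case using 0 by auto
next
  case (Suc k)
  define m where "m = (i + j) div 2"
  have m: "i \<le> m" "m \<le> j" "m - i \<le> 2 ^ k" "j - m \<le> 2 ^ k" using Suc.prems(1,2) unfolding m_def by auto
  have uY: "u i \<in> Y" "u j \<in> Y" "u m \<in> Y" using Suc.prems(1,3) m by auto
  obtain B where B: "seg B (u m) (u j)" using seg_exists uY by blast
  obtain C where C: "seg C (u i) (u m)" using seg_exists uY by blast
  obtain b where b: "b \<in> B \<union> C" "d a b \<le> \<delta>"
    using hyp uY Suc.prems(5,6) seg_sym[OF B] seg_sym[OF C] unfolding delta_hyperbolic_def by blast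
  have "\<exists>l. i \<le> l \<and> l \<le> j \<and> d b (u l) \<le> \<delta> * real k + J"
  proof (cases "b \<in> C")
    case True
    have "\<exists>l. i \<le> l \<and> l \<le> m \<and> d b (u l) \<le> \<delta> * real k + J"
      by (rule Suc.IH[OF m(1,3) _ _ C True]) (use Suc.prems(3,4) m in auto)
    then show ?thesis using m by force
  next
    case False
    then have "b \<in> B" using b by blast
    then have "\<exists>l. m \<le> l \<and> l \<le> j \<and> d b (u l) \<le> \<delta> * real k + J"
      by (intro Suc.IH[OF m(2,4) _ _ B]) (use Suc.prems(3,4) m in auto)
    then show ?thesis using m(1) le_trans by blast
  qed
  then obtain l where l: "i \<le> l" "l \<le> j" "d b (u l) \<le> \<delta> * real k + J" by blast
  have "a \<in> Y" "b \<in> Y" using seg_subset Suc.prems(5,6) b B C by blast+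
  then have "d a (u l) \<le> d a b + d b (u l)" using Suc.prems(3) l by (intro triangle) auto
  also have "\<dots> \<le> \<delta> * real (Suc k) + J" using b l by (simp add: algebra_simps)
  finally show ?case using l by blast
qed

text \<open>Two paths with the same endpoints in a hyperbolic space: walk along a geodesic joining the
  endpoints. It stays close to both paths, and on the way the nearby index on the first path must
  cross \<open>j\<close>.\<close>

lemma paths_fellow_travel:
  fixes u v :: "nat \<Rightarrow> 'x"
  assumes hyp: "delta_hyperbolic \<delta> Y d" and J: "0 \<le> J"
    and u: "\<And>i. i \<le> k \<Longrightarrow> u i \<in> Y" "\<And>i. i < k \<Longrightarrow> d (u i) (u (Suc i)) \<le> J" "k \<le> 2 ^ e"
    and v: "\<And>i. i \<le> n \<Longrightarrow> v i \<in> Y" "\<And>i. i < n \<Longrightarrow> d (v i) (v (Suc i)) \<le> J" "n \<le> 2 ^ e"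
    and ends: "u 0 = v 0" "u k = v n" and j: "j \<le> k"
  defines "R \<equiv> \<delta> * real e + J"
  shows "\<exists>i i' i''. i \<le> j \<and> j \<le> i' \<and> i' \<le> k \<and> i'' \<le> n \<and>
           d (u i) (u i') \<le> 2 * R + 1 \<and> d (u i) (v i'') \<le> 2 * R"
proof -
  have \<delta>: "0 \<le> \<delta>"
  proof -
    have Y0: "u 0 \<in> Y" using u by simp
    then obtain A where A: "seg A (u 0) (u 0)" using seg_exists by blast
    have "u 0 \<in> A" using seg_ends[OF A] by blast
    then obtain b where "d (u 0) b \<le> \<delta>" using hyp Y0 A unfolding delta_hyperbolic_def by blast
    then show ?thesis using nonneg[of "u 0" b] by linarith
  qed
  obtain A where A: "seg A (u 0) (u k)" using seg_exists u by blast
  define l where "l = d (u 0) (u k)"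
  obtain c where c: "c 0 = u 0" "c l = u k" "A = c ` {0..l}"
    and iso: "\<And>s t. s \<in> {0..l} \<Longrightarrow> t \<in> {0..l} \<Longrightarrow> d (c s) (c t) = \<bar>s - t\<bar>"
    using seg_parametrization[OF A] unfolding l_def by metis
  have l: "0 \<le> l" unfolding l_def by simp
  define a where "a t = c (min (real t) l)" for t :: nat
  have aA: "a t \<in> A" for t unfolding a_def c(3) using l by (intro imageI) auto
  then have aY: "a t \<in> Y" for t using seg_subset[OF A] by blast
  have astep: "d (a t) (a (Suc t)) \<le> 1" for t
    unfolding a_def using iso[of "min (real t) l" "min (real (Suc t)) l"] l by auto
  define N where "N = nat \<lceil>l\<rceil>"
  have a0: "a 0 = u 0" unfolding a_def using c l by simp
  have aN: "a N = u k"
  proof -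
    have "min (real N) l = l" unfolding N_def using of_nat_ceiling[of l] by simp
    then show ?thesis unfolding a_def using c by simp
  qed
  have near_u: "\<exists>i\<le>k. d (a t) (u i) \<le> R" for t
    using geodesic_close_to_path[OF hyp J _ _ _ _ A aA, of e t] u unfolding R_def by auto
  have near_v: "\<exists>i\<le>n. d (a t) (v i) \<le> R" for t
    using geodesic_close_to_path[OF hyp J, of 0 n e v A "a t"] v A aA unfolding R_def ends by auto
  have R: "0 \<le> R" unfolding R_def using J \<delta> by simp
  define P where "P t i \<longleftrightarrow> i \<le> k \<and> d (a t) (u i) \<le> R" for t i
  have P0: "P 0 0" unfolding P_def a0 using u(1)[of 0] R mdist_zero by simp
  have PN: "P N k" unfolding P_def aN using u(1)[of k] R mdist_zero by simp
  define t where "t = (GREATEST t. t \<le> N \<and> (\<exists>i\<le>j. P t i))"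
  have "t \<le> N \<and> (\<exists>i\<le>j. P t i)" unfolding t_def
    by (rule GreatestI_nat[of _ 0 N]) (use P0 in auto)
  then obtain i where i: "t \<le> N" "i \<le> j" "P t i" by blast
  have "\<exists>t' i'. j \<le> i' \<and> P t' i' \<and> d (a t) (a t') \<le> 1"
  proof (cases "t = N")
    case True
    then show ?thesis using PN j aY mdist_zero by (intro exI[of _ N] exI[of _ k]) simp
  next
    case False
    obtain i' where i': "P (Suc t) i'" using near_u unfolding P_def by blast
    have "\<not> i' \<le> j"
    proof
      assume "i' \<le> j"
      then have "Suc t \<le> t" unfolding t_def using i(1) False i'
        by (intro Greatest_le_nat[of _ _ N]) (auto simp: t_def[symmetric])
      then show False by simp
    qed
    then show ?thesis using i' astep by (intro exI[of _ "Suc t"] exI[of _ i']) simp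
  qed
  then obtain t' i' where i': "j \<le> i'" "P t' i'" "d (a t) (a t') \<le> 1" by blast
  obtain i'' where i'': "i'' \<le> n" "d (a t) (v i'') \<le> R" using near_v by blast
  have uY: "u i \<in> Y" "u i' \<in> Y" "v i'' \<in> Y" using i i' i'' u v unfolding P_def by auto
  have "d (u i) (u i') \<le> d (u i) (a t) + d (a t) (a t') + d (a t') (u i')"
    using triangle[OF uY(1) aY uY(2), of t] triangle[OF aY aY uY(2), of t t'] by linarith
  then have "d (u i) (u i') \<le> 2 * R + 1" using i i' commute[of "u i" "a t"] unfolding P_def by linarith
  moreover have "d (u i) (v i'') \<le> 2 * R"
    using triangle[OF uY(1) aY uY(3), of t] i i'' commute[of "u i" "a t"] unfolding P_def by linarith
  ultimately show ?thesis using i i' i'' unfolding P_def by blast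
qed

end

section \<open>The induced action and the tails of the cocycles\<close>

lemma measure_preserving_vimage:
  assumes "measure_preserving M N f" "A \<in> sets N"
  shows "f -` A \<inter> space M \<in> sets M" "emeasure M (f -` A \<inter> space M) = emeasure N A"
  using assms emeasure_distr[of f M N A] measurable_sets[of f M N A]
  by (auto simp: measure_preserving_def)

lemma emeasure_finite_union_le:
  assumes "finite I" "\<And>i. i \<in> I \<Longrightarrow> D i \<in> sets M" "\<And>i. i \<in> I \<Longrightarrow> emeasure M (D i) \<le> ennreal b" "0 \<le> b"
  shows "emeasure M (\<Union>i\<in>I. D i) \<le> ennreal (real (card I) * b)"
proof -
  have "emeasure M (\<Union>i\<in>I. D i) \<le> (\<Sum>i\<in>I. emeasure M (D i))"
    using assms by (intro emeasure_subadditive_finite) auto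
  also have "\<dots> \<le> (\<Sum>i\<in>I. ennreal b)" using assms by (intro sum_mono) auto
  also have "\<dots> = ennreal (real (card I) * b)" using assms by (simp add: ennreal_mult ennreal_of_nat_eq_real_of_nat)
  finally show ?thesis .
qed

locale fg_coupling = G: fg_group \<Gamma> S\<^sub>\<Gamma> + L: fg_group \<Lambda> S\<^sub>\<Lambda> +
    me_coupling \<Gamma> \<Lambda> M \<rho> \<sigma> X\<^sub>\<Gamma> X\<^sub>\<Lambda>
  for \<Gamma> :: "('g, 'm) monoid_scheme" and S\<^sub>\<Gamma> and \<Lambda> :: "('l, 'n) monoid_scheme" and S\<^sub>\<Lambda>
    and M :: "'w measure" and \<rho> \<sigma> X\<^sub>\<Gamma> X\<^sub>\<Lambda>
begin

text \<open>The two groups play symmetric roles in a coupling. By exchanging them, the facts about \<open>\<beta>\<close> below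
  yield those about \<open>\<alpha>\<close>.\<close>

lemma swap: "fg_coupling \<Lambda> S\<^sub>\<Lambda> \<Gamma> S\<^sub>\<Gamma> M \<sigma> \<rho> X\<^sub>\<Lambda> X\<^sub>\<Gamma>"
proof -
  have "me_coupling \<Lambda> \<Gamma> M \<sigma> \<rho> X\<^sub>\<Lambda> X\<^sub>\<Gamma>"
    by unfold_locales (fact standard nonzero domain_\<Gamma> domain_\<Lambda> | rule commuting[symmetric], assumption+)+
  then show ?thesis
    by (intro fg_coupling.intro L.fg_group_axioms G.fg_group_axioms)
qed

abbreviation \<beta> :: "'l \<Rightarrow> 'w \<Rightarrow> 'g" where
  "\<beta> \<equiv> cocycle \<sigma> \<Gamma> \<rho> X\<^sub>\<Gamma>"

text \<open>The action of \<open>\<Lambda>\<close> on \<open>X\<^sub>\<Gamma>\<close> obtained by identifying \<open>X\<^sub>\<Gamma>\<close> with the orbit space of \<open>\<Gamma>\<close>.\<close>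

definition induced :: "'l \<Rightarrow> 'w \<Rightarrow> 'w" where
  "induced h x = \<rho> (\<beta> h x) (\<sigma> h x)"

lemma act_\<Gamma>_space: "g \<in> carrier \<Gamma> \<Longrightarrow> x \<in> space M \<Longrightarrow> \<rho> g x \<in> space M"
  using \<Gamma>.element_image by blast

lemma act_\<Lambda>_space: "h \<in> carrier \<Lambda> \<Longrightarrow> x \<in> space M \<Longrightarrow> \<sigma> h x \<in> space M"
  using \<Lambda>.element_image by blast

lemma X\<^sub>\<Gamma>_sets: "X\<^sub>\<Gamma> \<in> sets M"
  and domain_bij: "bij_betw (\<lambda>(g, x). \<rho> g x) (carrier \<Gamma> \<times> X\<^sub>\<Gamma>) (space M)"
  using domain_\<Gamma>(1) by (auto simp: fundamental_domain_def)

lemma X\<^sub>\<Gamma>_space: "x \<in> X\<^sub>\<Gamma> \<Longrightarrow> x \<in> space M"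
  using X\<^sub>\<Gamma>_sets sets.sets_into_space by blast

lemma domain_translate_exists:
  assumes "w \<in> space M"
  shows "\<exists>g\<in>carrier \<Gamma>. \<rho> g w \<in> X\<^sub>\<Gamma>"
proof -
  have "w \<in> (\<lambda>(g, x). \<rho> g x) ` (carrier \<Gamma> \<times> X\<^sub>\<Gamma>)"
    using domain_bij assms by (simp add: bij_betw_def)
  then obtain g x where "g \<in> carrier \<Gamma>" "x \<in> X\<^sub>\<Gamma>" "w = \<rho> g x" by auto
  then show ?thesis using \<Gamma>.orbit_sym_aux[of g x w] X\<^sub>\<Gamma>_space by (intro bexI[of _ "inv\<^bsub>\<Gamma>\<^esub> g"]) auto
qed

lemma domain_translate_unique:
  assumes "w \<in> space M" "g \<in> carrier \<Gamma>" "g' \<in> carrier \<Gamma>" "\<rho> g w \<in> X\<^sub>\<Gamma>" "\<rho> g' w \<in> X\<^sub>\<Gamma>"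
  shows "g = g'"
proof -
  have "\<rho> (inv\<^bsub>\<Gamma>\<^esub> g) (\<rho> g w) = \<rho> (inv\<^bsub>\<Gamma>\<^esub> g') (\<rho> g' w)"
    using \<Gamma>.orbit_sym_aux assms by simp
  moreover have "inj_on (\<lambda>(g, x). \<rho> g x) (carrier \<Gamma> \<times> X\<^sub>\<Gamma>)" using domain_bij by (simp add: bij_betw_def)
  ultimately have "inv\<^bsub>\<Gamma>\<^esub> g = inv\<^bsub>\<Gamma>\<^esub> g'"
    using inj_onD[of "\<lambda>(g, x). \<rho> g x" "carrier \<Gamma> \<times> X\<^sub>\<Gamma>" "(inv\<^bsub>\<Gamma>\<^esub> g, \<rho> g w)" "(inv\<^bsub>\<Gamma>\<^esub> g', \<rho> g' w)"] assms
    by simp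
  then show ?thesis using assms G.inv_inv by metis
qed

lemma cocycle_spec:
  assumes "h \<in> carrier \<Lambda>" "x \<in> space M"
  shows "\<beta> h x \<in> carrier \<Gamma>" "induced h x \<in> X\<^sub>\<Gamma>"
proof -
  have "\<exists>!g. g \<in> carrier \<Gamma> \<and> \<rho> g (\<sigma> h x) \<in> X\<^sub>\<Gamma>"
    using domain_translate_exists[of "\<sigma> h x"] domain_translate_unique[of "\<sigma> h x"] act_\<Lambda>_space assms by blast
  from theI'[OF this] show "\<beta> h x \<in> carrier \<Gamma>" "induced h x \<in> X\<^sub>\<Gamma>"
    by (simp_all add: induced_def cocycle_def)
qed

lemma cocycle_eqI:
  assumes "h \<in> carrier \<Lambda>" "x \<in> space M" "g \<in> carrier \<Gamma>" "\<rho> g (\<sigma> h x) \<in> X\<^sub>\<Gamma>"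
  shows "\<beta> h x = g"
  using domain_translate_unique[of "\<sigma> h x" "\<beta> h x" g] cocycle_spec[OF assms(1,2)] act_\<Lambda>_space assms
  by (simp add: induced_def)

lemma cocycle_one:
  assumes "x \<in> X\<^sub>\<Gamma>"
  shows "\<beta> \<one>\<^bsub>\<Lambda>\<^esub> x = \<one>\<^bsub>\<Gamma>\<^esub>"
proof -
  have x: "x \<in> space M" using assms X\<^sub>\<Gamma>_space by blast
  then have "\<sigma> \<one>\<^bsub>\<Lambda>\<^esub> x = x" "\<rho> \<one>\<^bsub>\<Gamma>\<^esub> x = x"
    using fun_cong[OF \<Lambda>.id_eq_one, of x] fun_cong[OF \<Gamma>.id_eq_one, of x] by simp_all
  then show ?thesis using cocycle_eqI[OF L.one_closed x G.one_closed] assms by simp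
qed

lemma cocycle_mult:
  assumes "h \<in> carrier \<Lambda>" "k \<in> carrier \<Lambda>" "x \<in> space M"
  shows "\<beta> (h \<otimes>\<^bsub>\<Lambda>\<^esub> k) x = \<beta> h (induced k x) \<otimes>\<^bsub>\<Gamma>\<^esub> \<beta> k x"
    and "induced (h \<otimes>\<^bsub>\<Lambda>\<^esub> k) x = induced h (induced k x)"
proof -
  let ?y = "induced k x"
  have y: "?y \<in> X\<^sub>\<Gamma>" "?y \<in> space M" using cocycle_spec assms X\<^sub>\<Gamma>_space by auto
  have "\<rho> (\<beta> h ?y \<otimes>\<^bsub>\<Gamma>\<^esub> \<beta> k x) (\<sigma> (h \<otimes>\<^bsub>\<Lambda>\<^esub> k) x) = \<rho> (\<beta> h ?y) (\<rho> (\<beta> k x) (\<sigma> h (\<sigma> k x)))"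
    using assms y cocycle_spec act_\<Lambda>_space by (simp add: \<Gamma>.composition_rule \<Lambda>.composition_rule)
  also have "\<rho> (\<beta> k x) (\<sigma> h (\<sigma> k x)) = \<sigma> h ?y"
    unfolding induced_def
    using commuting[OF cocycle_spec(1)[OF assms(2,3)] assms(1) act_\<Lambda>_space[OF assms(2,3)]] by simp
  finally have eq: "\<rho> (\<beta> h ?y \<otimes>\<^bsub>\<Gamma>\<^esub> \<beta> k x) (\<sigma> (h \<otimes>\<^bsub>\<Lambda>\<^esub> k) x) = induced h ?y"
    by (simp add: induced_def)
  then show *: "\<beta> (h \<otimes>\<^bsub>\<Lambda>\<^esub> k) x = \<beta> h ?y \<otimes>\<^bsub>\<Gamma>\<^esub> \<beta> k x"
    using assms y cocycle_spec by (intro cocycle_eqI) auto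
  show "induced (h \<otimes>\<^bsub>\<Lambda>\<^esub> k) x = induced h ?y"
    using eq unfolding * [symmetric] by (simp add: induced_def)
qed

lemma translate_preimage:
  assumes "g \<in> carrier \<Gamma>" "h \<in> carrier \<Lambda>" "A \<in> sets M"
  shows "{x \<in> space M. \<rho> g (\<sigma> h x) \<in> A} \<in> sets M"
    and "emeasure M {x \<in> space M. \<rho> g (\<sigma> h x) \<in> A} = emeasure M A"
proof -
  have eq: "{x \<in> space M. \<rho> g (\<sigma> h x) \<in> A} = \<sigma> h -` (\<rho> g -` A \<inter> space M) \<inter> space M"
    using act_\<Lambda>_space assms by auto
  show "{x \<in> space M. \<rho> g (\<sigma> h x) \<in> A} \<in> sets M"
    "emeasure M {x \<in> space M. \<rho> g (\<sigma> h x) \<in> A} = emeasure M A"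
    unfolding eq using measure_preserving_vimage \<Gamma>.measure_preserving \<Lambda>.measure_preserving assms by metis+
qed

lemma cocycle_set_measurable:
  assumes "h \<in> carrier \<Lambda>"
  shows "{x \<in> X\<^sub>\<Gamma>. P (\<beta> h x)} \<in> sets M"
proof -
  have "{x \<in> X\<^sub>\<Gamma>. P (\<beta> h x)} = (\<Union>g\<in>{g\<in>carrier \<Gamma>. P g}. X\<^sub>\<Gamma> \<inter> {x \<in> space M. \<rho> g (\<sigma> h x) \<in> X\<^sub>\<Gamma>})"
  proof (intro equalityI subsetI)
    fix x assume x: "x \<in> {x \<in> X\<^sub>\<Gamma>. P (\<beta> h x)}"
    then have "\<beta> h x \<in> carrier \<Gamma>" "\<rho> (\<beta> h x) (\<sigma> h x) \<in> X\<^sub>\<Gamma>" "x \<in> space M"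
      using cocycle_spec[OF assms, of x] X\<^sub>\<Gamma>_space by (auto simp: induced_def)
    then show "x \<in> (\<Union>g\<in>{g\<in>carrier \<Gamma>. P g}. X\<^sub>\<Gamma> \<inter> {x \<in> space M. \<rho> g (\<sigma> h x) \<in> X\<^sub>\<Gamma>})"
      using x by (intro UN_I[of "\<beta> h x"]) auto
  qed (use cocycle_eqI[OF assms] in auto)
  also have "\<dots> \<in> sets M"
    using translate_preimage[OF _ assms X\<^sub>\<Gamma>_sets] X\<^sub>\<Gamma>_sets countable_subset[OF _ \<Gamma>.countable_group]
    by (intro sets.countable_UN'') auto
  finally show ?thesis .
qed

text \<open>The part of \<open>X\<^sub>\<Gamma>\<close> where \<open>\<beta> h = g\<close> is moved by \<open>\<rho> g \<circ> \<sigma> h\<close>, which preserves the measure, and the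
  images of \<open>X\<^sub>\<Gamma>\<close> under these maps are disjoint for different \<open>g\<close>.\<close>

lemma induced_preimage:
  assumes h: "h \<in> carrier \<Lambda>" and A: "A \<in> sets M" "A \<subseteq> X\<^sub>\<Gamma>"
  shows "{x \<in> X\<^sub>\<Gamma>. induced h x \<in> A} \<in> sets M"
    and "emeasure M {x \<in> X\<^sub>\<Gamma>. induced h x \<in> A} \<le> emeasure M A"
proof -
  define B where "B g = {w \<in> space M. \<rho> (inv\<^bsub>\<Gamma>\<^esub> g) (\<sigma> (inv\<^bsub>\<Lambda>\<^esub> h) w) \<in> X\<^sub>\<Gamma>} \<inter> A" for g
  define C where "C g = {x \<in> space M. \<rho> g (\<sigma> h x) \<in> B g}" for g
  have B: "B g \<in> sets M" if "g \<in> carrier \<Gamma>" for g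
    unfolding B_def using translate_preimage(1)[OF _ _ X\<^sub>\<Gamma>_sets] A that h by (intro sets.Int) auto
  have C: "C g \<in> sets M" "emeasure M (C g) = emeasure M (B g)" if "g \<in> carrier \<Gamma>" for g
    unfolding C_def using translate_preimage[OF that h B[OF that]] by auto
  have inverse: "\<rho> (inv\<^bsub>\<Gamma>\<^esub> g) (\<sigma> (inv\<^bsub>\<Lambda>\<^esub> h) (\<rho> g (\<sigma> h x))) = x" if "g \<in> carrier \<Gamma>" "x \<in> space M" for g x
  proof -
    have "\<sigma> (inv\<^bsub>\<Lambda>\<^esub> h) (\<rho> g (\<sigma> h x)) = \<rho> g x"
      using commuting[of g "inv\<^bsub>\<Lambda>\<^esub> h" "\<sigma> h x"] \<Lambda>.orbit_sym_aux[OF h that(2)] that h act_\<Lambda>_space by simp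
    then show ?thesis using \<Gamma>.orbit_sym_aux that by simp
  qed
  have eq: "{x \<in> X\<^sub>\<Gamma>. induced h x \<in> A} = (\<Union>g\<in>carrier \<Gamma>. C g)"
  proof (rule Set.set_eqI, rule iffI)
    fix x assume x: "x \<in> {x \<in> X\<^sub>\<Gamma>. induced h x \<in> A}"
    then have "x \<in> C (\<beta> h x)" using inverse cocycle_spec[OF h] X\<^sub>\<Gamma>_space act_\<Gamma>_space act_\<Lambda>_space h
      by (auto simp: C_def B_def induced_def)
    then show "x \<in> (\<Union>g\<in>carrier \<Gamma>. C g)" using x cocycle_spec[OF h] X\<^sub>\<Gamma>_space by blast
  next
    fix x assume "x \<in> (\<Union>g\<in>carrier \<Gamma>. C g)"
    then obtain g where g: "g \<in> carrier \<Gamma>" "x \<in> C g" by blast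
    then have x: "x \<in> space M" "\<rho> g (\<sigma> h x) \<in> A" "x \<in> X\<^sub>\<Gamma>" using inverse[of g x] by (auto simp: C_def B_def)
    then have "\<beta> h x = g" using cocycle_eqI[OF h] g A by blast
    then show "x \<in> {x \<in> X\<^sub>\<Gamma>. induced h x \<in> A}" using x by (simp add: induced_def)
  qed
  have disjB: "disjoint_family_on B (carrier \<Gamma>)"
    unfolding disjoint_family_on_def
  proof (intro ballI impI)
    fix g g' assume g: "g \<in> carrier \<Gamma>" "g' \<in> carrier \<Gamma>" "g \<noteq> g'"
    show "B g \<inter> B g' = {}"
    proof (rule ccontr)
      assume "B g \<inter> B g' \<noteq> {}"
      then obtain w where w: "w \<in> space M" "\<rho> (inv\<^bsub>\<Gamma>\<^esub> g) (\<sigma> (inv\<^bsub>\<Lambda>\<^esub> h) w) \<in> X\<^sub>\<Gamma>"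
        "\<rho> (inv\<^bsub>\<Gamma>\<^esub> g') (\<sigma> (inv\<^bsub>\<Lambda>\<^esub> h) w) \<in> X\<^sub>\<Gamma>" by (auto simp: B_def)
      then have "inv\<^bsub>\<Gamma>\<^esub> g = inv\<^bsub>\<Gamma>\<^esub> g'"
        using domain_translate_unique[of "\<sigma> (inv\<^bsub>\<Lambda>\<^esub> h) w"] act_\<Lambda>_space g h by simp
      then show False using g G.inv_inv by metis
    qed
  qed
  have disjC: "disjoint_family_on C (carrier \<Gamma>)"
    unfolding disjoint_family_on_def
  proof (intro ballI impI)
    fix g g' assume g: "g \<in> carrier \<Gamma>" "g' \<in> carrier \<Gamma>" "g \<noteq> g'"
    have False if "x \<in> C g" "x \<in> C g'" for x
    proof -
      have "x \<in> space M" "\<rho> g (\<sigma> h x) \<in> X\<^sub>\<Gamma>" "\<rho> g' (\<sigma> h x) \<in> X\<^sub>\<Gamma>" using that A by (auto simp: C_def B_def)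
      then show False using domain_translate_unique[of "\<sigma> h x" g g'] act_\<Lambda>_space[OF h] g by blast
    qed
    then show "C g \<inter> C g' = {}" by blast
  qed
  show "{x \<in> X\<^sub>\<Gamma>. induced h x \<in> A} \<in> sets M"
    unfolding eq using C \<Gamma>.countable_group by (intro sets.countable_UN'') auto
  have "emeasure M (\<Union>g\<in>carrier \<Gamma>. C g) = (\<integral>\<^sup>+g. emeasure M (C g) \<partial>count_space (carrier \<Gamma>))"
    using C disjC \<Gamma>.countable_group by (intro emeasure_UN_countable) auto
  also have "\<dots> = (\<integral>\<^sup>+g. emeasure M (B g) \<partial>count_space (carrier \<Gamma>))"
    using C by (intro nn_integral_cong) simp
  also have "\<dots> = emeasure M (\<Union>g\<in>carrier \<Gamma>. B g)"
    using B disjB \<Gamma>.countable_group by (intro emeasure_UN_countable[symmetric]) auto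
  also have "\<dots> \<le> emeasure M A" using A by (intro emeasure_mono) (auto simp: B_def)
  finally show "emeasure M {x \<in> X\<^sub>\<Gamma>. induced h x \<in> A} \<le> emeasure M A" unfolding eq .
qed

text \<open>Countably many translates of \<open>X\<^sub>\<Gamma>\<close> cover a space of nonzero measure.\<close>

lemma domain_positive: "0 < measure M X\<^sub>\<Gamma>"
  and emeasure_domain: "emeasure M X\<^sub>\<Gamma> = ennreal (measure M X\<^sub>\<Gamma>)"
proof -
  show e: "emeasure M X\<^sub>\<Gamma> = ennreal (measure M X\<^sub>\<Gamma>)"
    using domain_\<Gamma>(2) by (intro emeasure_eq_ennreal_measure) auto
  have "emeasure M X\<^sub>\<Gamma> \<noteq> 0"
  proof
    assume 0: "emeasure M X\<^sub>\<Gamma> = 0"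
    have "(\<Union>g\<in>carrier \<Gamma>. \<rho> g -` X\<^sub>\<Gamma> \<inter> space M) \<in> null_sets M"
      using measure_preserving_vimage[OF \<Gamma>.measure_preserving X\<^sub>\<Gamma>_sets] 0
      by (intro null_sets_UN' \<Gamma>.countable_group) auto
    moreover have "(\<Union>g\<in>carrier \<Gamma>. \<rho> g -` X\<^sub>\<Gamma> \<inter> space M) = space M"
      using domain_translate_exists by auto
    ultimately show False using nonzero by auto
  qed
  then show "0 < measure M X\<^sub>\<Gamma>" using e by (metis ennreal_0 measure_nonneg order_le_less)
qed

text \<open>Markov's inequality, with one constant for all generators.\<close>

lemma cocycle_tail:
  fixes \<psi> :: "real \<Rightarrow> real"
  assumes mono: "\<And>s t. 0 \<le> s \<Longrightarrow> s \<le> t \<Longrightarrow> \<psi> s \<le> \<psi> t" and c: "c > 0"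
    and int: "\<And>t. t \<in> S\<^sub>\<Lambda> \<Longrightarrow> (\<integral>\<^sup>+x\<in>X\<^sub>\<Gamma>. ennreal (\<psi> (c * real (G.wl (\<beta> t x)))) \<partial>M) < \<infinity>"
  shows "\<exists>I>0. \<forall>t\<in>S\<^sub>\<Lambda>. \<forall>\<tau>\<ge>0. \<psi> (c * \<tau>) > 0 \<longrightarrow>
           emeasure M {x\<in>X\<^sub>\<Gamma>. \<tau> < real (G.wl (\<beta> t x))} \<le> ennreal (I / \<psi> (c * \<tau>))"
proof -
  define J where "J t = (\<integral>\<^sup>+x\<in>X\<^sub>\<Gamma>. ennreal (\<psi> (c * real (G.wl (\<beta> t x)))) \<partial>M)" for t
  define I where "I = 1 + (\<Sum>t\<in>S\<^sub>\<Lambda>. enn2real (J t))"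
  have I: "I > 0" unfolding I_def by (simp add: add_pos_nonneg sum_nonneg)
  have "emeasure M {x\<in>X\<^sub>\<Gamma>. \<tau> < real (G.wl (\<beta> t x))} \<le> ennreal (I / \<psi> (c * \<tau>))"
    if t: "t \<in> S\<^sub>\<Lambda>" and \<tau>: "0 \<le> \<tau>" and pos: "\<psi> (c * \<tau>) > 0" for t \<tau>
  proof -
    let ?A = "{x\<in>X\<^sub>\<Gamma>. \<tau> < real (G.wl (\<beta> t x))}"
    have tc: "t \<in> carrier \<Lambda>" using t L.generators_closed by blast
    have A: "?A \<in> sets M" using cocycle_set_measurable[OF tc] by simp
    have "ennreal (\<psi> (c * \<tau>)) * emeasure M ?A = (\<integral>\<^sup>+x. ennreal (\<psi> (c * \<tau>)) * indicator ?A x \<partial>M)"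
      using A by (simp add: nn_integral_cmult_indicator)
    also have "\<dots> \<le> J t"
      unfolding J_def using mono c \<tau>
      by (intro nn_integral_mono) (auto simp: indicator_def intro!: ennreal_leI)
    also have "\<dots> = ennreal (enn2real (J t))" using int[OF t] by (simp add: J_def ennreal_enn2real_if)
    also have "\<dots> \<le> ennreal I"
      unfolding I_def using member_le_sum[OF t, of "\<lambda>t. enn2real (J t)"] L.finite_generators
      by (intro ennreal_leI) simp
    finally have le: "ennreal (\<psi> (c * \<tau>)) * emeasure M ?A \<le> ennreal I" .
    have "emeasure M ?A \<le> emeasure M X\<^sub>\<Gamma>" using X\<^sub>\<Gamma>_sets by (intro emeasure_mono) auto
    then have e: "emeasure M ?A = ennreal (measure M ?A)"
      using domain_\<Gamma>(2) by (intro emeasure_eq_ennreal_measure) auto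
    have "\<psi> (c * \<tau>) * measure M ?A \<le> I"
      using le pos I unfolding e by (simp add: ennreal_mult[symmetric])
    then show ?thesis unfolding e using pos by (intro ennreal_leI) (simp add: field_simps)
  qed
  then show ?thesis using I by blast
qed

text \<open>By the cocycle identity, \<open>\<beta> h\<close> is a product with one factor for each letter of a word for \<open>h\<close>. The
  factors are values of \<open>\<beta>\<close> on generators, or inverses of such, at images of \<open>x\<close> under elements that
  are no longer than \<open>h\<close>.\<close>

lemma cocycle_ball_le:
  assumes x: "x \<in> X\<^sub>\<Gamma>" and \<tau>: "0 \<le> \<tau>"
    and gen: "\<And>k t. k \<in> carrier \<Lambda> \<Longrightarrow> L.wl k \<le> n \<Longrightarrow> t \<in> S\<^sub>\<Lambda> \<Longrightarrow> real (G.wl (\<beta> t (induced k x))) \<le> \<tau>"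
    and h: "h \<in> carrier \<Lambda>" "L.wl h \<le> n"
  shows "real (G.wl (\<beta> h x)) \<le> real (L.wl h) * \<tau>"
  using h
proof (induction "L.wl h" arbitrary: h)
  case 0
  then show ?case using L.wl_eq_0[of h] cocycle_one[OF x] \<tau> by simp
next
  case (Suc m)
  have xM: "x \<in> space M" using x X\<^sub>\<Gamma>_space by blast
  obtain s k where sk: "s \<in> L.symmetrized S\<^sub>\<Lambda>" "k \<in> carrier \<Lambda>" "h = s \<otimes>\<^bsub>\<Lambda>\<^esub> k" "L.wl k = m"
    using L.wl_Suc_split[OF Suc.prems(1), of m] Suc.hyps(2) by metis
  have k: "real (G.wl (\<beta> k x)) \<le> real m * \<tau>" using Suc.hyps(1)[of k] Suc.hyps(2) sk Suc.prems by simp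
  have sc: "s \<in> carrier \<Lambda>" using sk L.symmetrized_closed by blast
  have ind: "induced k x \<in> space M" "induced h x \<in> space M"
    using cocycle_spec xM sk(2) Suc.prems X\<^sub>\<Gamma>_space by auto
  have "real (G.wl (\<beta> h x)) \<le> \<tau> + real (G.wl (\<beta> k x))"
  proof (cases "s \<in> S\<^sub>\<Lambda>")
    case True
    have "G.wl (\<beta> h x) \<le> G.wl (\<beta> s (induced k x)) + G.wl (\<beta> k x)"
      unfolding sk(3) cocycle_mult(1)[OF sc sk(2) xM]
      using cocycle_spec sc sk(2) xM ind by (intro G.wl_mult) auto
    moreover have "real (G.wl (\<beta> s (induced k x))) \<le> \<tau>" using True sk Suc by (intro gen) auto
    ultimately show ?thesis by linarith
  next
    case False
    \<comment> \<open>Here \<open>s\<close> is the inverse of a generator \<open>t\<close>, and the cocycle of \<open>t\<close> at the image of \<open>h\<close> leads back to \<open>k\<close>.\<close>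
    then obtain t where t: "t \<in> S\<^sub>\<Lambda>" "s = inv\<^bsub>\<Lambda>\<^esub> t" using sk by blast
    have tc: "t \<in> carrier \<Lambda>" using t L.generators_closed by blast
    have "t \<otimes>\<^bsub>\<Lambda>\<^esub> h = k" unfolding sk(3) t(2) using tc sk(2) by (simp add: L.m_assoc[symmetric])
    then have "\<beta> k x = \<beta> t (induced h x) \<otimes>\<^bsub>\<Gamma>\<^esub> \<beta> h x" using cocycle_mult(1)[OF tc Suc.prems(1) xM] by simp
    then have "\<beta> h x = inv\<^bsub>\<Gamma>\<^esub> \<beta> t (induced h x) \<otimes>\<^bsub>\<Gamma>\<^esub> \<beta> k x"
      using cocycle_spec tc Suc.prems xM ind by (simp add: G.m_assoc[symmetric])
    moreover have "G.wl (inv\<^bsub>\<Gamma>\<^esub> \<beta> t (induced h x) \<otimes>\<^bsub>\<Gamma>\<^esub> \<beta> k x)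
        \<le> G.wl (inv\<^bsub>\<Gamma>\<^esub> \<beta> t (induced h x)) + G.wl (\<beta> k x)"
      using cocycle_spec tc sk(2) xM ind by (intro G.wl_mult) auto
    moreover have "G.wl (inv\<^bsub>\<Gamma>\<^esub> \<beta> t (induced h x)) = G.wl (\<beta> t (induced h x))"
      using cocycle_spec tc ind by (intro G.wl_inv) auto
    ultimately have "G.wl (\<beta> h x) \<le> G.wl (\<beta> t (induced h x)) + G.wl (\<beta> k x)" by simp
    moreover have "real (G.wl (\<beta> t (induced h x))) \<le> \<tau>" using t Suc.prems by (intro gen) auto
    ultimately show ?thesis by linarith
  qed
  also have "\<dots> \<le> real (Suc m) * \<tau>" using k by (simp add: algebra_simps)
  finally show ?case using Suc.hyps(2) by simp
qed

text \<open>The union bound over a ball. With the two groups exchanged, this is where exponential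
  integrability enters: it beats the exponential growth of the ball when \<open>\<tau>\<close> is a large multiple of
  \<open>n powr (1 / p)\<close>.\<close>

lemma cocycle_ball_tail:
  assumes \<tau>: "0 \<le> \<tau>" and b: "0 \<le> b"
    and tail: "\<And>t. t \<in> S\<^sub>\<Lambda> \<Longrightarrow> emeasure M {x\<in>X\<^sub>\<Gamma>. \<tau> < real (G.wl (\<beta> t x))} \<le> ennreal b"
  shows "\<exists>W\<in>sets M. W \<subseteq> X\<^sub>\<Gamma> \<and>
     emeasure M W \<le> ennreal (real (Suc (card (L.symmetrized S\<^sub>\<Lambda>))) ^ n * real (card S\<^sub>\<Lambda>) * b) \<and>
     (\<forall>x\<in>X\<^sub>\<Gamma> - W. \<forall>h\<in>carrier \<Lambda>. L.wl h \<le> n \<longrightarrow> real (G.wl (\<beta> h x)) \<le> real n * \<tau>)"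
proof -
  let ?B = "{h\<in>carrier \<Lambda>. L.wl h \<le> n}"
  let ?T = "\<lambda>t. {x\<in>X\<^sub>\<Gamma>. \<tau> < real (G.wl (\<beta> t x))}"
  let ?D = "\<lambda>(k, t). {x\<in>X\<^sub>\<Gamma>. induced k x \<in> ?T t}"
  define W where "W = (\<Union>i\<in>?B \<times> S\<^sub>\<Lambda>. ?D i)"
  have fin: "finite (?B \<times> S\<^sub>\<Lambda>)" using L.card_ball_le L.finite_generators by blast
  have T: "?T t \<in> sets M" if "t \<in> S\<^sub>\<Lambda>" for t
    using cocycle_set_measurable[of t "\<lambda>g. \<tau> < real (G.wl g)"] that L.generators_closed by blast
  have D: "?D i \<in> sets M" "emeasure M (?D i) \<le> ennreal b" if i: "i \<in> ?B \<times> S\<^sub>\<Lambda>" for i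
  proof -
    obtain k t where kt: "i = (k, t)" "k \<in> carrier \<Lambda>" "t \<in> S\<^sub>\<Lambda>" using i by auto
    have "{x\<in>X\<^sub>\<Gamma>. induced k x \<in> ?T t} \<in> sets M"
      "emeasure M {x\<in>X\<^sub>\<Gamma>. induced k x \<in> ?T t} \<le> emeasure M (?T t)"
      by (intro induced_preimage kt T Collect_restrict)+
    then show "?D i \<in> sets M" "emeasure M (?D i) \<le> ennreal b"
      using tail[OF kt(3)] kt(1) by (auto intro: order_trans)
  qed
  have "emeasure M W \<le> ennreal (real (card (?B \<times> S\<^sub>\<Lambda>)) * b)"
    unfolding W_def by (rule emeasure_finite_union_le[OF fin D b])
  also have "\<dots> \<le> ennreal (real (Suc (card (L.symmetrized S\<^sub>\<Lambda>))) ^ n * real (card S\<^sub>\<Lambda>) * b)"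
  proof (intro ennreal_leI mult_right_mono b)
    have "real (card ?B) \<le> real (Suc (card (L.symmetrized S\<^sub>\<Lambda>)) ^ n)"
      using L.card_ball_le[of n] by (intro of_nat_mono) blast
    then show "real (card (?B \<times> S\<^sub>\<Lambda>)) \<le> real (Suc (card (L.symmetrized S\<^sub>\<Lambda>))) ^ n * real (card S\<^sub>\<Lambda>)"
      by (simp add: card_cartesian_product mult_right_mono)
  qed
  finally have "emeasure M W \<le> ennreal (real (Suc (card (L.symmetrized S\<^sub>\<Lambda>))) ^ n * real (card S\<^sub>\<Lambda>) * b)" .
  moreover have "real (G.wl (\<beta> h x)) \<le> real n * \<tau>"
    if x: "x \<in> X\<^sub>\<Gamma>" "x \<notin> W" and h: "h \<in> carrier \<Lambda>" "L.wl h \<le> n" for x h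
  proof -
    have "real (G.wl (\<beta> h x)) \<le> real (L.wl h) * \<tau>"
    proof (rule cocycle_ball_le[OF x(1) \<tau> _ h])
      fix k t assume kt: "k \<in> carrier \<Lambda>" "L.wl k \<le> n" "t \<in> S\<^sub>\<Lambda>"
      then have "x \<notin> {x\<in>X\<^sub>\<Gamma>. induced k x \<in> ?T t}" using x(2) unfolding W_def by blast
      moreover have "induced k x \<in> X\<^sub>\<Gamma>" using cocycle_spec kt x X\<^sub>\<Gamma>_space by blast
      ultimately show "real (G.wl (\<beta> t (induced k x))) \<le> \<tau>" using x(1) by auto
    qed
    also have "\<dots> \<le> real n * \<tau>" using h \<tau> by (intro mult_right_mono) auto
    finally show ?thesis .
  qed
  moreover have "W \<in> sets M" unfolding W_def using D fin by (intro sets.finite_UN) auto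
  moreover have "W \<subseteq> X\<^sub>\<Gamma>" unfolding W_def by auto
  ultimately show ?thesis by blast
qed

end

section \<open>Large scale maps from \<open>\<Lambda>\<close> to \<open>\<Gamma>\<close>\<close>

context fg_coupling begin

abbreviation \<alpha> :: "'g \<Rightarrow> 'w \<Rightarrow> 'l" where
  "\<alpha> \<equiv> cocycle \<rho> \<Lambda> \<sigma> X\<^sub>\<Lambda>"

text \<open>The finite set \<open>A\<close> is the part of \<open>\<Lambda>\<close> on which \<open>f\<close> is controlled. The last clause is a coarse form
  of injectivity at the scale \<open>R\<close>.\<close>

definition large_scale_map :: "'l set \<Rightarrow> real \<Rightarrow> real \<Rightarrow> real \<Rightarrow> ('l \<Rightarrow> 'g) \<Rightarrow> bool" where
  "large_scale_map A J R T f \<longleftrightarrow>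
     (\<forall>l\<in>carrier \<Lambda>. f l \<in> carrier \<Gamma>) \<and>
     (\<forall>l\<in>A. \<forall>s\<in>S\<^sub>\<Lambda>. real (G.word_dist (f l) (f (l \<otimes>\<^bsub>\<Lambda>\<^esub> s))) \<le> J) \<and>
     (\<forall>l\<in>A. \<forall>k\<in>A. real (G.word_dist (f k) (f l)) \<le> R \<longrightarrow> real (L.word_dist k l) \<le> T)"

text \<open>The map is \<open>l \<mapsto> inv (\<beta> (inv l) x)\<close> for a suitable \<open>x\<close>. Two elements of \<open>\<Lambda>\<close> whose images differ by
  \<open>g\<close> differ themselves, up to the finite set \<open>F\<close>, by a value of \<open>\<alpha> g\<close>; this is where coboundedness
  is used. The last hypothesis ensures that the points \<open>x\<close> at which one of the cocycles is large do not
  fill \<open>X\<^sub>\<Gamma>\<close>.\<close>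

lemma coarse_map_exists:
  assumes F: "finite F" "F \<subseteq> carrier \<Lambda>" "X\<^sub>\<Gamma> \<subseteq> (\<Union>h\<in>F. \<sigma> h ` X\<^sub>\<Lambda>)"
    and CF: "\<And>h. h \<in> F \<Longrightarrow> L.wl h \<le> CF"
    and b1: "0 \<le> b1" "\<And>t. t \<in> S\<^sub>\<Lambda> \<Longrightarrow> emeasure M {x\<in>X\<^sub>\<Gamma>. J < real (G.wl (\<beta> t x))} \<le> ennreal b1"
    and \<tau>: "0 \<le> \<tau>"
    and b2: "0 \<le> b2" "\<And>s. s \<in> S\<^sub>\<Gamma> \<Longrightarrow> emeasure M {x\<in>X\<^sub>\<Lambda>. \<tau> < real (L.wl (\<alpha> s x))} \<le> ennreal b2"
    and A: "finite A" "A \<subseteq> carrier \<Lambda>" "card A \<le> m"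
    and small: "real m * real (card S\<^sub>\<Lambda>) * b1 + real m * real (card F) *
       (real (Suc (card (G.symmetrized S\<^sub>\<Gamma>))) ^ n * real (card S\<^sub>\<Gamma>) * b2) < measure M X\<^sub>\<Gamma>"
  shows "\<exists>f. large_scale_map A J (real n) (2 * real CF + real n * \<tau>) f"
proof -
  define w where "w = real (Suc (card (G.symmetrized S\<^sub>\<Gamma>))) ^ n * real (card S\<^sub>\<Gamma>) * b2"
  have w0: "0 \<le> w" unfolding w_def using b2 by simp
  obtain W where W: "W \<in> sets M" "W \<subseteq> X\<^sub>\<Lambda>" "emeasure M W \<le> ennreal w"
    "\<And>x g. x \<in> X\<^sub>\<Lambda> \<Longrightarrow> x \<notin> W \<Longrightarrow> g \<in> carrier \<Gamma> \<Longrightarrow> G.wl g \<le> n \<Longrightarrow> real (L.wl (\<alpha> g x)) \<le> real n * \<tau>"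
    using fg_coupling.cocycle_ball_tail[OF swap \<tau> b2, of n] unfolding w_def by (metis DiffI)
  define Z where "Z h = X\<^sub>\<Gamma> \<inter> (\<sigma> (inv\<^bsub>\<Lambda>\<^esub> h) -` W \<inter> space M)" for h
  have Z: "Z h \<in> sets M" "Z h \<subseteq> X\<^sub>\<Gamma>" "emeasure M (Z h) \<le> ennreal w" if "h \<in> F" for h
  proof -
    have "inv\<^bsub>\<Lambda>\<^esub> h \<in> carrier \<Lambda>" using that F by auto
    from measure_preserving_vimage[OF \<Lambda>.measure_preserving[OF this] W(1)]
    have v: "\<sigma> (inv\<^bsub>\<Lambda>\<^esub> h) -` W \<inter> space M \<in> sets M"
      "emeasure M (\<sigma> (inv\<^bsub>\<Lambda>\<^esub> h) -` W \<inter> space M) \<le> ennreal w" using W(3) by auto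
    then show "Z h \<in> sets M" "Z h \<subseteq> X\<^sub>\<Gamma>" using X\<^sub>\<Gamma>_sets by (auto simp: Z_def)
    have "emeasure M (Z h) \<le> emeasure M (\<sigma> (inv\<^bsub>\<Lambda>\<^esub> h) -` W \<inter> space M)"
      unfolding Z_def using v(1) by (intro emeasure_mono) auto
    then show "emeasure M (Z h) \<le> ennreal w" using v(2) by simp
  qed
  define T where "T t = {x\<in>X\<^sub>\<Gamma>. J < real (G.wl (\<beta> t x))}" for t
  have T: "T t \<in> sets M" "T t \<subseteq> X\<^sub>\<Gamma>" if "t \<in> S\<^sub>\<Lambda>" for t
    using cocycle_set_measurable[of t "\<lambda>g. J < real (G.wl g)"] that L.generators_closed by (auto simp: T_def)
  \<comment> \<open>On \<open>D1 (l, s)\<close> the map jumps too far along the edge from \<open>l\<close> to \<open>l \<otimes> s\<close>; on \<open>D2 (l, h)\<close> the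
    representative in \<open>X\<^sub>\<Lambda>\<close> of the image of \<open>x\<close> under \<open>inv l\<close> is exceptional for \<open>\<alpha>\<close>.\<close>
  define D1 where "D1 = (\<lambda>(l, s). {x\<in>X\<^sub>\<Gamma>. induced (inv\<^bsub>\<Lambda>\<^esub> (l \<otimes>\<^bsub>\<Lambda>\<^esub> s)) x \<in> T s})"
  define D2 where "D2 = (\<lambda>(l, h). {x\<in>X\<^sub>\<Gamma>. induced (inv\<^bsub>\<Lambda>\<^esub> l) x \<in> Z h})"
  have D1: "D1 i \<in> sets M" "emeasure M (D1 i) \<le> ennreal b1" if i: "i \<in> A \<times> S\<^sub>\<Lambda>" for i
  proof -
    obtain l s where ls: "i = (l, s)" "l \<in> A" "s \<in> S\<^sub>\<Lambda>" using i by auto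
    have c: "inv\<^bsub>\<Lambda>\<^esub> (l \<otimes>\<^bsub>\<Lambda>\<^esub> s) \<in> carrier \<Lambda>" using ls A L.generators_closed by auto
    show "D1 i \<in> sets M" "emeasure M (D1 i) \<le> ennreal b1"
      using induced_preimage[OF c T[OF ls(3)]] b1(2)[OF ls(3)] ls(1)
      by (auto simp: D1_def T_def intro: order_trans)
  qed
  have D2: "D2 i \<in> sets M" "emeasure M (D2 i) \<le> ennreal w" if i: "i \<in> A \<times> F" for i
  proof -
    obtain l h where lh: "i = (l, h)" "l \<in> A" "h \<in> F" using i by auto
    have c: "inv\<^bsub>\<Lambda>\<^esub> l \<in> carrier \<Lambda>" using lh A by auto
    show "D2 i \<in> sets M" "emeasure M (D2 i) \<le> ennreal w"
      using induced_preimage[OF c Z(1,2)[OF lh(3)]] Z(3)[OF lh(3)] lh(1)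
      by (auto simp: D2_def intro: order_trans)
  qed
  have fin: "finite (A \<times> S\<^sub>\<Lambda>)" "finite (A \<times> F)" using A F L.finite_generators by auto
  let ?Bad = "(\<Union>i\<in>A \<times> S\<^sub>\<Lambda>. D1 i) \<union> (\<Union>i\<in>A \<times> F. D2 i)"
  have "emeasure M ?Bad \<le> emeasure M (\<Union>i\<in>A \<times> S\<^sub>\<Lambda>. D1 i) + emeasure M (\<Union>i\<in>A \<times> F. D2 i)"
    using fin D1(1) D2(1) by (intro emeasure_subadditive sets.finite_UN) auto
  also have "\<dots> \<le> ennreal (real (card (A \<times> S\<^sub>\<Lambda>)) * b1) + ennreal (real (card (A \<times> F)) * w)"
    using emeasure_finite_union_le[OF fin(1) D1 b1(1)] emeasure_finite_union_le[OF fin(2) D2 w0]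
    by (rule add_mono)
  also have "\<dots> = ennreal (real (card (A \<times> S\<^sub>\<Lambda>)) * b1 + real (card (A \<times> F)) * w)"
    using b1 w0 by (intro ennreal_plus[symmetric]) auto
  also have "\<dots> \<le> ennreal (real m * real (card S\<^sub>\<Lambda>) * b1 + real m * real (card F) * w)"
    using A(3) b1 w0 by (intro ennreal_leI add_mono mult_right_mono) (auto simp: card_cartesian_product mult_right_mono)
  also have "\<dots> < emeasure M X\<^sub>\<Gamma>"
    unfolding emeasure_domain using small domain_positive by (intro ennreal_lessI) (auto simp: w_def)
  finally have lt: "emeasure M ?Bad < emeasure M X\<^sub>\<Gamma>" .
  have "\<not> X\<^sub>\<Gamma> \<subseteq> ?Bad"
  proof
    assume "X\<^sub>\<Gamma> \<subseteq> ?Bad"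
    then have "emeasure M X\<^sub>\<Gamma> \<le> emeasure M ?Bad"
      using fin D1(1) D2(1) by (intro emeasure_mono sets.Un sets.finite_UN) auto
    then show False using lt by simp
  qed
  then obtain x where x: "x \<in> X\<^sub>\<Gamma>" "x \<notin> ?Bad" by blast
  have xM: "x \<in> space M" using x X\<^sub>\<Gamma>_space by blast
  define f where "f l = inv\<^bsub>\<Gamma>\<^esub> (\<beta> (inv\<^bsub>\<Lambda>\<^esub> l) x)" for l
  have \<beta>c: "\<beta> (inv\<^bsub>\<Lambda>\<^esub> l) x \<in> carrier \<Gamma>" if "l \<in> carrier \<Lambda>" for l
    using cocycle_spec(1)[OF _ xM] that by simp
  have fc: "f l \<in> carrier \<Gamma>" if "l \<in> carrier \<Lambda>" for l
    using \<beta>c[OF that] by (simp add: f_def)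
  have f_diff: "inv\<^bsub>\<Gamma>\<^esub> (f k) \<otimes>\<^bsub>\<Gamma>\<^esub> f l = \<beta> (inv\<^bsub>\<Lambda>\<^esub> k \<otimes>\<^bsub>\<Lambda>\<^esub> l) (induced (inv\<^bsub>\<Lambda>\<^esub> l) x)"
    and induced_diff: "induced (inv\<^bsub>\<Lambda>\<^esub> k) x = induced (inv\<^bsub>\<Lambda>\<^esub> k \<otimes>\<^bsub>\<Lambda>\<^esub> l) (induced (inv\<^bsub>\<Lambda>\<^esub> l) x)"
    if "k \<in> carrier \<Lambda>" "l \<in> carrier \<Lambda>" for k l
  proof -
    have k: "inv\<^bsub>\<Lambda>\<^esub> k = (inv\<^bsub>\<Lambda>\<^esub> k \<otimes>\<^bsub>\<Lambda>\<^esub> l) \<otimes>\<^bsub>\<Lambda>\<^esub> inv\<^bsub>\<Lambda>\<^esub> l"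
      using that by (simp add: L.m_assoc)
    have kc: "inv\<^bsub>\<Lambda>\<^esub> k \<otimes>\<^bsub>\<Lambda>\<^esub> l \<in> carrier \<Lambda>" "inv\<^bsub>\<Lambda>\<^esub> l \<in> carrier \<Lambda>" using that by auto
    note mult = cocycle_mult[OF kc xM, unfolded k[symmetric]]
    show "induced (inv\<^bsub>\<Lambda>\<^esub> k) x = induced (inv\<^bsub>\<Lambda>\<^esub> k \<otimes>\<^bsub>\<Lambda>\<^esub> l) (induced (inv\<^bsub>\<Lambda>\<^esub> l) x)"
      by (rule mult(2))
    have "\<beta> (inv\<^bsub>\<Lambda>\<^esub> k \<otimes>\<^bsub>\<Lambda>\<^esub> l) (induced (inv\<^bsub>\<Lambda>\<^esub> l) x) \<in> carrier \<Gamma>"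
      using cocycle_spec kc xM X\<^sub>\<Gamma>_space by blast
    then show "inv\<^bsub>\<Gamma>\<^esub> (f k) \<otimes>\<^bsub>\<Gamma>\<^esub> f l = \<beta> (inv\<^bsub>\<Lambda>\<^esub> k \<otimes>\<^bsub>\<Lambda>\<^esub> l) (induced (inv\<^bsub>\<Lambda>\<^esub> l) x)"
      unfolding f_def using mult(1) \<beta>c that by (simp add: G.m_assoc)
  qed
  have "real (G.word_dist (f l) (f (l \<otimes>\<^bsub>\<Lambda>\<^esub> s))) \<le> J" if ls: "l \<in> A" "s \<in> S\<^sub>\<Lambda>" for l s
  proof -
    have c: "l \<in> carrier \<Lambda>" "s \<in> carrier \<Lambda>" using ls A L.generators_closed by auto
    let ?y = "induced (inv\<^bsub>\<Lambda>\<^esub> (l \<otimes>\<^bsub>\<Lambda>\<^esub> s)) x"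
    have "inv\<^bsub>\<Lambda>\<^esub> l \<otimes>\<^bsub>\<Lambda>\<^esub> (l \<otimes>\<^bsub>\<Lambda>\<^esub> s) = s" using c by (simp add: L.m_assoc[symmetric])
    then have eq: "G.word_dist (f l) (f (l \<otimes>\<^bsub>\<Lambda>\<^esub> s)) = G.wl (\<beta> s ?y)"
      unfolding G.word_dist_def using f_diff[of l "l \<otimes>\<^bsub>\<Lambda>\<^esub> s"] c by simp
    have "?y \<in> X\<^sub>\<Gamma>" using c xM by (intro cocycle_spec) auto
    moreover have "x \<notin> D1 (l, s)" using x ls by blast
    then have "?y \<notin> T s" using x by (simp add: D1_def)
    ultimately show ?thesis unfolding eq by (simp add: T_def)
  qed
  moreover have "real (L.word_dist k l) \<le> 2 * real CF + real n * \<tau>"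
    if lk: "l \<in> A" "k \<in> A" "G.word_dist (f k) (f l) \<le> n" for l k
  proof -
    have c: "l \<in> carrier \<Lambda>" "k \<in> carrier \<Lambda>" using lk A by auto
    define d where "d = inv\<^bsub>\<Lambda>\<^esub> k \<otimes>\<^bsub>\<Lambda>\<^esub> l"
    define y where "y = induced (inv\<^bsub>\<Lambda>\<^esub> l) x"
    define g where "g = \<beta> d y"
    have dc: "d \<in> carrier \<Lambda>" unfolding d_def using c by simp
    have yX: "y \<in> X\<^sub>\<Gamma>" unfolding y_def using c xM by (intro cocycle_spec) auto
    have yM: "y \<in> space M" using yX X\<^sub>\<Gamma>_space by blast
    have gc: "g \<in> carrier \<Gamma>" unfolding g_def using cocycle_spec dc yM by blast
    have gn: "G.wl g \<le> n" using lk(3) f_diff[OF c(2,1)] unfolding G.word_dist_def g_def d_def y_def by simp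
    have y'X: "induced d y \<in> X\<^sub>\<Gamma>" using cocycle_spec dc yM by blast
    obtain h z where hz: "h \<in> F" "z \<in> X\<^sub>\<Lambda>" "y = \<sigma> h z" using yX F(3) by blast
    obtain h' z' where hz': "h' \<in> F" "z' \<in> X\<^sub>\<Lambda>" "induced d y = \<sigma> h' z'" using y'X F(3) by blast
    have hc: "h \<in> carrier \<Lambda>" "h' \<in> carrier \<Lambda>" using hz hz' F by auto
    have zM: "z \<in> space M" "z' \<in> space M"
      using hz hz' fg_coupling.X\<^sub>\<Gamma>_space[OF swap] by auto
    have "x \<notin> D2 (l, h)" using x lk hz by blast
    then have "y \<notin> Z h" using x by (simp add: D2_def y_def)
    moreover have "\<sigma> (inv\<^bsub>\<Lambda>\<^esub> h) y = z" using \<Lambda>.orbit_sym_aux[OF hc(1) zM(1)] hz by simp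
    ultimately have zW: "z \<notin> W" using yX yM by (simp add: Z_def)
    \<comment> \<open>The points \<open>z\<close> and \<open>z'\<close> of \<open>X\<^sub>\<Lambda>\<close> are related by \<open>g\<close>, so \<open>\<alpha> g z\<close> is \<open>d\<close> up to elements of \<open>F\<close>.\<close>
    have "\<sigma> h' z' = \<rho> g (\<sigma> d (\<sigma> h z))" using hz' hz by (simp add: induced_def g_def)
    also have "\<dots> = \<sigma> d (\<sigma> h (\<rho> g z))"
      using commuting gc dc hc zM act_\<Lambda>_space by simp
    also have "\<dots> = \<sigma> (d \<otimes>\<^bsub>\<Lambda>\<^esub> h) (\<rho> g z)"
      using dc hc gc zM act_\<Gamma>_space by (simp add: \<Lambda>.composition_rule)
    finally have "z' = \<sigma> (inv\<^bsub>\<Lambda>\<^esub> h') (\<sigma> (d \<otimes>\<^bsub>\<Lambda>\<^esub> h) (\<rho> g z))"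
      using \<Lambda>.orbit_sym_aux[OF hc(2) zM(2)] by simp
    also have "\<dots> = \<sigma> (inv\<^bsub>\<Lambda>\<^esub> h' \<otimes>\<^bsub>\<Lambda>\<^esub> (d \<otimes>\<^bsub>\<Lambda>\<^esub> h)) (\<rho> g z)"
      using dc hc gc zM act_\<Gamma>_space by (simp add: \<Lambda>.composition_rule)
    finally have "\<alpha> g z = inv\<^bsub>\<Lambda>\<^esub> h' \<otimes>\<^bsub>\<Lambda>\<^esub> (d \<otimes>\<^bsub>\<Lambda>\<^esub> h)"
      using gc zM hc dc hz' by (intro fg_coupling.cocycle_eqI[OF swap]) auto
    then have "d = h' \<otimes>\<^bsub>\<Lambda>\<^esub> \<alpha> g z \<otimes>\<^bsub>\<Lambda>\<^esub> inv\<^bsub>\<Lambda>\<^esub> h"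
      using hc dc by (simp add: L.m_assoc[symmetric]) (simp add: L.m_assoc)
    moreover have \<alpha>c: "\<alpha> g z \<in> carrier \<Lambda>" using fg_coupling.cocycle_spec(1)[OF swap gc zM(1)] .
    ultimately have "L.wl d \<le> L.wl h' + L.wl (\<alpha> g z) + L.wl h"
      using L.wl_mult[of "h' \<otimes>\<^bsub>\<Lambda>\<^esub> \<alpha> g z" "inv\<^bsub>\<Lambda>\<^esub> h"] L.wl_mult[of h' "\<alpha> g z"] hc by simp
    moreover have "real (L.wl (\<alpha> g z)) \<le> real n * \<tau>" using W(4)[OF hz(2) zW gc gn] .
    moreover have "L.wl h \<le> CF" "L.wl h' \<le> CF" using CF hz hz' by auto
    ultimately show ?thesis unfolding L.word_dist_def d_def[symmetric] by linarith
  qed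
  ultimately show ?thesis unfolding large_scale_map_def using fc by (intro exI[of _ f]) simp
qed

end

lemma jump_exponent:
  fixes q :: real
  assumes "q > 0"
  shows "q / (1 + q) * (1 + 1 / q) = 1"
proof -
  have "1 + 1 / q = (1 + q) / q" using assms by (simp add: field_simps)
  then show ?thesis using assms by simp
qed

lemma linear_times_exp_powr_tendsto:
  fixes a :: real
  assumes "a > 0"
  shows "((\<lambda>x. x * exp (- (x powr a))) \<longlongrightarrow> 0) at_top"
  using assms by real_asymp

context fg_coupling begin

text \<open>The choice of the constants. With \<open>a = q / (1 + q)\<close> Markov's inequality for \<open>\<beta>\<close> allows jumps of
  size \<open>m powr a\<close> among \<open>m\<close> elements, and a ball of this radius allows steps of \<open>\<alpha>\<close> of size
  \<open>m powr (a / p)\<close>. Their product is the error \<open>m powr (a * (1 + 1 / p))\<close>, which is sublinear exactly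
  when \<open>q < p\<close>.\<close>

lemma large_scale_maps:
  assumes p: "p > 0" and q: "q > 0"
    and cob: "cobounded \<Lambda> \<sigma> X\<^sub>\<Gamma> X\<^sub>\<Lambda>"
    and int: "integrable_coupling (\<lambda>t. exp (t powr p)) (\<lambda>t. t powr (1 + 1 / q))
       \<Gamma> S\<^sub>\<Gamma> \<Lambda> S\<^sub>\<Lambda> M \<rho> \<sigma> X\<^sub>\<Gamma> X\<^sub>\<Lambda>"
  defines "a \<equiv> q / (1 + q)"
  shows "\<exists>J\<ge>0. \<forall>K>0. \<exists>C m0. \<forall>m\<ge>m0. \<forall>A. finite A \<longrightarrow> A \<subseteq> carrier \<Lambda> \<longrightarrow> card A \<le> m \<longrightarrow>
     (\<exists>f. large_scale_map A (J * real m powr a) (K * real m powr a) (C * real m powr (a * (1 + 1 / p))) f)"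
proof -
  obtain c where c: "c > 0"
    and int\<alpha>: "\<And>s. s \<in> S\<^sub>\<Gamma> \<Longrightarrow> (\<integral>\<^sup>+x\<in>X\<^sub>\<Lambda>. ennreal (exp ((c * real (L.wl (\<alpha> s x))) powr p)) \<partial>M) < \<infinity>"
    and int\<beta>: "\<And>t. t \<in> S\<^sub>\<Lambda> \<Longrightarrow> (\<integral>\<^sup>+x\<in>X\<^sub>\<Gamma>. ennreal ((c * real (G.wl (\<beta> t x))) powr (1 + 1 / q)) \<partial>M) < \<infinity>"
    using int unfolding integrable_coupling_def by blast
  obtain I1 where I1: "I1 > 0" and tail\<beta>: "\<And>t \<tau>. t \<in> S\<^sub>\<Lambda> \<Longrightarrow> 0 \<le> \<tau> \<Longrightarrow> (c * \<tau>) powr (1 + 1 / q) > 0 \<Longrightarrow>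
      emeasure M {x\<in>X\<^sub>\<Gamma>. \<tau> < real (G.wl (\<beta> t x))} \<le> ennreal (I1 / (c * \<tau>) powr (1 + 1 / q))"
  proof -
    have mono: "s powr (1 + 1 / q) \<le> t powr (1 + 1 / q)" if "0 \<le> s" "s \<le> t" for s t :: real
      using that q by (intro powr_mono2) auto
    show ?thesis using cocycle_tail[of "\<lambda>t. t powr (1 + 1 / q)" c, OF mono c int\<beta>] that by blast
  qed
  obtain I2 where I2: "I2 > 0" and tail\<alpha>: "\<And>s \<tau>. s \<in> S\<^sub>\<Gamma> \<Longrightarrow> 0 \<le> \<tau> \<Longrightarrow>
      emeasure M {x\<in>X\<^sub>\<Lambda>. \<tau> < real (L.wl (\<alpha> s x))} \<le> ennreal (I2 / exp ((c * \<tau>) powr p))"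
  proof -
    have mono: "exp (s powr p) \<le> exp (t powr p)" if "0 \<le> s" "s \<le> t" for s t :: real
      using that p by (simp add: powr_mono2)
    show ?thesis
      using fg_coupling.cocycle_tail[OF swap, of "\<lambda>t. exp (t powr p)" c, OF mono c int\<alpha>] that by force
  qed
  obtain F where F: "finite F" "F \<subseteq> carrier \<Lambda>" "X\<^sub>\<Gamma> \<subseteq> (\<Union>h\<in>F. \<sigma> h ` X\<^sub>\<Lambda>)"
    using cob unfolding cobounded_def by blast
  define CF where "CF = (\<Sum>h\<in>F. L.wl h)"
  have CF: "L.wl h \<le> CF" if "h \<in> F" for h
    unfolding CF_def using F that by (intro member_le_sum) auto
  define \<mu> where "\<mu> = measure M X\<^sub>\<Gamma>"
  have \<mu>: "\<mu> > 0" unfolding \<mu>_def by (rule domain_positive)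
  have a: "0 < a" using q by (simp add: a_def)
  have aq: "a * (1 + 1 / q) = 1" unfolding a_def using q by (intro jump_exponent) simp
  define Y where "Y = 4 * real (card S\<^sub>\<Lambda>) * I1 / \<mu> + 1"
  have Y: "Y > 0" unfolding Y_def using I1 \<mu> by (simp add: add_nonneg_pos)
  define J where "J = Y powr a / c"
  have J: "J > 0" unfolding J_def using Y c by simp
  \<comment> \<open>The constants in \<open>J\<close> make the first part of the exceptional set smaller than half of \<open>X\<^sub>\<Gamma>\<close>.\<close>
  have cJ: "(c * (J * real m powr a)) powr (1 + 1 / q) = Y * real m" if "m > 0" for m
  proof -
    have "(c * (J * real m powr a)) powr (1 + 1 / q) = (Y powr a) powr (1 + 1 / q) * (real m powr a) powr (1 + 1 / q)"
      unfolding J_def using c Y by (simp add: powr_mult)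
    also have "\<dots> = Y * real m" unfolding powr_powr aq using Y by simp
    finally show ?thesis .
  qed
  have "\<exists>C m0. \<forall>m\<ge>m0. \<forall>A. finite A \<longrightarrow> A \<subseteq> carrier \<Lambda> \<longrightarrow> card A \<le> m \<longrightarrow>
     (\<exists>f. large_scale_map A (J * real m powr a) (K * real m powr a) (C * real m powr (a * (1 + 1 / p))) f)" if K: "K > 0" for K
  proof -
    define N where "N = real (Suc (card (G.symmetrized S\<^sub>\<Gamma>)))"
    have N: "N \<ge> 1" unfolding N_def by simp
    \<comment> \<open>A ball of radius \<open>K * m powr a\<close> has at most \<open>exp (K * ln N * m powr a)\<close> elements. The additional 1
      leaves a factor \<open>exp (- (m powr a))\<close>, which beats the number \<open>m\<close> of translates.\<close>
    define B where "B = K * ln N + 1"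
    have B: "B > 0" unfolding B_def using K N by (simp add: add_nonneg_pos)
    define C where "C = 2 * real CF + K * B powr (1 / p) / c"
    define E where "E = real (card F) * real (card S\<^sub>\<Gamma>) * I2"
    have "((\<lambda>x. E * (x * exp (- (x powr a)))) \<longlongrightarrow> E * 0) at_top"
      by (intro tendsto_mult_left linear_times_exp_powr_tendsto a)
    then have "((\<lambda>m. E * (real m * exp (- (real m powr a)))) \<longlongrightarrow> 0) sequentially"
      using filterlim_compose[OF _ filterlim_real_sequentially] by fastforce
    then have "eventually (\<lambda>m. E * (real m * exp (- (real m powr a))) < \<mu> / 4) sequentially"
      using \<mu> by (intro order_tendstoD(2)) auto
    then obtain m1 where m1: "\<And>m. m \<ge> m1 \<Longrightarrow> E * (real m * exp (- (real m powr a))) < \<mu> / 4"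
      unfolding eventually_sequentially by blast
    show ?thesis
    proof (intro exI[of _ C] exI[of _ "max m1 1"] allI impI)
      fix m A assume m: "max m1 1 \<le> m" and A: "finite A" "A \<subseteq> carrier \<Lambda>" "card A \<le> m"
      define b1 where "b1 = I1 / (Y * real m)"
      define n where "n = nat \<lfloor>K * real m powr a\<rfloor>"
      define \<tau> where "\<tau> = (B * real m powr a) powr (1 / p) / c"
      define b2 where "b2 = I2 / exp (B * real m powr a)"
      have m_pos: "m > 0" using m by simp
      have b: "0 \<le> b1" "0 \<le> b2" using I1 I2 Y by (auto simp: b1_def b2_def)
      have \<tau>: "0 \<le> \<tau>" unfolding \<tau>_def using c by simp
      have c\<tau>: "(c * \<tau>) powr p = B * real m powr a"
        unfolding \<tau>_def using c B p by (simp add: powr_powr)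
      have n_le: "real n \<le> K * real m powr a" unfolding n_def using K by (intro of_nat_floor) simp
      have t1: "emeasure M {x\<in>X\<^sub>\<Gamma>. J * real m powr a < real (G.wl (\<beta> t x))} \<le> ennreal b1" if "t \<in> S\<^sub>\<Lambda>" for t
        using tail\<beta>[OF that, of "J * real m powr a"] J cJ[OF m_pos] Y m_pos by (simp add: b1_def)
      have t2: "emeasure M {x\<in>X\<^sub>\<Lambda>. \<tau> < real (L.wl (\<alpha> s x))} \<le> ennreal b2" if "s \<in> S\<^sub>\<Gamma>" for s
        using tail\<alpha>[OF that \<tau>] unfolding c\<tau> b2_def .
      have "N ^ n * b2 \<le> I2 * exp (- (real m powr a))"
      proof -
        have "N ^ n = exp (real n * ln N)" using N by (simp add: exp_of_nat_mult)
        also have "\<dots> \<le> exp (K * real m powr a * ln N)" using n_le N by (simp add: mult_right_mono)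
        finally have "N ^ n * b2 \<le> exp (K * real m powr a * ln N) * b2" using b by (intro mult_right_mono)
        also have "\<dots> = I2 * exp (- (real m powr a))"
          unfolding b2_def B_def by (simp add: algebra_simps exp_add exp_minus field_simps)
        finally show ?thesis .
      qed
      then have "real m * real (card F) * real (card S\<^sub>\<Gamma>) * (N ^ n * b2)
          \<le> real m * real (card F) * real (card S\<^sub>\<Gamma>) * (I2 * exp (- (real m powr a)))"
        by (intro mult_left_mono) auto
      also have "\<dots> = E * (real m * exp (- (real m powr a)))" by (simp add: E_def)
      also have "\<dots> < \<mu> / 4" using m by (intro m1) simp
      also have "real m * real (card F) * real (card S\<^sub>\<Gamma>) * (N ^ n * b2)
          = real m * real (card F) * (N ^ n * real (card S\<^sub>\<Gamma>) * b2)" by simp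
      finally have "real m * real (card F) * (N ^ n * real (card S\<^sub>\<Gamma>) * b2) < \<mu> / 4" .
      moreover have "real m * real (card S\<^sub>\<Lambda>) * b1 < \<mu> / 2"
      proof -
        have "real m * real (card S\<^sub>\<Lambda>) * b1 = real (card S\<^sub>\<Lambda>) * I1 / Y" using m_pos by (simp add: b1_def)
        also have "real (card S\<^sub>\<Lambda>) * I1 = (Y - 1) * \<mu> / 4" using \<mu> by (simp add: Y_def)
        also have "(Y - 1) * \<mu> / 4 / Y < \<mu> / 2"
          using \<mu> Y by (simp add: divide_less_eq algebra_simps add_pos_pos)
        finally show ?thesis .
      qed
      ultimately have small: "real m * real (card S\<^sub>\<Lambda>) * b1 + real m * real (card F) *
         (real (Suc (card (G.symmetrized S\<^sub>\<Gamma>))) ^ n * real (card S\<^sub>\<Gamma>) * b2) < measure M X\<^sub>\<Gamma>"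
        using \<mu> unfolding \<mu>_def N_def by linarith
      obtain f where "large_scale_map A (J * real m powr a) (real n) (2 * real CF + real n * \<tau>) f"
        using coarse_map_exists[OF F CF b(1) t1 \<tau> b(2) t2 A small] by blast
      then have f: "\<And>l. l \<in> carrier \<Lambda> \<Longrightarrow> f l \<in> carrier \<Gamma>"
        "\<And>l s. l \<in> A \<Longrightarrow> s \<in> S\<^sub>\<Lambda> \<Longrightarrow> real (G.word_dist (f l) (f (l \<otimes>\<^bsub>\<Lambda>\<^esub> s))) \<le> J * real m powr a"
        "\<And>l k. l \<in> A \<Longrightarrow> k \<in> A \<Longrightarrow> G.word_dist (f k) (f l) \<le> n \<Longrightarrow>
           real (L.word_dist k l) \<le> 2 * real CF + real n * \<tau>"
        unfolding large_scale_map_def by auto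
      have "real (L.word_dist k l) \<le> C * real m powr (a * (1 + 1 / p))"
        if lk: "l \<in> A" "k \<in> A" "real (G.word_dist (f k) (f l)) \<le> K * real m powr a" for l k
      proof -
        have "G.word_dist (f k) (f l) \<le> n" unfolding n_def using lk(3) by linarith
        then have "real (L.word_dist k l) \<le> 2 * real CF + real n * \<tau>" using f(3) lk by blast
        also have "real n * \<tau> \<le> K * real m powr a * \<tau>" using n_le \<tau> by (rule mult_right_mono)
        also have "K * real m powr a * \<tau> = K * B powr (1 / p) / c * real m powr (a * (1 + 1 / p))"
          unfolding \<tau>_def using B by (simp add: powr_mult powr_powr powr_add distrib_left)
        also have "2 * real CF \<le> 2 * real CF * real m powr (a * (1 + 1 / p))"
          using ge_one_powr_ge_zero[of "real m" "a * (1 + 1 / p)"] m_pos a p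
          by (simp add: mult_le_cancel_left1)
        finally show ?thesis unfolding C_def by (simp add: distrib_right)
      qed
      then show "\<exists>f. large_scale_map A (J * real m powr a) (K * real m powr a) (C * real m powr (a * (1 + 1 / p))) f"
        unfolding large_scale_map_def using f by blast
    qed
  qed
  then show ?thesis using J by (intro exI[of _ J]) simp
qed

end

lemma sublinear_powr_eventually_less:
  fixes \<theta> C D :: real
  assumes "0 < \<theta>" "\<theta> < 1" "D > 0"
  shows "\<forall>\<^sub>F r in at_top. 2 * C * (D * r) powr \<theta> + 5 < r"
proof -
  have "((\<lambda>r. (D * r) powr \<theta> / r) \<longlongrightarrow> 0) at_top"
    using assms by real_asymp
  moreover have "((\<lambda>r::real. 5 / r) \<longlongrightarrow> 0) at_top" by real_asymp
  ultimately have "((\<lambda>r. 2 * C * ((D * r) powr \<theta> / r) + 5 / r) \<longlongrightarrow> 2 * C * 0 + 0) at_top"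
    by (intro tendsto_intros)
  then have "\<forall>\<^sub>F r in at_top. 2 * C * ((D * r) powr \<theta> / r) + 5 / r < 1"
    by (intro order_tendstoD(2)) auto
  then show ?thesis
    using eventually_gt_at_top[of 0] by eventually_elim (simp add: field_simps)
qed

section \<open>Hyperbolicity of \<open>\<Lambda>\<close>\<close>

context fg_coupling begin

text \<open>A detour in the Cayley graph of \<open>\<Lambda>\<close> is mapped to \<open>\<Gamma>\<close> and contradicts the sublinear error of the
  map. Hyperbolicity of \<open>\<Gamma>\<close> is given for some generating set \<open>S\<close>, whereas integrability is measured
  with \<open>S\<^sub>\<Gamma>\<close>; the constants \<open>k1\<close> and \<open>k2\<close> compare the two word lengths.\<close>

lemma hyperbolic_group_transfer:
  assumes q: "q > 0" "p > q"
    and cob: "cobounded \<Lambda> \<sigma> X\<^sub>\<Gamma> X\<^sub>\<Lambda>"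
    and int: "integrable_coupling (\<lambda>t. exp (t powr p)) (\<lambda>t. t powr (1 + 1 / q))
       \<Gamma> S\<^sub>\<Gamma> \<Lambda> S\<^sub>\<Lambda> M \<rho> \<sigma> X\<^sub>\<Gamma> X\<^sub>\<Lambda>"
    and S: "finite_generating_set \<Gamma> S"
    and hyp: "hyperbolic_space (realization (carrier \<Gamma>) (cayley_edges \<Gamma> S))
                (path_dist (carrier \<Gamma>) (cayley_edges \<Gamma> S))"
  shows "hyperbolic_space (realization (carrier \<Lambda>) (cayley_edges \<Lambda> S\<^sub>\<Lambda>))
           (path_dist (carrier \<Lambda>) (cayley_edges \<Lambda> S\<^sub>\<Lambda>))"
proof (rule ccontr)
  assume nonhyp: "\<not> ?thesis"
  interpret H: fg_group \<Gamma> S by unfold_locales (rule S)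
  interpret CH: graph_distance "carrier \<Gamma>" "cayley_edges \<Gamma> S" H.word_dist by (rule H.graph_distance_cayley)
  interpret CL: graph_distance "carrier \<Lambda>" "cayley_edges \<Lambda> S\<^sub>\<Lambda>" L.word_dist by (rule L.graph_distance_cayley)
  interpret X: geodesic_metric CH.Y CH.pd by unfold_locales (rule CH.geodesic_realization)
  interpret Y: geodesic_metric CL.Y CL.pd by unfold_locales (rule CL.geodesic_realization)
  have p: "p > 0" using q by simp
  obtain k1 where k1: "k1 > 0" "\<And>g. g \<in> carrier \<Gamma> \<Longrightarrow> real (H.wl g) \<le> k1 * real (G.wl g)"
    using G.word_length_comparison[OF S] by blast
  obtain k2 where k2: "k2 > 0" "\<And>g. g \<in> carrier \<Gamma> \<Longrightarrow> real (G.wl g) \<le> k2 * real (H.wl g)"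
    using H.word_length_comparison[OF G.generating] by blast
  obtain \<delta> where \<delta>: "\<delta> \<ge> 0" "delta_hyperbolic \<delta> CH.Y CH.pd"
    using hyp unfolding hyperbolic_space_def by blast
  define a where "a = q / (1 + q)"
  have a: "0 < a" using q by (simp add: a_def)
  have aq: "a * (1 + 1 / q) = 1" unfolding a_def using q by (intro jump_exponent) simp
  define \<theta> where "\<theta> = a * (1 + 1 / p)"
  have \<theta>0: "0 < \<theta>" unfolding \<theta>_def using a p by (simp add: add_pos_pos)
  have "a * (1 + 1 / p) < a * (1 + 1 / q)"
    using a p q by (intro mult_strict_left_mono) (auto simp: field_simps)
  then have \<theta>1: "\<theta> < 1" using aq by (simp add: \<theta>_def)
  obtain J where J: "J \<ge> 0" and maps: "\<forall>K>0. \<exists>C m0. \<forall>m\<ge>m0. \<forall>A. finite A \<longrightarrow> A \<subseteq> carrier \<Lambda> \<longrightarrow> card A \<le> m \<longrightarrow>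
     (\<exists>f. large_scale_map A (J * real m powr a) (K * real m powr a) (C * real m powr \<theta>) f)"
    using large_scale_maps[OF p q(1) cob int, folded a_def, folded \<theta>_def] by (elim exE conjE)
  \<comment> \<open>\<open>\<kappa> * m powr a\<close> bounds the distance from a geodesic to the image of a path: the first summand comes
    from the logarithmic term, the second one from the jumps of the map.\<close>
  define \<kappa> where "\<kappa> = \<delta> * (1 / (a * ln 2) + 1) + 3 * k1 * J"
  have \<kappa>: "\<kappa> \<ge> 0" unfolding \<kappa>_def using \<delta> a k1 J by simp
  define K where "K = k2 * (2 * \<kappa> + 1)"
  have K: "K > 0" unfolding K_def using k2 \<kappa> by simp
  obtain C m0 where maps': "\<forall>m\<ge>m0. \<forall>A. finite A \<longrightarrow> A \<subseteq> carrier \<Lambda> \<longrightarrow> card A \<le> m \<longrightarrow>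
     (\<exists>f. large_scale_map A (J * real m powr a) (K * real m powr a) (C * real m powr \<theta>) f)"
    using maps[THEN spec, THEN mp, OF K] by (elim exE)
  \<comment> \<open>Rounding points at distance at most 1 to vertices gives elements at distance at most 3. The map is
    controlled along generators only, so it is applied to a 3-neighbourhood \<open>A\<close> of the rounded loop.\<close>
  define B3 where "B3 = {h\<in>carrier \<Lambda>. L.wl h \<le> 3}"
  define NB where "NB = card B3"
  have fB3: "finite B3" unfolding B3_def using L.card_ball_le[of 3] by blast
  have "\<one>\<^bsub>\<Lambda>\<^esub> \<in> B3" by (simp add: B3_def)
  then have NB: "NB \<ge> 1" unfolding NB_def using fB3 by (metis One_nat_def Suc_leI card_gt_0_iff empty_iff)
  define D where "D = 101 * real NB"
  have D: "D > 0" unfolding D_def using NB by simp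
  obtain r0 where r0: "\<And>r. r \<ge> r0 \<Longrightarrow> 2 * max C 0 * (D * r) powr \<theta> + 5 < r"
    using sublinear_powr_eventually_less[OF \<theta>0 \<theta>1 D, of "max C 0"] unfolding eventually_at_top_linorder by blast
  obtain r x y Q q0 n where r: "r \<ge> max 1 (max r0 (real m0))" and Q: "Y.seg Q x y" "q0 \<in> Q"
    and len: "CL.pd x y \<le> 8 * r" "0 < n" "real n \<le> 70 * r"
    and chain: "(x, y) \<in> Y.steps {u\<in>CL.Y. r \<le> CL.pd q0 u} ^^ n"
    using Y.nonhyperbolic_detour[OF nonhyp, of "max 1 (max r0 (real m0))"] by auto
  have r1: "r \<ge> 1" "r \<ge> r0" "r \<ge> real m0" using r by auto
  obtain P where P: "P 0 = x" "P n = y"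
    and Pstep: "\<And>i. i < n \<Longrightarrow> (P i, P (Suc i)) \<in> Y.steps {u\<in>CL.Y. r \<le> CL.pd q0 u}"
    using chain unfolding relpow_fun_conv by blast
  have PY: "P i \<in> CL.Y" "r \<le> CL.pd q0 (P i)" if "i \<le> n" for i
  proof -
    have "P i \<in> {u\<in>CL.Y. r \<le> CL.pd q0 u}"
    proof (cases "i = n")
      case True
      then show ?thesis using Pstep[of "n - 1"] len(2) by (simp add: Y.steps_def)
    next
      case False
      then show ?thesis using Pstep[of i] that by (simp add: Y.steps_def)
    qed
    then show "P i \<in> CL.Y" "r \<le> CL.pd q0 (P i)" by auto
  qed
  define l where "l = CL.pd x y"
  have l: "0 \<le> l" unfolding l_def by simp
  obtain c where c: "c \<in> {0..l} \<rightarrow> CL.Y" "c 0 = x" "c l = y" "Q = c ` {0..l}"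
    and iso: "\<And>s t. s \<in> {0..l} \<Longrightarrow> t \<in> {0..l} \<Longrightarrow> CL.pd (c s) (c t) = \<bar>s - t\<bar>"
    using Y.seg_parametrization[OF Q(1)] unfolding l_def by metis
  define k where "k = nat \<lceil>l\<rceil>"
  define cQ where "cQ i = c (min (real i) l)" for i :: nat
  have mem: "min (real i) l \<in> {0..l}" for i :: nat using l by auto
  have cQY: "cQ i \<in> CL.Y" for i unfolding cQ_def using c(1) mem by blast
  have cQd: "CL.pd (cQ i) (cQ j) = \<bar>min (real i) l - min (real j) l\<bar>" for i j
    unfolding cQ_def by (rule iso[OF mem mem])
  have k: "l \<le> real k" "real k \<le> 8 * r + 1"
    using l len(1) unfolding k_def l_def[symmetric] by linarith+
  have cQ0: "cQ 0 = x" "cQ k = y" unfolding cQ_def using c l k by auto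
  have "\<forall>u\<in>CL.Y. \<exists>g\<in>carrier \<Lambda>. CL.pd u (vertex_point g) \<le> 1" using CL.near_vertex by metis
  then obtain v where v: "\<And>u. u \<in> CL.Y \<Longrightarrow> v u \<in> carrier \<Lambda>"
    "\<And>u. u \<in> CL.Y \<Longrightarrow> CL.pd u (vertex_point (v u)) \<le> 1" by metis
  have wdv: "real (L.word_dist (v u) (v w)) \<le> CL.pd u w + 2" "CL.pd u w \<le> real (L.word_dist (v u) (v w)) + 2"
    if uw: "u \<in> CL.Y" "w \<in> CL.Y" for u w
  proof -
    note Vu = CL.vertex_point_realization[OF v(1)[OF uw(1)]] and Vw = CL.vertex_point_realization[OF v(1)[OF uw(2)]]
    have "CL.pd (vertex_point (v u)) (vertex_point (v w)) \<le> CL.pd u (vertex_point (v u)) + CL.pd u w + CL.pd w (vertex_point (v w))"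
      using Y.triangle[OF Vu uw(1) Vw] Y.triangle[OF uw Vw] Y.commute[of u "vertex_point (v u)"] by linarith
    moreover have "CL.pd u w \<le> CL.pd u (vertex_point (v u)) + CL.pd (vertex_point (v u)) (vertex_point (v w)) + CL.pd w (vertex_point (v w))"
      using Y.triangle[OF uw(1) Vu uw(2)] Y.triangle[OF Vu Vw uw(2)] Y.commute[of w "vertex_point (v w)"] by linarith
    ultimately show "real (L.word_dist (v u) (v w)) \<le> CL.pd u w + 2" "CL.pd u w \<le> real (L.word_dist (v u) (v w)) + 2"
      using v(2)[OF uw(1)] v(2)[OF uw(2)] CL.path_dist_vertices[OF v(1)[OF uw(1)] v(1)[OF uw(2)]] by linarith+
  qed
  define A0 where "A0 = v ` (P ` {..n} \<union> cQ ` {..k})"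
  define A where "A = (\<lambda>(g, h). g \<otimes>\<^bsub>\<Lambda>\<^esub> h) ` (A0 \<times> B3)"
  have A0: "A0 \<subseteq> carrier \<Lambda>" "finite A0" "card A0 \<le> n + k + 2"
  proof -
    show "A0 \<subseteq> carrier \<Lambda>" unfolding A0_def using v(1) PY(1) cQY by auto
    show "finite A0" unfolding A0_def by simp
    have "card A0 \<le> card (P ` {..n} \<union> cQ ` {..k})" unfolding A0_def by (intro card_image_le) simp
    also have "\<dots> \<le> card (P ` {..n}) + card (cQ ` {..k})" by (rule card_Un_le)
    also have "\<dots> \<le> card {..n} + card {..k}" by (intro add_mono card_image_le) auto
    finally show "card A0 \<le> n + k + 2" by simp
  qed
  have A0P: "v (P i) \<in> A0" if "i \<le> n" for i using that by (auto simp: A0_def)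
  have A0Q: "v (cQ i) \<in> A0" if "i \<le> k" for i using that by (auto simp: A0_def)
  have A_near: "u \<in> A" if "g \<in> A0" "u \<in> carrier \<Lambda>" "L.word_dist g u \<le> 3" for g u
  proof -
    have g: "g \<in> carrier \<Lambda>" using that A0 by blast
    have "u = g \<otimes>\<^bsub>\<Lambda>\<^esub> (inv\<^bsub>\<Lambda>\<^esub> g \<otimes>\<^bsub>\<Lambda>\<^esub> u)" using g that by (simp add: L.m_assoc[symmetric])
    then show ?thesis unfolding A_def using that g
      by (intro image_eqI[of _ _ "(g, inv\<^bsub>\<Lambda>\<^esub> g \<otimes>\<^bsub>\<Lambda>\<^esub> u)"]) (auto simp: B3_def L.word_dist_def)
  qed
  have A0A: "A0 \<subseteq> A" using A_near A0(1) by (auto simp: subset_iff)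
  \<comment> \<open>There are at most \<open>(70 * r + 1) + (8 * r + 2)\<close> rounded points, and \<open>r\<close> is at least 1.\<close>
  define m where "m = nat \<lceil>100 * r * real NB\<rceil>"
  have NBr: "r * real NB \<ge> r" using NB r1 by simp
  have m: "100 * (r * real NB) \<le> real m" "real m \<le> D * r"
    unfolding m_def D_def using NBr r1 by (linarith, simp add: algebra_simps, linarith)
  have m_ge: "m \<ge> m0" "m \<ge> 1" "n \<le> m" "k \<le> m"
    using m NBr r1 len k by linarith+
  have fA: "finite A" unfolding A_def using A0 fB3 by blast
  have Ac: "A \<subseteq> carrier \<Lambda>" unfolding A_def B3_def using A0 by auto
  have "card A \<le> m"
  proof -
    have "card A \<le> card A0 * NB" unfolding A_def NB_def card_cartesian_product[symmetric]
      using A0 fB3 by (intro card_image_le) blast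
    also have "\<dots> \<le> (n + k + 2) * NB" using A0 by (intro mult_right_mono) auto
    finally have "real (card A) \<le> real ((n + k + 2) * NB)" by (rule of_nat_mono)
    also have "\<dots> = (real n + real k + 2) * real NB" by (simp add: algebra_simps)
    also have "\<dots> \<le> (100 * r) * real NB" using len k r1 by (intro mult_right_mono) auto
    finally show ?thesis using m(1) by simp
  qed
  from maps'[rule_format, OF m_ge(1) fA Ac this]
  obtain f where "large_scale_map A (J * real m powr a) (K * real m powr a) (C * real m powr \<theta>) f" by blast
  then have f: "\<And>u. u \<in> carrier \<Lambda> \<Longrightarrow> f u \<in> carrier \<Gamma>"
    "\<And>u s. u \<in> A \<Longrightarrow> s \<in> S\<^sub>\<Lambda> \<Longrightarrow> real (G.word_dist (f u) (f (u \<otimes>\<^bsub>\<Lambda>\<^esub> s))) \<le> J * real m powr a"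
    "\<And>u w. u \<in> A \<Longrightarrow> w \<in> A \<Longrightarrow> real (G.word_dist (f w) (f u)) \<le> K * real m powr a \<Longrightarrow>
       real (L.word_dist w u) \<le> C * real m powr \<theta>"
    unfolding large_scale_map_def by blast+
  define JX where "JX = 3 * k1 * J * real m powr a"
  have JX: "JX \<ge> 0" unfolding JX_def using k1 J by simp
  have HG: "real (H.word_dist g h) \<le> k1 * real (G.word_dist g h)" "real (G.word_dist g h) \<le> k2 * real (H.word_dist g h)"
    if "g \<in> carrier \<Gamma>" "h \<in> carrier \<Gamma>" for g h
    unfolding H.word_dist_def G.word_dist_def using k1(2) k2(2) that by simp_all
  have jump: "real (H.word_dist (f g) (f w)) \<le> JX" if gw: "g \<in> A0" "w \<in> carrier \<Lambda>" "L.word_dist g w \<le> 3" for g w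
  proof -
    have g: "g \<in> carrier \<Lambda>" using gw A0 by blast
    have "real (G.word_dist (f g) (f w)) \<le> real (L.word_dist g w) * (J * real m powr a)"
    proof (rule L.lipschitz_along_words[where D = "\<lambda>g h. real (G.word_dist g h)" and n = 3])
      fix u s assume "u \<in> carrier \<Lambda>" "L.word_dist g u \<le> 3" "s \<in> S\<^sub>\<Lambda>"
      then show "real (G.word_dist (f u) (f (u \<otimes>\<^bsub>\<Lambda>\<^esub> s))) \<le> J * real m powr a" using f(2) A_near gw(1) by blast
    next
      fix u v' w assume "u \<in> carrier \<Lambda>" "v' \<in> carrier \<Lambda>" "w \<in> carrier \<Lambda>"
      then show "real (G.word_dist (f u) (f w)) \<le> real (G.word_dist (f u) (f v')) + real (G.word_dist (f v') (f w))"
        using of_nat_mono[OF G.word_dist_triangle[OF f(1) f(1) f(1)]] by simp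
    qed (use g gw f(1) G.word_dist_commute in auto)
    also have "\<dots> \<le> 3 * (J * real m powr a)" using gw(3) J by (intro mult_right_mono) auto
    finally have "k1 * real (G.word_dist (f g) (f w)) \<le> k1 * (3 * (J * real m powr a))"
      using k1(1) by (intro mult_left_mono) auto
    then show ?thesis using HG(1)[OF f(1)[OF g] f(1)[OF gw(2)]] unfolding JX_def by (simp add: mult_ac)
  qed
  define uP where "uP i = vertex_point (f (v (P i)))" for i
  define uQ where "uQ i = vertex_point (f (v (cQ i)))" for i
  define e where "e = nat \<lceil>log 2 (real m)\<rceil>"
  have e: "m \<le> 2 ^ e"
  proof -
    have "real m = 2 powr (log 2 (real m))" using m_ge by simp
    also have "\<dots> \<le> 2 powr (real e)" unfolding e_def by (intro powr_mono) linarith+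
    also have "\<dots> = real (2 ^ e)" by (simp add: powr_realpow)
    finally show ?thesis by (simp only: of_nat_le_iff)
  qed
  have ma: "real m powr a \<ge> 1" using m_ge a by (intro ge_one_powr_ge_zero) auto
  have e_le: "real e \<le> (1 / (a * ln 2) + 1) * real m powr a"
  proof -
    have "0 \<le> log 2 (real m)" using m_ge by simp
    then have "real e \<le> log 2 (real m) + 1" unfolding e_def by linarith
    also have "log 2 (real m) = ln (real m) / ln 2" by (simp add: log_def)
    also have "\<dots> \<le> (real m powr a / a) / ln 2"
      using ln_powr_bound[of "real m" a] m_ge a by (intro divide_right_mono) auto
    finally show ?thesis using ma by (simp add: algebra_simps)
  qed
  define R where "R = \<delta> * real e + JX"
  have R: "2 * R + 1 \<le> (2 * \<kappa> + 1) * real m powr a" "0 \<le> R"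
  proof -
    have "\<delta> * real e \<le> \<delta> * ((1 / (a * ln 2) + 1) * real m powr a)" using e_le \<delta> by (intro mult_left_mono)
    then have "R \<le> \<kappa> * real m powr a" unfolding R_def JX_def \<kappa>_def by (simp add: algebra_simps)
    then show "2 * R + 1 \<le> (2 * \<kappa> + 1) * real m powr a" using ma by (simp add: algebra_simps)
    show "0 \<le> R" unfolding R_def using \<delta> JX by simp
  qed
  define T where "T = max C 0 * (D * r) powr \<theta>"
  have close: "real (L.word_dist g h) \<le> T"
    if gh: "g \<in> A0" "h \<in> A0" "CH.pd (vertex_point (f g)) (vertex_point (f h)) \<le> 2 * R + 1" for g h
  proof -
    have c: "g \<in> carrier \<Lambda>" "h \<in> carrier \<Lambda>" using gh A0 by auto
    have "real (H.word_dist (f g) (f h)) \<le> (2 * \<kappa> + 1) * real m powr a"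
      using gh(3) CH.path_dist_vertices[OF f(1)[OF c(1)] f(1)[OF c(2)]] R by linarith
    then have "k2 * real (H.word_dist (f g) (f h)) \<le> k2 * ((2 * \<kappa> + 1) * real m powr a)"
      using k2(1) by (intro mult_left_mono) auto
    then have "real (G.word_dist (f g) (f h)) \<le> K * real m powr a"
      unfolding K_def using HG(2)[OF f(1)[OF c(1)] f(1)[OF c(2)]] by (simp add: mult_ac)
    then have "real (L.word_dist g h) \<le> C * real m powr \<theta>" using f(3) gh A0A by blast
    also have "\<dots> \<le> max C 0 * (D * r) powr \<theta>"
      using m(2) \<theta>0 by (intro mult_mono powr_mono2) auto
    finally show ?thesis unfolding T_def .
  qed
  have uY: "uP i \<in> CH.Y" if "i \<le> n" for i
    unfolding uP_def using that v PY f by (intro CH.vertex_point_realization) auto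
  have uQY: "uQ i \<in> CH.Y" for i
    unfolding uQ_def using v cQY f by (intro CH.vertex_point_realization) auto
  have uPstep: "CH.pd (uP i) (uP (Suc i)) \<le> JX" if i: "i < n" for i
  proof -
    have "CL.pd (P i) (P (Suc i)) \<le> 1" using Pstep[OF i] by (simp add: Y.steps_def)
    then have "L.word_dist (v (P i)) (v (P (Suc i))) \<le> 3" using wdv(1)[OF PY(1) PY(1), of i "Suc i"] i by simp
    then show ?thesis unfolding uP_def using jump[OF A0P] CH.path_dist_vertices f(1) v(1) PY(1) i by simp
  qed
  have uQstep: "CH.pd (uQ i) (uQ (Suc i)) \<le> JX" if i: "i < k" for i
  proof -
    have "CL.pd (cQ i) (cQ (Suc i)) \<le> 1" unfolding cQd by auto
    then have "L.word_dist (v (cQ i)) (v (cQ (Suc i))) \<le> 3" using wdv(1)[OF cQY cQY, of i "Suc i"] by simp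
    then show ?thesis unfolding uQ_def using jump[OF A0Q] CH.path_dist_vertices f(1) v(1) cQY i by simp
  qed
  \<comment> \<open>The index of the sample point of \<open>Q\<close> next to \<open>q0\<close>.\<close>
  obtain s where s: "s \<in> {0..l}" "q0 = c s" using Q(2) c(4) by blast
  define j where "j = nat \<lfloor>s\<rfloor>"
  have j: "real j \<le> s" "s \<le> real j + 1" unfolding j_def using s(1) by auto
  have jl: "real j \<le> l" using j s by auto
  then have jk: "j \<le> k" using k(1) by simp
  obtain i i' i'' where i: "i \<le> j" "j \<le> i'" "i' \<le> k" "i'' \<le> n"
    and d1: "CH.pd (uQ i) (uQ i') \<le> 2 * R + 1" and d2: "CH.pd (uQ i) (uP i'') \<le> 2 * R"
  proof -
    have ends: "uQ 0 = uP 0" "uQ k = uP n" by (simp_all add: uQ_def uP_def cQ0 P)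
    have len: "k \<le> 2 ^ e" "n \<le> 2 ^ e" using m_ge(3,4) e by (auto intro: le_trans)
    show ?thesis
      using X.paths_fellow_travel[OF \<delta>(2) JX uQY uQstep len(1) uY uPstep len(2) ends jk] that
      unfolding R_def by blast
  qed
  have ik: "i \<le> k" using i by simp
  have "CL.pd (cQ i) (cQ i') \<le> T + 2"
    using wdv(2)[OF cQY cQY, of i i'] close[OF A0Q[OF ik] A0Q[OF i(3)]] d1 unfolding uQ_def by linarith
  then have "\<bar>min (real i) l - min (real i') l\<bar> \<le> T + 2" unfolding cQd .
  moreover have "min (real i) l = real i" "min (real i') l \<ge> real j" using i jl by auto
  \<comment> \<open>Since \<open>Q\<close> is a geodesic, close points of \<open>Q\<close> have close indices; \<open>j\<close> lies between \<open>i\<close> and \<open>i'\<close>.\<close>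
  ultimately have ji: "real j - real i \<le> T + 2" by linarith
  have "CL.pd (cQ i) (cQ j) \<le> T + 2" unfolding cQd using i jl ji by simp
  moreover have "CL.pd q0 (cQ j) \<le> 1"
    unfolding s(2) cQ_def using iso[OF s(1) mem, of j] jl j by simp
  moreover have "CL.pd (cQ i) (P i'') \<le> T + 2"
    using wdv(2)[OF cQY PY(1)[OF i(4)], of i] close[OF A0Q[OF ik] A0P[OF i(4)]] d2 unfolding uQ_def uP_def by linarith
  moreover have "CL.pd q0 (P i'') \<le> CL.pd q0 (cQ j) + CL.pd (cQ i) (cQ j) + CL.pd (cQ i) (P i'')"
  proof -
    have q0Y: "q0 \<in> CL.Y" using Y.seg_subset[OF Q(1)] Q(2) by blast
    show ?thesis
      using Y.triangle[OF q0Y cQY PY(1)[OF i(4)], of j] Y.triangle[OF cQY cQY PY(1)[OF i(4)], of j i]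
        Y.commute[of "cQ i" "cQ j"] by linarith
  qed
  ultimately have "CL.pd q0 (P i'') \<le> 2 * T + 5" by linarith
  moreover have "2 * T + 5 < r" using r0[OF r1(2)] by (simp add: T_def mult.assoc)
  ultimately show False using PY(2)[OF i(4)] by linarith
qed

end

theorem theorem3:
  fixes \<Gamma> :: "('g, 'm) monoid_scheme" and \<Lambda> :: "('l, 'n) monoid_scheme"
    and S\<^sub>\<Gamma> :: "'g set" and S\<^sub>\<Lambda> :: "'l set"
    and M :: "'w measure"
    and \<rho> :: "'g \<Rightarrow> 'w \<Rightarrow> 'w" and \<sigma> :: "'l \<Rightarrow> 'w \<Rightarrow> 'w"
    and X\<^sub>\<Gamma> X\<^sub>\<Lambda> :: "'w set"
    and p q :: real
  assumes "group \<Gamma>" and "finite_generating_set \<Gamma> S\<^sub>\<Gamma>" and "hyperbolic_group \<Gamma>"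
    and "group \<Lambda>" and "finite_generating_set \<Lambda> S\<^sub>\<Lambda>"
    and "p > q" and "q > 0"
    and "me_coupling \<Gamma> \<Lambda> M \<rho> \<sigma> X\<^sub>\<Gamma> X\<^sub>\<Lambda>"
    and "cobounded \<Lambda> \<sigma> X\<^sub>\<Gamma> X\<^sub>\<Lambda>"
    and "integrable_coupling (\<lambda>t. exp (t powr p)) (\<lambda>t. t powr (1 + 1 / q))
           \<Gamma> S\<^sub>\<Gamma> \<Lambda> S\<^sub>\<Lambda> M \<rho> \<sigma> X\<^sub>\<Gamma> X\<^sub>\<Lambda>"
  shows "hyperbolic_group \<Lambda>"
proof -
  interpret fg_coupling \<Gamma> S\<^sub>\<Gamma> \<Lambda> S\<^sub>\<Lambda> M \<rho> \<sigma> X\<^sub>\<Gamma> X\<^sub>\<Lambda>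
    using assms by (intro fg_coupling.intro fg_group.intro fg_group_axioms.intro)
  obtain S where "finite_generating_set \<Gamma> S"
    "hyperbolic_space (realization (carrier \<Gamma>) (cayley_edges \<Gamma> S))
       (path_dist (carrier \<Gamma>) (cayley_edges \<Gamma> S))"
    using assms(3) unfolding hyperbolic_group_def by blast
  then show ?thesis
    unfolding hyperbolic_group_def using hyperbolic_group_transfer assms by blast
qed

end
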